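(* Let $\mathcal R$ and $\mathcal T$ be finite-dimensional operator systems, with base positive cones $\mathcal R_+$ and $\mathcal T_+$. Then $$\mathcal R_+\otimes_{\rm sep}\mathcal T_+=\mathcal R_+\otimes_{{\rm sep}^*}\mathcal T_+$$ if and only if one of the cones $\mathcal R_+$ or $\mathcal T_+$ is simplicial.
   Context: Operator systems are complex $*$-vector spaces with matrix cones $\mathcal M_n(\mathcal R)_+$ and Archimedean order unit; $\mathcal R_+$ is the cone at level $n=1$, a proper cone in the real vector space $\mathcal R_{\rm sa}=\{x\in\mathcal R: x^*=x\}$. For a finite-dimensional operator system $\mathcal R$, $(\mathcal R^d)_+$ is the set of linear functionals $\phi:\mathcal R\to\mathbb C$ with $\phi(y)\ge 0$ for all $y\in\mathcal R_+$. Separability cone: $\mathcal R_+\otimes_{\rm sep}\mathcal T_+=\{\sum_{j=1}^k a_j\otimes b_j : k\in\mathbb N,\ a_j\in\mathcal R_+,\ b_j\in\mathcal T_+\}$. Dual separable cone: $\mathcal R_+\otimes_{{\rm sep}^*}\mathcal T_+=\{x\in(\mathcal R\otimes_{\mathbb C}\mathcal T)_{\rm sa} : (\phi\otimes\psi)(x)\ge 0 \text{ for all }\phi\in(\mathcal R^d)_+,\ \psi\in(\mathcal T^d)_+\}$. A proper (closed, generating, pointed) cone $C$ in a finite-dimensional real vector space $V$ is simplicial if $V$ has a linear basis $B$ such that $C$ is the cone generated by $B$. Here $\mathcal R_+$ and $\mathcal T_+$ are considered as cones in $\mathcal R_{\rm sa}$ and $\mathcal T_{\rm sa}$. *)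

theory Defs
  imports
    "HOL-Analysis.Analysis"
    "HOL-Library.Poly_Mapping"
    "HOL-Library.Complex_Order"
    "Jordan_Normal_Form.Matrix"
begin

section \<open>Complex *-vector spaces\<close>

class scaleC = scaleR +
  fixes scaleC :: "complex \<Rightarrow> 'a \<Rightarrow> 'a"  (infixr \<open>*\<^sub>C\<close> 75)
  assumes scaleR_scaleC: "scaleR r = scaleC (complex_of_real r)"

class complex_vector = scaleC + ab_group_add +
  assumes scaleC_add_right: "a *\<^sub>C (x + y) = a *\<^sub>C x + a *\<^sub>C y"
    and scaleC_add_left: "(a + b) *\<^sub>C x = a *\<^sub>C x + b *\<^sub>C x"
    and scaleC_scaleC: "a *\<^sub>C b *\<^sub>C x = (a * b) *\<^sub>C x"
    and scaleC_one: "1 *\<^sub>C x = x"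

subclass (in complex_vector) real_vector
  by standard (simp_all add: scaleR_scaleC scaleC_add_right scaleC_add_left scaleC_scaleC scaleC_one)

global_interpretation complex_vector:
  vector_space "scaleC :: complex \<Rightarrow> 'a \<Rightarrow> 'a::complex_vector"
  by standard (simp_all add: scaleC_add_right scaleC_add_left scaleC_scaleC scaleC_one)

abbreviation clinear :: "('a::complex_vector \<Rightarrow> 'b::complex_vector) \<Rightarrow> bool"
  where "clinear \<equiv> Vector_Spaces.linear scaleC scaleC"

instantiation complex :: complex_vector
begin
definition scaleC_complex_def [simp]: "c *\<^sub>C (x::complex) = c * x"
instance
  by standard (auto simp: fun_eq_iff scaleR_conv_of_real algebra_simps)
end

class complex_star_vector = complex_vector +
  fixes star :: "'a \<Rightarrow> 'a"
  assumes star_add: "star (x + y) = star x + star y"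
    and star_scaleC: "star (c *\<^sub>C x) = cnj c *\<^sub>C star x"
    and star_star [simp]: "star (star x) = x"

definition selfadjoint :: "'a::complex_star_vector set"
  where "selfadjoint = {x. star x = x}"


section \<open>Operator systems\<close>

definition mat_star :: "'a::complex_star_vector mat \<Rightarrow> 'a mat"
  where "mat_star X = Matrix.mat (dim_col X) (dim_row X) (\<lambda>(i, j). star (X $$ (j, i)))"

text \<open>The matrix \<open>\<alpha>\<^sup>* X \<alpha>\<close>, for a scalar \<open>n \<times> m\<close> matrix \<open>\<alpha>\<close>
  and an \<open>n \<times> n\<close> matrix \<open>X\<close> over the vector space.\<close>

definition compression :: "complex mat \<Rightarrow> 'a::complex_vector mat \<Rightarrow> 'a mat"
  where "compression \<alpha> X =
    Matrix.mat (dim_col \<alpha>) (dim_col \<alpha>) (\<lambda>(i, j).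
      \<Sum>k<dim_row \<alpha>. \<Sum>l<dim_row \<alpha>. (cnj (\<alpha> $$ (k, i)) * \<alpha> $$ (l, j)) *\<^sub>C X $$ (k, l))"

definition diag_unit :: "'a::zero \<Rightarrow> nat \<Rightarrow> 'a mat"
  where "diag_unit e n = Matrix.mat n n (\<lambda>(i, j). if i = j then e else 0)"

text \<open>Abstract operator systems in the sense of Choi and Effros.  The value \<open>M 0\<close> is
  irrelevant: all axioms concern the levels \<open>n \<ge> 1\<close>.\<close>

locale operator_system =
  fixes M :: "nat \<Rightarrow> 'a::complex_star_vector mat set" and e :: 'a
  assumes cone_carrier: "n \<ge> 1 \<Longrightarrow> M n \<subseteq> {X \<in> carrier_mat n n. mat_star X = X}"
    and cone_zero: "n \<ge> 1 \<Longrightarrow> 0\<^sub>m n n \<in> M n"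
    and cone_add: "n \<ge> 1 \<Longrightarrow> X \<in> M n \<Longrightarrow> Y \<in> M n \<Longrightarrow> X + Y \<in> M n"
    and cone_scale: "n \<ge> 1 \<Longrightarrow> X \<in> M n \<Longrightarrow> 0 \<le> r \<Longrightarrow> map_mat (scaleR r) X \<in> M n"
    and cone_pointed: "n \<ge> 1 \<Longrightarrow> X \<in> M n \<Longrightarrow> - X \<in> M n \<Longrightarrow> X = 0\<^sub>m n n"
    and cone_compression: "n \<ge> 1 \<Longrightarrow> m \<ge> 1 \<Longrightarrow> \<alpha> \<in> carrier_mat n m \<Longrightarrow> X \<in> M n
      \<Longrightarrow> compression \<alpha> X \<in> M m"
    and unit_selfadjoint: "star e = e"
    and order_unit: "n \<ge> 1 \<Longrightarrow> X \<in> carrier_mat n n \<Longrightarrow> mat_star X = X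
      \<Longrightarrow> \<exists>r>0. map_mat (scaleR r) (diag_unit e n) - X \<in> M n"
    and archimedean: "n \<ge> 1 \<Longrightarrow> X \<in> carrier_mat n n \<Longrightarrow> mat_star X = X
      \<Longrightarrow> (\<And>r. r > 0 \<Longrightarrow> map_mat (scaleR r) (diag_unit e n) + X \<in> M n) \<Longrightarrow> X \<in> M n"

locale fin_dim_operator_system = operator_system M e
  for M :: "nat \<Rightarrow> 'a::complex_star_vector mat set" and e :: 'a +
  assumes fin_dim: "\<exists>B. finite B \<and> complex_vector.span B = (UNIV :: 'a set)"

definition base_cone :: "(nat \<Rightarrow> 'a mat set) \<Rightarrow> 'a set"
  where "base_cone M = {x. Matrix.mat 1 1 (\<lambda>_. x) \<in> M 1}"

definition dual_cone :: "'a::complex_vector set \<Rightarrow> ('a \<Rightarrow> complex) set"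
  where "dual_cone C = {\<phi>. clinear \<phi> \<and> (\<forall>y\<in>C. 0 \<le> \<phi> y)}"

text \<open>A cone generated by a basis of \<open>V\<close> is automatically closed, generating and pointed,
  so these properties are not listed.  Independence and span are over the reals.\<close>

definition simplicial_cone_in :: "'a::real_vector set \<Rightarrow> 'a set \<Rightarrow> bool"
  where "simplicial_cone_in V C \<longleftrightarrow> (\<exists>B. independent B \<and> span B = V \<and> C = convex_cone hull B)"


section \<open>The algebraic tensor product\<close>

text \<open>The free complex vector space on \<open>'k\<close> is \<open>'k \<Rightarrow>\<^sub>0 complex\<close>.\<close>

definition free_scale :: "complex \<Rightarrow> ('k \<Rightarrow>\<^sub>0 complex) \<Rightarrow> ('k \<Rightarrow>\<^sub>0 complex)"
  where "free_scale c f = Poly_Mapping.map ((*) c) f"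

lemma lookup_free_scale [simp]:
  "Poly_Mapping.lookup (free_scale c f) k = c * Poly_Mapping.lookup f k"
  by (simp add: free_scale_def Poly_Mapping.map.rep_eq when_def)

global_interpretation free: vector_space "free_scale :: complex \<Rightarrow> ('k \<Rightarrow>\<^sub>0 complex) \<Rightarrow> _"
  by standard (auto intro!: poly_mapping_eqI simp: lookup_add algebra_simps)

inductive_set tensor_relations ::
    "(('a::complex_vector \<times> 'b::complex_vector) \<Rightarrow>\<^sub>0 complex) set" where
  add_left: "Poly_Mapping.single (a + a', b) 1 - Poly_Mapping.single (a, b) 1
      - Poly_Mapping.single (a', b) 1 \<in> tensor_relations"
| add_right: "Poly_Mapping.single (a, b + b') 1 - Poly_Mapping.single (a, b) 1
      - Poly_Mapping.single (a, b') 1 \<in> tensor_relations"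
| scale_left: "Poly_Mapping.single (c *\<^sub>C a, b) 1 - free_scale c (Poly_Mapping.single (a, b) 1)
      \<in> tensor_relations"
| scale_right: "Poly_Mapping.single (a, c *\<^sub>C b) 1 - free_scale c (Poly_Mapping.single (a, b) 1)
      \<in> tensor_relations"

definition tensor_eq ::
    "(('a::complex_vector \<times> 'b::complex_vector) \<Rightarrow>\<^sub>0 complex) \<Rightarrow> (('a \<times> 'b) \<Rightarrow>\<^sub>0 complex) \<Rightarrow> bool"
  where "tensor_eq f g \<longleftrightarrow> f - g \<in> free.span tensor_relations"

lemma equivp_tensor_eq: "equivp tensor_eq"
proof (rule equivpI)
  show "reflp tensor_eq"
    by (auto simp: reflp_def tensor_eq_def free.span_zero)
  show "symp tensor_eq"
    unfolding symp_def tensor_eq_def using free.span_neg by fastforce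
  show "transp tensor_eq"
    unfolding transp_def tensor_eq_def using free.span_add by fastforce
qed

quotient_type (overloaded) ('a, 'b) tensor =
    "(('a::complex_vector \<times> 'b::complex_vector) \<Rightarrow>\<^sub>0 complex)" / tensor_eq
  by (rule equivp_tensor_eq)

instantiation tensor :: (complex_vector, complex_vector) complex_vector
begin

lift_definition zero_tensor :: "('a, 'b) tensor" is 0 .

lift_definition plus_tensor :: "('a, 'b) tensor \<Rightarrow> ('a, 'b) tensor \<Rightarrow> ('a, 'b) tensor" is "(+)"
  unfolding tensor_eq_def by (subst add_diff_add) (rule free.span_add)

lift_definition uminus_tensor :: "('a, 'b) tensor \<Rightarrow> ('a, 'b) tensor" is uminus
  unfolding tensor_eq_def by (subst minus_diff_minus) (rule free.span_neg)

lift_definition minus_tensor :: "('a, 'b) tensor \<Rightarrow> ('a, 'b) tensor \<Rightarrow> ('a, 'b) tensor" is "(-)"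
proof -
  fix f f' g g' :: "('a \<times> 'b) \<Rightarrow>\<^sub>0 complex"
  assume "tensor_eq f f'" "tensor_eq g g'"
  then have "(f - f') - (g - g') \<in> free.span tensor_relations"
    unfolding tensor_eq_def by (rule free.span_diff)
  then show "tensor_eq (f - g) (f' - g')"
    unfolding tensor_eq_def by (simp add: algebra_simps)
qed

lift_definition scaleC_tensor :: "complex \<Rightarrow> ('a, 'b) tensor \<Rightarrow> ('a, 'b) tensor" is free_scale
  unfolding tensor_eq_def by (subst free.scale_right_diff_distrib[symmetric]) (rule free.span_scale)

definition scaleR_tensor :: "real \<Rightarrow> ('a, 'b) tensor \<Rightarrow> ('a, 'b) tensor"
  where "scaleR_tensor r = scaleC (complex_of_real r)"

instance
proof
  fix a b c :: "('a, 'b) tensor" and s t :: complex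
  show "a + b + c = a + (b + c)" "a + b = b + a" "0 + a = a" "- a + a = 0" "a - b = a + - b"
    by (transfer, simp add: algebra_simps tensor_eq_def free.span_zero)+
  show "scaleR r = (scaleC (complex_of_real r) :: ('a, 'b) tensor \<Rightarrow> _)" for r
    by (simp add: scaleR_tensor_def)
  show "s *\<^sub>C (a + b) = s *\<^sub>C a + s *\<^sub>C b" "(s + t) *\<^sub>C a = s *\<^sub>C a + t *\<^sub>C a"
      "s *\<^sub>C t *\<^sub>C a = (s * t) *\<^sub>C a" "1 *\<^sub>C a = a"
    by (transfer, simp add: tensor_eq_def free.span_zero free.scale_right_distrib
        free.scale_left_distrib)+
qed

end

lift_definition tensor_mult ::
    "'a::complex_vector \<Rightarrow> 'b::complex_vector \<Rightarrow> ('a, 'b) tensor"  (infixr \<open>\<otimes>\<^sub>C\<close> 70)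
  is "\<lambda>a b. Poly_Mapping.single (a, b) 1" .

text \<open>The involution is determined by \<open>(a \<otimes> b)\<^sup>* = a\<^sup>* \<otimes> b\<^sup>*\<close>; on representatives it sends
  \<open>\<Sum> c\<^sub>i (a\<^sub>i, b\<^sub>i)\<close> to the sum of the \<open>cnj c\<^sub>i (star a\<^sub>i, star b\<^sub>i)\<close>.\<close>

definition free_star ::
    "(('a::complex_star_vector \<times> 'b::complex_star_vector) \<Rightarrow>\<^sub>0 complex) \<Rightarrow> (('a \<times> 'b) \<Rightarrow>\<^sub>0 complex)"
  where "free_star f = Poly_Mapping.map cnj (Poly_Mapping.map_key (map_prod star star) f)"

lemma inj_star_pair: "inj (map_prod star star :: ('a::complex_star_vector \<times> 'b::complex_star_vector) \<Rightarrow> _)"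
  by (intro prod.inj_map injI) (metis star_star)+

lemma lookup_free_star [simp]:
  "Poly_Mapping.lookup (free_star f) p = cnj (Poly_Mapping.lookup f (map_prod star star p))"
  by (simp add: free_star_def Poly_Mapping.map.rep_eq map_key.rep_eq[OF inj_star_pair] when_def)

lemma free_star_add: "free_star (f + g) = free_star f + free_star g"
  by (intro poly_mapping_eqI) (simp add: lookup_add)

lemma free_star_diff: "free_star (f - g) = free_star f - free_star g"
  by (intro poly_mapping_eqI) (simp add: lookup_minus)

lemma free_star_scale: "free_star (free_scale c f) = free_scale (cnj c) (free_star f)"
  by (intro poly_mapping_eqI) simp

lemma free_star_single:
  "free_star (Poly_Mapping.single (a, b) 1) = Poly_Mapping.single (star a, star b) 1"
  by (intro poly_mapping_eqI) (auto simp: lookup_single when_def)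

lemma free_star_span:
  assumes "f \<in> free.span tensor_relations"
  shows "free_star f \<in> free.span tensor_relations"
  using assms
proof (induction rule: free.span_induct_alt)
  case base
  have "free_star (0 :: ('a \<times> 'b) \<Rightarrow>\<^sub>0 complex) = 0" by (intro poly_mapping_eqI) simp
  then show ?case by (simp add: free.span_zero)
next
  case (step c x y)
  from step(1) have "free_star x \<in> tensor_relations"
    by cases (simp_all add: free_star_diff free_star_scale free_star_single star_add star_scaleC
        tensor_relations.intros)
  then show ?case
    using step by (simp add: free_star_add free_star_scale free.span_add free.span_scale free.span_base)
qed

instantiation tensor :: (complex_star_vector, complex_star_vector) complex_star_vector
begin

lift_definition star_tensor :: "('a, 'b) tensor \<Rightarrow> ('a, 'b) tensor" is free_star
  unfolding tensor_eq_def by (subst free_star_diff[symmetric]) (rule free_star_span)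

instance
proof
  fix x y :: "('a, 'b) tensor" and c :: complex
  have inv: "free_star (free_star f) = f" for f :: "('a \<times> 'b) \<Rightarrow>\<^sub>0 complex"
    by (intro poly_mapping_eqI) (auto simp: map_prod_def split: prod.splits)
  show "star (x + y) = star x + star y" "star (c *\<^sub>C x) = cnj c *\<^sub>C star x" "star (star x) = x"
    by (transfer, simp add: tensor_eq_def free.span_zero free_star_add free_star_scale inv)+
qed

end

lemma star_tensor_mult: "star (a \<otimes>\<^sub>C b) = star a \<otimes>\<^sub>C star b"
  by transfer (simp add: free_star_single tensor_eq_def free.span_zero)

lemma tensor_mult_add_left: "(a + a') \<otimes>\<^sub>C b = a \<otimes>\<^sub>C b + a' \<otimes>\<^sub>C b"
  by transfer (use free.span_base[OF tensor_relations.add_left] in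
      \<open>simp add: tensor_eq_def diff_diff_eq\<close>)

lemma tensor_mult_add_right: "a \<otimes>\<^sub>C (b + b') = a \<otimes>\<^sub>C b + a \<otimes>\<^sub>C b'"
  by transfer (use free.span_base[OF tensor_relations.add_right] in
      \<open>simp add: tensor_eq_def diff_diff_eq\<close>)

lemma tensor_mult_scaleC_left: "(c *\<^sub>C a) \<otimes>\<^sub>C b = c *\<^sub>C (a \<otimes>\<^sub>C b)"
  by transfer (simp add: tensor_eq_def free.span_base tensor_relations.scale_left)

lemma tensor_mult_scaleC_right: "a \<otimes>\<^sub>C (c *\<^sub>C b) = c *\<^sub>C (a \<otimes>\<^sub>C b)"
  by transfer (simp add: tensor_eq_def free.span_base tensor_relations.scale_right)

text \<open>The functional \<open>\<phi> \<otimes> \<psi>\<close>; for complex linear \<open>\<phi>\<close> and \<open>\<psi>\<close> it exists and is unique by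
  the lemma \<open>tensor_functional_unique\<close> below.\<close>

definition tensor_functional ::
    "('a::complex_vector \<Rightarrow> complex) \<Rightarrow> ('b::complex_vector \<Rightarrow> complex) \<Rightarrow> ('a, 'b) tensor \<Rightarrow> complex"
  where "tensor_functional \<phi> \<psi> = (THE L. clinear L \<and> (\<forall>a b. L (a \<otimes>\<^sub>C b) = \<phi> a * \<psi> b))"

lemma free_induct [case_names zero add]:
  assumes "P 0" "\<And>c k f. P f \<Longrightarrow> P (free_scale c (Poly_Mapping.single k 1) + f)"
  shows "P (f :: 'k \<Rightarrow>\<^sub>0 complex)"
proof (induction f rule: update_induct)
  case (update f k c)
  then have "Poly_Mapping.update k c f = free_scale c (Poly_Mapping.single k 1) + f"
    by (intro poly_mapping_eqI)
      (auto simp: lookup_update lookup_add lookup_single when_def in_keys_iff)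
  then show ?case using assms(2) update by simp
qed (rule assms(1))

lemma tensor_induct [case_names zero add]:
  assumes "P 0" "\<And>c a b x. P x \<Longrightarrow> P (c *\<^sub>C (a \<otimes>\<^sub>C b) + x)"
  shows "P x"
proof -
  have "P (abs_tensor f)" for f
  proof (induction f rule: free_induct)
    case zero
    then show ?case using assms(1) by (simp add: zero_tensor_def)
  next
    case (add c k f)
    then show ?case using assms(2)[OF add, of c "fst k" "snd k"]
      by (simp add: tensor_mult.abs_eq scaleC_tensor.abs_eq plus_tensor.abs_eq)
  qed
  then show ?thesis by (metis Quotient3_abs_rep Quotient3_tensor)
qed

lemma tensor_functional_unique:
  fixes \<phi> :: "'a::complex_vector \<Rightarrow> complex" and \<psi> :: "'b::complex_vector \<Rightarrow> complex"
  assumes "clinear \<phi>" "clinear \<psi>"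
  shows "\<exists>!L. clinear L \<and> (\<forall>a b. L (a \<otimes>\<^sub>C b) = \<phi> a * \<psi> b)"
proof -
  interpret p: Vector_Spaces.linear scaleC scaleC \<phi> by fact
  interpret q: Vector_Spaces.linear scaleC scaleC \<psi> by fact
  define w where "w k = \<phi> (fst k) * \<psi> (snd k)" for k
  define E where "E f = (\<Sum>k\<in>Poly_Mapping.keys f. Poly_Mapping.lookup f k * w k)"
    for f :: "('a \<times> 'b) \<Rightarrow>\<^sub>0 complex"
  have E: "E f = (\<Sum>k\<in>K. Poly_Mapping.lookup f k * w k)"
    if "finite K" "Poly_Mapping.keys f \<subseteq> K" for f K
    unfolding E_def using that by (intro sum.mono_neutral_left) (auto simp: in_keys_iff)
  have add: "E (f + g) = E f + E g" for f g
    by (subst (1 2 3) E[of "Poly_Mapping.keys f \<union> Poly_Mapping.keys g"])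
      (use keys_add[of f g] in \<open>auto simp: lookup_add algebra_simps sum.distrib\<close>)
  have scale: "E (free_scale c f) = c * E f" for c f
    by (subst (1 2) E[of "Poly_Mapping.keys f"]) (auto simp: in_keys_iff sum_distrib_left mult.assoc)
  have sing: "E (Poly_Mapping.single k 1) = w k" for k
    by (simp add: E_def)
  have minus: "E (f - g) = E f - E g" for f g
    using add[of "f - g" g] by simp
  have rel: "E f = 0" if "f \<in> free.span tensor_relations" for f
    using that
  proof (induction rule: free.span_induct_alt)
    case (step c x y)
    from step(1) have "E x = 0"
      by cases (simp_all add: minus scale sing w_def p.add q.add p.scale q.scale distrib_left distrib_right)
    then show ?case using step by (simp add: add scale)
  qed (simp add: E_def)
  have resp: "tensor_eq f g \<Longrightarrow> E f = E g" for f g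
    using rel minus by (force simp: tensor_eq_def)
  define L where "L x = E (rep_tensor x)" for x
  have Labs: "L (abs_tensor f) = E f" for f
    unfolding L_def by (rule resp) (metis Quotient3_rep_abs Quotient3_tensor equivp_tensor_eq equivp_reflp)
  have ex: "\<exists>f. x = abs_tensor f" for x :: "('a, 'b) tensor"
    by (metis Quotient3_abs_rep Quotient3_tensor)
  have "clinear L"
  proof
    fix x y :: "('a, 'b) tensor" and c
    obtain f g where "x = abs_tensor f" "y = abs_tensor g" using ex by metis
    then show "L (x + y) = L x + L y" "L (c *\<^sub>C x) = c *\<^sub>C L x"
      by (simp_all add: plus_tensor.abs_eq scaleC_tensor.abs_eq Labs add scale)
  qed
  moreover have "L (a \<otimes>\<^sub>C b) = \<phi> a * \<psi> b" for a b
    by (simp add: tensor_mult.abs_eq Labs sing w_def)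
  moreover have "L1 = L2" if "clinear L1" "clinear L2"
    "\<forall>a b. L1 (a \<otimes>\<^sub>C b) = L2 (a \<otimes>\<^sub>C b)" for L1 L2 :: "('a, 'b) tensor \<Rightarrow> complex"
  proof
    interpret l1: Vector_Spaces.linear scaleC scaleC L1 by fact
    interpret l2: Vector_Spaces.linear scaleC scaleC L2 by fact
    show "L1 x = L2 x" for x
      by (induction x rule: tensor_induct)
        (simp_all add: l1.zero l2.zero l1.add l2.add l1.scale l2.scale that)
  qed
  ultimately show ?thesis by metis
qed

lemma tensor_functional_mult:
  fixes \<phi> :: "'a::complex_vector \<Rightarrow> complex" and \<psi> :: "'b::complex_vector \<Rightarrow> complex"
  assumes "clinear \<phi>" "clinear \<psi>"
  shows "tensor_functional \<phi> \<psi> (a \<otimes>\<^sub>C b) = \<phi> a * \<psi> b"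
  using theI'[OF tensor_functional_unique[OF assms]] by (simp add: tensor_functional_def)


section \<open>Separable and dual separable cones\<close>

definition sep_cone ::
    "'a::complex_vector set \<Rightarrow> 'b::complex_vector set \<Rightarrow> ('a, 'b) tensor set"
  where "sep_cone C D =
    {\<Sum>j<k. a j \<otimes>\<^sub>C b j | (k::nat) a b. (\<forall>j<k. a j \<in> C) \<and> (\<forall>j<k. b j \<in> D)}"

definition dual_sep_cone ::
    "'a::complex_star_vector set \<Rightarrow> 'b::complex_star_vector set \<Rightarrow> ('a, 'b) tensor set"
  where "dual_sep_cone C D =
    {x \<in> selfadjoint. \<forall>\<phi>\<in>dual_cone C. \<forall>\<psi>\<in>dual_cone D. 0 \<le> tensor_functional \<phi> \<psi> x}"

end

theory Submission
  imports Defs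
begin

no_notation scalar_prod (infix "\<bullet>" 70)

text \<open>
  Write \<open>C\<close> and \<open>D\<close> for the two cones, in coordinates.  Equality of the separable and the dual
  separable cone fails as soon as there are a tensor \<open>z\<close>, positive on pairs of dual functionals, and a
  tensor \<open>s\<close> of functionals, positive on \<open>C \<times> D\<close>, with negative pairing.

  A kite in \<open>C\<close> consists of \<open>e \<plusminus> x\<close>, \<open>e \<plusminus> y\<close> in \<open>C\<close> and \<open>u \<plusminus> f\<close>, \<open>u \<plusminus> g\<close> in the dual cone.  By the CHSH
  inequality a kite in \<open>C\<close> and a kite in \<open>D\<close> give such positive tensors.  When the kites are tight,
  that is, each functional vanishes at the corresponding point, their pairing is the product of the
  twists \<open>f y - g x\<close> of the two kites, up to a factor and, by exchanging \<open>x\<close> and \<open>y\<close>, up to sign.  If a twist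
  vanishes, then smoothness of \<open>C\<close> at \<open>e \<plusminus> x\<close> either allows a first order perturbation of the twist at no
  first order cost, or makes \<open>z\<close> strictly positive so that it can be decreased.

  Tight kites come from affine diameters: given \<open>e = x\<^sub>1 + x\<^sub>2\<close> and \<open>u = f\<^sub>1 + f\<^sub>2\<close> with \<open>f\<^sub>i\<close> supporting at
  \<open>x\<^sub>i\<close>, a maximum of \<open>\<phi> c / (u c \<cdot> \<phi> e)\<close> over the cone and its dual is a second affine diameter through \<open>e\<close>.
  Suitable \<open>x\<^sub>i\<close>, \<open>f\<^sub>i\<close> exist unless any two exposed rays of the dual cone lie in a common proper face.
  In that case, provided that all proper exposed faces of \<open>C\<close> and of its dual are simplicial, the cone is
  simplicial.  The proviso is harmless, because a negative pairing on a face of \<open>C\<close> or of its dual extends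
  to \<open>C\<close>, and one argues by induction on the dimension.
\<close>

section \<open>Pointed cones and their duals\<close>

text \<open>CHSH leaves no slack. Write ((1, a), (b, 1)) and ((1, a'), (b', 1)) for the values of
  \<open>f\<close>, \<open>g\<close> at \<open>x\<close>, \<open>y\<close> in two tight kites. The
  terms of \<open>e\<close> against \<open>f\<close>, \<open>g\<close> cancel those of
  \<open>u\<close> against \<open>x\<close>, \<open>y\<close>, and what remains of the pairing is 1
  - (4 - (a - b)(a' - b')) / 4. So the constants cancel exactly and the twists alone decide. They
  cannot be assumed nonzero: in a circular cone the quadratic form identifies points with
  functionals and makes every smooth kite untwisted. Hence the perturbations, and hence the demand
  for smooth endpoints. These come from duality: a point exposing a ray of the dual cone has no
  other support.

  The induction must run through the faces of the dual cone as well. Over the four-dimensional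
  cyclic polytope with six vertices there is a nonsimplicial cone in which any two rays lie in a
  common proper face and all proper faces are simplicial; only its dual, with faces over triangular
  prisms, betrays it.\<close>

definition pointed_cone :: "'v::euclidean_space set \<Rightarrow> bool"
  where "pointed_cone C \<longleftrightarrow> closed C \<and> convex_cone C \<and> (\<forall>x\<in>C. - x \<in> C \<longrightarrow> x = 0)"

text \<open>Cones need not span the ambient space; the dual is taken inside their span.\<close>

definition pdual :: "'v::euclidean_space set \<Rightarrow> 'v set"
  where "pdual C = {f \<in> span C. \<forall>c\<in>C. 0 \<le> f \<bullet> c}"

lemma pdualD: "f \<in> pdual C \<Longrightarrow> c \<in> C \<Longrightarrow> 0 \<le> f \<bullet> c"
  by (auto simp: pdual_def)

lemma pdualD': "f \<in> pdual C \<Longrightarrow> c \<in> C \<Longrightarrow> 0 \<le> c \<bullet> f"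
  by (auto simp: pdual_def inner_commute)

lemma pdual_subset_span: "pdual C \<subseteq> span C"
  by (auto simp: pdual_def)

lemma pointed_coneD:
  assumes "pointed_cone C"
  shows "closed C" "convex C" "0 \<in> C" "x \<in> C \<Longrightarrow> y \<in> C \<Longrightarrow> x + y \<in> C"
    "x \<in> C \<Longrightarrow> 0 \<le> r \<Longrightarrow> r *\<^sub>R x \<in> C" "x \<in> C \<Longrightarrow> - x \<in> C \<Longrightarrow> x = 0"
proof -
  have C: "closed C" "convex_cone C" "\<And>x. x \<in> C \<Longrightarrow> - x \<in> C \<Longrightarrow> x = 0"
    using assms by (auto simp: pointed_cone_def)
  show "closed C" "convex C" "0 \<in> C" "x \<in> C \<Longrightarrow> - x \<in> C \<Longrightarrow> x = 0"
    using C convex_cone_contains_0 by (auto simp: convex_cone_def)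
  show "x \<in> C \<Longrightarrow> y \<in> C \<Longrightarrow> x + y \<in> C" "x \<in> C \<Longrightarrow> 0 \<le> r \<Longrightarrow> r *\<^sub>R x \<in> C"
    using C(2) convex_cone_add convex_cone_scaleR by blast+
qed

lemma pointed_cone_sum:
  assumes "pointed_cone C" "\<And>i. i \<in> I \<Longrightarrow> g i \<in> C"
  shows "sum g I \<in> C"
  using assms(2)
proof (induction I rule: infinite_finite_induct)
  case (insert i I)
  then have "g i \<in> C" "sum g I \<in> C" by blast+
  then show ?case using insert(1,2) by (simp add: pointed_coneD(4)[OF assms(1)])
qed (simp_all add: pointed_coneD(3)[OF assms(1)])

text \<open>Used to move functionals into a span: \<open>y\<close> pairs with \<open>span L\<close>
  as \<open>x\<close> does, so a functional found in the ambient space can be replaced by a member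
  of \<open>pdual\<close>.\<close>

lemma orthogonal_projection:
  fixes L :: "'v::euclidean_space set"
  obtains y where "y \<in> span L" "\<And>w. w \<in> span L \<Longrightarrow> w \<bullet> y = w \<bullet> x"
proof -
  obtain y z where "y \<in> span L" "\<And>w. w \<in> span L \<Longrightarrow> z \<bullet> w = 0" "x = y + z"
    using orthogonal_subspace_decomp_exists[of L x] unfolding real_inner_class.orthogonal_def by blast
  then show thesis
    by (intro that[of y]) (auto simp: inner_add_right inner_commute)
qed

lemma orthogonal_to_span_inner:
  assumes "w \<in> span S" "\<And>s. s \<in> S \<Longrightarrow> s \<bullet> x = 0"
  shows "w \<bullet> x = 0"
proof -
  have "subspace {w. w \<bullet> x = 0}"
    by (auto simp: subspace_def inner_add_left)
  moreover have "S \<subseteq> {w. w \<bullet> x = 0}" using assms(2) by blast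
  ultimately show ?thesis using assms(1) span_minimal by blast
qed

lemma span_eq_if_orthogonal_trivial:
  fixes S :: "'v::euclidean_space set"
  assumes "S \<subseteq> span L" "\<And>v. v \<in> span L \<Longrightarrow> (\<And>s. s \<in> S \<Longrightarrow> s \<bullet> v = 0) \<Longrightarrow> v = 0"
  shows "span S = span L"
proof
  show "span S \<subseteq> span L" using assms(1) by (simp add: span_minimal)
  show "span L \<subseteq> span S"
  proof
    fix x assume x: "x \<in> span L"
    obtain y where y: "y \<in> span S" "\<And>w. w \<in> span S \<Longrightarrow> w \<bullet> y = w \<bullet> x"
      by (rule orthogonal_projection) blast
    have "x - y \<in> span L" using x y(1) \<open>span S \<subseteq> span L\<close> by (auto intro: span_diff)
    moreover have "s \<bullet> (x - y) = 0" if "s \<in> S" for s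
      using y(2)[OF span_base[OF that]] by (simp add: inner_diff_right)
    ultimately have "x - y = 0" using assms(2) by blast
    then show "x \<in> span S" using y(1) by simp
  qed
qed

lemma separate_from_closed_cone:
  fixes C :: "'v::euclidean_space set"
  assumes C: "closed C" "convex_cone C" and x: "x \<notin> C"
  obtains a where "a \<bullet> x < 0" "\<And>c. c \<in> C \<Longrightarrow> 0 \<le> a \<bullet> c"
proof -
  have conv: "convex C" using C(2) by (simp add: convex_cone_def)
  obtain a b where ab: "a \<bullet> x < b" "\<And>c. c \<in> C \<Longrightarrow> a \<bullet> c > b"
    using separating_hyperplane_closed_point[OF conv C(1) x] by blast
  have b: "b < 0" using ab(2)[OF convex_cone_contains_0[OF C(2)]] by simp
  have "0 \<le> a \<bullet> c" if "c \<in> C" for c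
  proof (rule ccontr)
    assume neg: "\<not> 0 \<le> a \<bullet> c"
    \<comment> \<open>On this multiple of \<open>c\<close> the functional \<open>a\<close> takes
      exactly the value \<open>b\<close>, against the strict inequality on \<open>C\<close>.\<close>
    then have "(b / (a \<bullet> c)) *\<^sub>R c \<in> C"
      using b that by (intro convex_cone_scaleR[OF C(2)]) (auto simp: divide_simps)
    from ab(2)[OF this] neg show False by simp
  qed
  then show thesis using that ab(1) b by force
qed

text \<open>An ambient functional separating \<open>x\<close> from \<open>C\<close> still does so
  after projection to \<open>span C\<close>, and the projection lies in
  \<open>pdual C\<close>.\<close>

lemma bipolar:
  assumes C: "pointed_cone C" and x: "x \<in> span C" and pos: "\<And>f. f \<in> pdual C \<Longrightarrow> 0 \<le> f \<bullet> x"
  shows "x \<in> C"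
proof (rule ccontr)
  assume "x \<notin> C"
  moreover have "closed C" "convex_cone C" using C by (auto simp: pointed_cone_def)
  ultimately obtain a where neg: "a \<bullet> x < 0" and nonneg: "\<And>c. c \<in> C \<Longrightarrow> 0 \<le> a \<bullet> c"
    using separate_from_closed_cone by blast
  obtain f where f: "f \<in> span C" "\<And>w. w \<in> span C \<Longrightarrow> w \<bullet> f = w \<bullet> a"
    by (rule orthogonal_projection) blast
  have "f \<in> pdual C"
    using f nonneg by (auto simp: pdual_def inner_commute[of f] inner_commute[of a] span_base)
  from pos[OF this] have "0 \<le> a \<bullet> x" using f(2)[OF x] by (simp add: inner_commute)
  with neg show False by simp
qed

text \<open>A vector of the span orthogonal to the dual lies in \<open>C\<close> together with its
  negative, by \<open>bipolar\<close>; pointedness makes it zero.\<close>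

lemma span_pdual:
  assumes C: "pointed_cone C"
  shows "span (pdual C) = span C"
proof (rule span_eq_if_orthogonal_trivial[OF pdual_subset_span])
  fix v assume v: "v \<in> span C" "\<And>s. s \<in> pdual C \<Longrightarrow> s \<bullet> v = 0"
  have "v \<in> C" "- v \<in> C"
    using v by (auto intro!: bipolar[OF C] simp: span_neg)
  then show "v = 0" using pointed_coneD(6)[OF C] by blast
qed

lemma pointed_cone_pdual:
  assumes C: "pointed_cone C"
  shows "pointed_cone (pdual C)"
proof -
  have "pdual C = span C \<inter> (\<Inter>c\<in>C. {f. c \<bullet> f \<ge> 0})"
    by (auto simp: pdual_def inner_commute)
  then have "closed (pdual C)"
    by (auto intro!: closed_Int closed_INT closed_halfspace_ge)
  moreover have "convex_cone (pdual C)"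
    by (auto simp: convex_cone_iff pdual_def span_zero span_add span_scale inner_add_left)
  moreover have "x = 0" if x: "x \<in> pdual C" "- x \<in> pdual C" for x
  proof -
    have "c \<bullet> x = 0" if "c \<in> C" for c
      using pdualD[OF x(1) that] pdualD[OF x(2) that] by (simp add: inner_commute)
    then have "w \<bullet> x = 0" if "w \<in> span C" for w
      using orthogonal_to_span_inner that by blast
    moreover have "x \<in> span C" using x(1) pdual_subset_span by blast
    ultimately have "x \<bullet> x = 0" by blast
    then show "x = 0" by simp
  qed
  ultimately show ?thesis by (auto simp: pointed_cone_def)
qed

lemma pdual_pdual:
  assumes C: "pointed_cone C"
  shows "pdual (pdual C) = C"
proof
  show "pdual (pdual C) \<subseteq> C"
  proof
    fix x assume x: "x \<in> pdual (pdual C)"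
    then have "x \<in> span C" using pdual_subset_span span_pdual[OF C] by blast
    then show "x \<in> C" by (rule bipolar[OF C]) (rule pdualD'[OF x])
  qed
  show "C \<subseteq> pdual (pdual C)"
  proof
    fix x assume x: "x \<in> C"
    then have "x \<in> span (pdual C)" using span_base span_pdual[OF C] by blast
    moreover have "0 \<le> x \<bullet> f" if "f \<in> pdual C" for f using pdualD'[OF that x] .
    ultimately show "x \<in> pdual (pdual C)" by (auto simp: pdual_def[of "pdual C"])
  qed
qed

text \<open>The witness is the sum of a basis of the span of the dual, chosen inside the dual. If it
  vanishes at \<open>c\<close>, so does each nonnegative summand, and \<open>c\<close> is orthogonal
  to a span that contains it.\<close>

lemma pdual_interior_functional:
  assumes C: "pointed_cone C"
  obtains u where "u \<in> pdual C" "\<And>c. c \<in> C \<Longrightarrow> c \<noteq> 0 \<Longrightarrow> 0 < u \<bullet> c"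
proof -
  obtain B where B: "B \<subseteq> pdual C" "independent B" "pdual C \<subseteq> span B"
    using maximal_independent_subset by blast
  have fin: "finite B" using B(2) by (simp add: independent_imp_finite)
  have u: "\<Sum>B \<in> pdual C"
    by (rule pointed_cone_sum[OF pointed_cone_pdual[OF C]]) (use B(1) in blast)
  have "0 < \<Sum>B \<bullet> c" if c: "c \<in> C" "c \<noteq> 0" for c
  proof (rule ccontr)
    assume "\<not> 0 < \<Sum>B \<bullet> c"
    then have "(\<Sum>b\<in>B. b \<bullet> c) = 0"
      using pdualD[OF u c(1)] by (simp add: inner_sum_left)
    moreover have "0 \<le> b \<bullet> c" if "b \<in> B" for b
      using B(1) that by (intro pdualD[OF _ c(1)]) auto
    ultimately have "\<forall>b\<in>B. b \<bullet> c = 0"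
      using fin by (simp add: sum_nonneg_eq_0_iff)
    then have "w \<bullet> c = 0" if "w \<in> span B" for w
      using orthogonal_to_span_inner that by blast
    moreover have "c \<in> span B"
      using span_base[OF c(1)] span_minimal[OF B(3) subspace_span] span_pdual[OF C] by auto
    ultimately have "c \<bullet> c = 0" by blast
    then show False using c(2) by simp
  qed
  with u that show thesis by blast
qed

section \<open>Exposed faces\<close>

definition cone_face :: "'v::euclidean_space set \<Rightarrow> 'v \<Rightarrow> 'v set"
  where "cone_face C h = {c \<in> C. h \<bullet> c = 0}"

lemma pointed_cone_face:
  assumes C: "pointed_cone C"
  shows "pointed_cone (cone_face C h)"
proof -
  have "cone_face C h = C \<inter> {c. h \<bullet> c = 0}" by (auto simp: cone_face_def)
  then have "closed (cone_face C h)"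
    using pointed_coneD(1)[OF C] by (simp add: closed_Int closed_hyperplane)
  then show ?thesis
    using C by (auto simp: pointed_cone_def convex_cone_iff cone_face_def inner_add_right)
qed

lemma dim_cone_face_less:
  assumes h: "h \<in> span C" "h \<noteq> 0"
  shows "dim (cone_face C h) < dim C"
proof -
  have "span (cone_face C h) \<subset> span C"
  proof
    show "span (cone_face C h) \<subseteq> span C"
      by (intro span_mono) (auto simp: cone_face_def)
    have "h \<bullet> w = 0" if "w \<in> span (cone_face C h)" for w
      using that by (induction rule: span_induct_alt) (auto simp: inner_add_right cone_face_def)
    then have "h \<notin> span (cone_face C h)" using h(2) by fastforce
    then show "span (cone_face C h) \<noteq> span C" using h(1) by blast
  qed
  then show ?thesis by (rule dim_psubset)
qed

definition simplicial :: "'v::euclidean_space set \<Rightarrow> bool"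
  where "simplicial C \<longleftrightarrow> (\<exists>B. independent B \<and> C = convex_cone hull B)"

section \<open>Entangleable pairs of cones\<close>

text \<open>A list of pairs \<open>(p, q)\<close> stands for the tensor \<open>\<Sum> p \<otimes> q\<close>, viewed as a bilinear form by \<open>ev\<close>.\<close>

definition ev :: "('v::euclidean_space \<times> 'w::euclidean_space) list \<Rightarrow> 'v \<Rightarrow> 'w \<Rightarrow> real"
  where "ev Z a b = (\<Sum>(p, q)\<leftarrow>Z. (p \<bullet> a) * (q \<bullet> b))"

definition pairing :: "('v::euclidean_space \<times> 'w::euclidean_space) list \<Rightarrow> ('v \<times> 'w) list \<Rightarrow> real"
  where "pairing S Z = (\<Sum>(s, t)\<leftarrow>S. ev Z s t)"

definition scale_list :: "real \<Rightarrow> ('v::euclidean_space \<times> 'w::euclidean_space) list \<Rightarrow> ('v \<times> 'w) list"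
  where "scale_list r = map (\<lambda>(p, q). (r *\<^sub>R p, q))"

lemma ev_simps [simp]:
  "ev [] a b = 0"
  "ev ((p, q) # Z) a b = (p \<bullet> a) * (q \<bullet> b) + ev Z a b"
  "ev (Y @ Z) a b = ev Y a b + ev Z a b"
  "ev Z (r *\<^sub>R a) b = r * ev Z a b"
  "ev Z a (r *\<^sub>R b) = r * ev Z a b"
  "ev Z 0 b = 0"
  "ev Z a 0 = 0"
  "ev (scale_list r Z) a b = r * ev Z a b"
  "ev (map prod.swap Z) b a = ev Z a b"
  by (induction Z) (auto simp: ev_def scale_list_def algebra_simps)

lemma pairing_simps [simp]:
  "pairing [] Z = 0"
  "pairing ((s, t) # S) Z = ev Z s t + pairing S Z"
  "pairing (R @ S) Z = pairing R Z + pairing S Z"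
  by (auto simp: pairing_def)

lemma pairing_Nil_right [simp]: "pairing S [] = 0"
  by (induction S) auto

lemma pairing_Cons_right [simp]: "pairing S ((p, q) # Z) = ev S p q + pairing S Z"
  by (induction S) (auto simp: inner_commute)

lemma pairing_append_right [simp]: "pairing S (Y @ Z) = pairing S Y + pairing S Z"
  by (induction S) auto

lemma pairing_commute: "pairing S Z = pairing Z S"
  by (induction Z) auto

lemma pairing_scale_right [simp]: "pairing S (scale_list r Z) = r * pairing S Z"
  by (induction S) (auto simp: algebra_simps)

lemma pairing_swap [simp]: "pairing (map prod.swap S) (map prod.swap Z) = pairing S Z"
  by (induction S) auto

lemma continuous_ev: "continuous_on A (\<lambda>x. ev Z (fst x) (snd x))"
  by (induction Z) (auto intro!: continuous_intros)

text \<open>\<open>Z\<close> lies in the dual separable cone, and \<open>S\<close> separates it from the separable cone.\<close>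

definition entangleable :: "'v::euclidean_space set \<Rightarrow> 'w::euclidean_space set \<Rightarrow> bool"
  where "entangleable C D \<longleftrightarrow> (\<exists>Z S. set Z \<subseteq> span C \<times> span D \<and> set S \<subseteq> span C \<times> span D \<and>
    (\<forall>\<phi>\<in>pdual C. \<forall>\<psi>\<in>pdual D. 0 \<le> ev Z \<phi> \<psi>) \<and> (\<forall>c\<in>C. \<forall>d\<in>D. 0 \<le> ev S c d) \<and> pairing S Z < 0)"

lemma entangleableI:
  assumes "set Z \<subseteq> span C \<times> span D" "set S \<subseteq> span C \<times> span D"
    "\<And>\<phi> \<psi>. \<phi> \<in> pdual C \<Longrightarrow> \<psi> \<in> pdual D \<Longrightarrow> 0 \<le> ev Z \<phi> \<psi>"
    "\<And>c d. c \<in> C \<Longrightarrow> d \<in> D \<Longrightarrow> 0 \<le> ev S c d" "pairing S Z < 0"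
  shows "entangleable C D"
  using assms unfolding entangleable_def by blast

lemma entangleableE:
  assumes "entangleable C D"
  obtains Z S where "set Z \<subseteq> span C \<times> span D" "set S \<subseteq> span C \<times> span D"
    "\<And>\<phi> \<psi>. \<phi> \<in> pdual C \<Longrightarrow> \<psi> \<in> pdual D \<Longrightarrow> 0 \<le> ev Z \<phi> \<psi>"
    "\<And>c d. c \<in> C \<Longrightarrow> d \<in> D \<Longrightarrow> 0 \<le> ev S c d" "pairing S Z < 0"
  using assms unfolding entangleable_def by blast

lemma entangleable_swap:
  assumes "entangleable C D"
  shows "entangleable D C"
  using assms
proof (rule entangleableE)
  fix Z S
  assume Z: "set Z \<subseteq> span C \<times> span D" "\<And>\<phi> \<psi>. \<phi> \<in> pdual C \<Longrightarrow> \<psi> \<in> pdual D \<Longrightarrow> 0 \<le> ev Z \<phi> \<psi>"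
    and S: "set S \<subseteq> span C \<times> span D" "\<And>c d. c \<in> C \<Longrightarrow> d \<in> D \<Longrightarrow> 0 \<le> ev S c d" and "pairing S Z < 0"
  then show ?thesis
    by (intro entangleableI[of "map prod.swap Z" _ _ "map prod.swap S"]) auto
qed

lemma entangleable_pdual:
  assumes C: "pointed_cone C" and D: "pointed_cone D" and "entangleable (pdual C) (pdual D)"
  shows "entangleable C D"
  using assms(3)
proof (rule entangleableE)
  fix Z S
  assume "set Z \<subseteq> span (pdual C) \<times> span (pdual D)" "set S \<subseteq> span (pdual C) \<times> span (pdual D)"
    "\<And>\<phi> \<psi>. \<phi> \<in> pdual (pdual C) \<Longrightarrow> \<psi> \<in> pdual (pdual D) \<Longrightarrow> 0 \<le> ev Z \<phi> \<psi>"
    "\<And>c d. c \<in> pdual C \<Longrightarrow> d \<in> pdual D \<Longrightarrow> 0 \<le> ev S c d" "pairing S Z < 0"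
  then show ?thesis
    using span_pdual[OF C] span_pdual[OF D] pdual_pdual[OF C] pdual_pdual[OF D] pairing_commute[of S Z]
    by (intro entangleableI[of S _ _ Z]) auto
qed

text \<open>On the compact part where \<open>f\<close> is at most 0 the function \<open>g\<close>
  has a positive minimum, and \<open>N\<close> is the depth of \<open>f\<close> divided by it. This
  argument serves to extend positivity from a face, to subtract from a strictly positive tensor and
  to move a smooth point.\<close>

lemma compact_penalty:
  fixes f g :: "'x::topological_space \<Rightarrow> real"
  assumes K: "compact K" and f: "continuous_on K f" and g: "continuous_on K g"
    and nonneg: "\<And>x. x \<in> K \<Longrightarrow> 0 \<le> g x" and zero: "\<And>x. x \<in> K \<Longrightarrow> g x = 0 \<Longrightarrow> 0 < f x"
  obtains N where "0 \<le> N" "\<And>x. x \<in> K \<Longrightarrow> 0 \<le> f x + N * g x"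
proof -
  define K0 where "K0 = K \<inter> f -` {..0}"
  have K0: "compact K0"
  proof -
    obtain T where T: "closed T" "T \<inter> K = f -` {..0} \<inter> K"
      using continuous_on_closed_invariant[of K f] f by (metis closed_atMost)
    then show ?thesis using K by (metis K0_def compact_Int_closed inf_commute)
  qed
  show thesis
  proof (cases "K0 = {}")
    case True
    then show thesis by (intro that[of 0]) (force simp: K0_def)+
  next
    case False
    obtain m where m: "m \<in> K0" "\<And>x. x \<in> K0 \<Longrightarrow> g m \<le> g x"
      using continuous_attains_inf[OF K0 False continuous_on_subset[OF g]] by (auto simp: K0_def)
    obtain l where l: "l \<in> K0" "\<And>x. x \<in> K0 \<Longrightarrow> f l \<le> f x"
      using continuous_attains_inf[OF K0 False continuous_on_subset[OF f]] by (auto simp: K0_def)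
    have gm: "0 < g m"
      using m(1) nonneg[of m] zero[of m] by (force simp: K0_def)
    have fl: "f l \<le> 0" using l(1) by (simp add: K0_def)
    show thesis
    proof (rule that[of "- f l / g m"])
      show "0 \<le> - f l / g m" using gm fl by (simp add: divide_nonpos_pos)
      fix x assume x: "x \<in> K"
      show "0 \<le> f x + - f l / g m * g x"
      proof (cases "x \<in> K0")
        case True
        have "- f l / g m * g m \<le> - f l / g m * g x"
          by (intro mult_left_mono m(2) True) (use gm fl in \<open>simp add: divide_nonpos_pos\<close>)
        then show ?thesis using l(2)[OF True] gm by simp
      next
        case False
        then have "0 < f x" using x by (auto simp: K0_def)
        moreover have "0 \<le> - f l / g m * g x"
          using gm fl nonneg[OF x] by (intro mult_nonneg_nonneg) (simp_all add: divide_nonpos_pos)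
        ultimately show ?thesis by simp
      qed
    qed
  qed
qed

text \<open>Bilinearity reduces the claim to pairs of unit vectors, a compact set on which
  \<open>compact_penalty\<close> applies.\<close>

lemma ev_domination:
  fixes C :: "'v::euclidean_space set" and D :: "'w::euclidean_space set"
  assumes C: "pointed_cone C" and D: "pointed_cone D"
    and nonneg: "\<And>c d. c \<in> C \<Longrightarrow> d \<in> D \<Longrightarrow> 0 \<le> ev G c d"
    and zero: "\<And>c d. c \<in> C \<Longrightarrow> d \<in> D \<Longrightarrow> c \<noteq> 0 \<Longrightarrow> d \<noteq> 0 \<Longrightarrow> ev G c d = 0 \<Longrightarrow> 0 < ev F c d"
  obtains N where "0 \<le> N" "\<And>c d. c \<in> C \<Longrightarrow> d \<in> D \<Longrightarrow> 0 \<le> ev F c d + N * ev G c d"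
proof -
  define K where "K = (C \<inter> sphere 0 1) \<times> (D \<inter> sphere 0 1)"
  have "compact K"
    unfolding K_def using pointed_coneD(1)[OF C] pointed_coneD(1)[OF D]
    by (intro compact_Times closed_Int_compact compact_sphere)
  moreover have "0 \<le> ev G (fst x) (snd x)" if "x \<in> K" for x
    using that by (auto simp: K_def nonneg)
  moreover have "0 < ev F (fst x) (snd x)" if "x \<in> K" "ev G (fst x) (snd x) = 0" for x
    using that by (intro zero) (auto simp: K_def)
  ultimately obtain N where N: "0 \<le> N"
      "\<And>x. x \<in> K \<Longrightarrow> 0 \<le> ev F (fst x) (snd x) + N * ev G (fst x) (snd x)"
    using compact_penalty[OF _ continuous_ev continuous_ev] by blast
  show thesis
  proof (rule that[OF N(1)])
    fix c d assume c: "c \<in> C" and d: "d \<in> D"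
    show "0 \<le> ev F c d + N * ev G c d"
    proof (cases "c = 0 \<or> d = 0")
      case False
      define c' where "c' = c /\<^sub>R norm c"
      define d' where "d' = d /\<^sub>R norm d"
      have "(c', d') \<in> K"
        using c d False by (auto simp: K_def c'_def d'_def pointed_coneD(5)[OF C] pointed_coneD(5)[OF D])
      then have "0 \<le> (norm c * norm d) * (ev F c' d' + N * ev G c' d')"
        by (intro mult_nonneg_nonneg) (use N(2) in force)+
      moreover have "c = norm c *\<^sub>R c'" "d = norm d *\<^sub>R d'"
        using False by (auto simp: c'_def d'_def)
      then have "ev F c d = norm c * norm d * ev F c' d'" "ev G c d = norm c * norm d * ev G c' d'"
        using ev_simps(4,5) by (metis mult.assoc)+
      ultimately show ?thesis by (simp add: algebra_simps)
    qed auto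
  qed
qed

text \<open>A functional positive on \<open>cone_face C h \<times> D\<close> becomes positive on \<open>C \<times> D\<close> after adding a large
  multiple of \<open>h \<otimes> w\<close>, which does not change the pairing with tensors over the face.\<close>

lemma entangleable_face:
  fixes C :: "'v::euclidean_space set" and D :: "'w::euclidean_space set"
  assumes C: "pointed_cone C" and D: "pointed_cone D" and h: "h \<in> pdual C"
    and ent: "entangleable (cone_face C h) D"
  shows "entangleable C D"
  using ent
proof (rule entangleableE)
  let ?F = "cone_face C h"
  fix Z S
  assume Z: "set Z \<subseteq> span ?F \<times> span D" "\<And>\<phi> \<psi>. \<phi> \<in> pdual ?F \<Longrightarrow> \<psi> \<in> pdual D \<Longrightarrow> 0 \<le> ev Z \<phi> \<psi>"
    and S: "set S \<subseteq> span ?F \<times> span D" "\<And>c d. c \<in> ?F \<Longrightarrow> d \<in> D \<Longrightarrow> 0 \<le> ev S c d"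
    and neg: "pairing S Z < 0"
  obtain u where u: "u \<in> pdual C" "\<And>c. c \<in> C \<Longrightarrow> c \<noteq> 0 \<Longrightarrow> 0 < u \<bullet> c"
    using pdual_interior_functional[OF C] by blast
  obtain w where w: "w \<in> pdual D" "\<And>d. d \<in> D \<Longrightarrow> d \<noteq> 0 \<Longrightarrow> 0 < w \<bullet> d"
    using pdual_interior_functional[OF D] by blast
  have FC: "span ?F \<subseteq> span C" by (intro span_mono) (auto simp: cone_face_def)
  \<comment> \<open>Adding \<open>\<delta>\<close> times \<open>u \<otimes> w\<close> makes
    \<open>S\<close> strictly positive on nonzero pairs over the face, as
    \<open>ev_domination\<close> requires, while \<open>\<delta>\<close> is small enough to keep the
    pairing negative.\<close>
  obtain \<delta> where \<delta>: "0 < \<delta>" "pairing S Z + \<delta> * ev Z u w < 0"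
  proof (cases "ev Z u w \<le> 0")
    case True
    then show thesis using neg by (intro that[of 1]) auto
  next
    case False
    then show thesis
      using neg by (intro that[of "- pairing S Z / (2 * ev Z u w)"]) (auto simp: field_simps)
  qed
  define S1 where "S1 = (\<delta> *\<^sub>R u, w) # S"
  obtain N where N: "0 \<le> N" "\<And>c d. c \<in> C \<Longrightarrow> d \<in> D \<Longrightarrow> 0 \<le> ev S1 c d + N * ev [(h, w)] c d"
  proof (rule ev_domination[OF C D, of "[(h, w)]" S1])
    show "0 \<le> ev [(h, w)] c d" if "c \<in> C" "d \<in> D" for c d
      using pdualD[OF h] pdualD[OF w(1)] that by simp
    show "0 < ev S1 c d" if "c \<in> C" "d \<in> D" "c \<noteq> 0" "d \<noteq> 0" "ev [(h, w)] c d = 0" for c d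
    proof -
      have "h \<bullet> c = 0" using that w(2)[of d] by auto
      then have "0 \<le> ev S c d" using that by (intro S(2)) (auto simp: cone_face_def)
      moreover have "0 < \<delta> * (u \<bullet> c) * (w \<bullet> d)"
        using \<delta>(1) u(2)[of c] w(2)[of d] that by simp
      ultimately show ?thesis by (simp add: S1_def)
    qed
  qed blast
  have hp: "h \<bullet> p = 0" if "p \<in> span ?F" for p
    using orthogonal_to_span_inner[OF that, of h] by (auto simp: cone_face_def inner_commute)
  have hZ: "ev Z' h w = 0" if "set Z' \<subseteq> span ?F \<times> span D" for Z'
    using that by (induction Z') (auto simp: hp inner_commute[of _ h])
  define S2 where "S2 = (N *\<^sub>R h, w) # S1"
  show ?thesis
  proof (rule entangleableI[of Z C D S2])
    show "set Z \<subseteq> span C \<times> span D" using Z(1) FC by auto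
    show "set S2 \<subseteq> span C \<times> span D"
      using S(1) FC h u(1) w(1) pdual_subset_span[of C] pdual_subset_span[of D]
      by (auto simp: S2_def S1_def intro!: span_scale)
    show "0 \<le> ev S2 c d" if "c \<in> C" "d \<in> D" for c d
      using N(2)[OF that] by (simp add: S2_def algebra_simps)
    show "pairing S2 Z < 0"
      using \<delta>(2) hZ[OF Z(1)] by (simp add: S2_def S1_def)
    \<comment> \<open>\<open>Z\<close> lives over the face, so it sees only the projection of \<phi>
      to the span of the face, and this projection is positive on the face.\<close>
    fix \<phi> \<psi> assume \<phi>: "\<phi> \<in> pdual C" and \<psi>: "\<psi> \<in> pdual D"
    obtain \<phi>' where \<phi>': "\<phi>' \<in> span ?F" "\<And>x. x \<in> span ?F \<Longrightarrow> x \<bullet> \<phi>' = x \<bullet> \<phi>"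
      using orthogonal_projection[of ?F \<phi>] by blast
    have "0 \<le> \<phi>' \<bullet> c" if "c \<in> ?F" for c
      using \<phi>'(2)[OF span_base[OF that]] pdualD'[OF \<phi>, of c] that
      by (simp add: inner_commute cone_face_def)
    then have "\<phi>' \<in> pdual ?F" using \<phi>'(1) by (simp add: pdual_def)
    moreover have "ev Z' \<phi>' \<psi> = ev Z' \<phi> \<psi>" if "set Z' \<subseteq> span ?F \<times> span D" for Z'
      using that by (induction Z') (auto simp: \<phi>'(2))
    ultimately show "0 \<le> ev Z \<phi> \<psi>" using Z(2)[OF _ \<psi>] Z(1) by metis
  qed
qed

section \<open>Kites\<close>

definition kite :: "'v::euclidean_space set \<Rightarrow> 'v \<Rightarrow> 'v \<Rightarrow> 'v \<Rightarrow> 'v \<Rightarrow> 'v \<Rightarrow> 'v \<Rightarrow> bool"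
  where "kite C e x y u f g \<longleftrightarrow>
    e + x \<in> C \<and> e - x \<in> C \<and> e + y \<in> C \<and> e - y \<in> C \<and>
    u + f \<in> pdual C \<and> u - f \<in> pdual C \<and> u + g \<in> pdual C \<and> u - g \<in> pdual C"

text \<open>Grouping as p(r + s) + q(r - s) leaves |r + s| + |r - s|, which is twice the larger of
  |r| and |s|.\<close>

lemma chsh_inequality:
  fixes a b :: real
  assumes "\<bar>p\<bar> \<le> a" "\<bar>q\<bar> \<le> a" "\<bar>r\<bar> \<le> b" "\<bar>s\<bar> \<le> b"
  shows "\<bar>p * r + p * s + q * r - q * s\<bar> \<le> 2 * (a * b)"
proof -
  have "\<bar>p * (r + s)\<bar> \<le> a * \<bar>r + s\<bar>" "\<bar>q * (r - s)\<bar> \<le> a * \<bar>r - s\<bar>"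
    using assms by (auto simp: abs_mult intro!: mult_right_mono)
  then have "\<bar>p * r + p * s + q * r - q * s\<bar> \<le> a * (\<bar>r + s\<bar> + \<bar>r - s\<bar>)"
    by (simp add: algebra_simps)
  also have "\<dots> \<le> a * (2 * b)"
    using assms by (intro mult_left_mono) auto
  finally show ?thesis by simp
qed

text \<open>The factor 1/2 is the inverse of the CHSH bound 2, so the correction never exceeds the
  leading term. The sign \<open>r\<close> is free because tensors of points will use 1 and tensors
  of functionals -1.\<close>

definition kite_tensor :: "real \<Rightarrow> 'v \<Rightarrow> 'v \<Rightarrow> 'v \<Rightarrow> 'w \<Rightarrow> 'w \<Rightarrow> 'w \<Rightarrow> ('v::euclidean_space \<times> 'w::euclidean_space) list"
  where "kite_tensor r e x y e' x' y' =
    [(e, e'), ((r / 2) *\<^sub>R x, x'), ((r / 2) *\<^sub>R x, y'), ((r / 2) *\<^sub>R y, x'), ((- r / 2) *\<^sub>R y, y')]"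

lemma ev_kite_tensor:
  "ev (kite_tensor r e x y e' x' y') a b = (e \<bullet> a) * (e' \<bullet> b) +
    (r / 2) * ((x \<bullet> a) * (x' \<bullet> b) + (x \<bullet> a) * (y' \<bullet> b) + (y \<bullet> a) * (x' \<bullet> b) - (y \<bullet> a) * (y' \<bullet> b))"
  by (simp add: kite_tensor_def algebra_simps)

lemma ev_kite_tensor_nonneg:
  assumes r: "\<bar>r\<bar> = 1"
    and a: "0 \<le> (e + x) \<bullet> a" "0 \<le> (e - x) \<bullet> a" "0 \<le> (e + y) \<bullet> a" "0 \<le> (e - y) \<bullet> a"
    and b: "0 \<le> (e' + x') \<bullet> b" "0 \<le> (e' - x') \<bullet> b" "0 \<le> (e' + y') \<bullet> b" "0 \<le> (e' - y') \<bullet> b"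
  shows "0 \<le> ev (kite_tensor r e x y e' x' y') a b"
proof -
  define T where "T = (x \<bullet> a) * (x' \<bullet> b) + (x \<bullet> a) * (y' \<bullet> b) + (y \<bullet> a) * (x' \<bullet> b) - (y \<bullet> a) * (y' \<bullet> b)"
  have "\<bar>T\<bar> \<le> 2 * ((e \<bullet> a) * (e' \<bullet> b))"
    unfolding T_def using a b by (intro chsh_inequality) (auto simp: inner_add_left inner_diff_left abs_le_iff)
  moreover have "ev (kite_tensor r e x y e' x' y') a b = (e \<bullet> a) * (e' \<bullet> b) + r / 2 * T"
    by (simp only: ev_kite_tensor T_def)
  moreover have "r = 1 \<or> r = - 1" using r by auto
  ultimately show ?thesis by (auto simp: abs_le_iff)
qed

lemma kite_in_span:
  assumes "pointed_cone C" "kite C e x y u f g"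
  shows "e \<in> span C" "x \<in> span C" "y \<in> span C" "u \<in> span C" "f \<in> span C" "g \<in> span C"
proof -
  have *: "e \<in> V \<and> x \<in> V" if "subspace V" "e + x \<in> V" "e - x \<in> V" for V and e x :: 'a
  proof -
    have "(1/2) *\<^sub>R ((e + x) + (e - x)) \<in> V" "(1/2) *\<^sub>R ((e + x) - (e - x)) \<in> V"
      using that by (blast intro: subspace_scale subspace_add subspace_diff)+
    moreover have "(e + x) + (e - x) = 2 *\<^sub>R e" "(e + x) - (e - x) = 2 *\<^sub>R x"
      by (simp_all add: scaleR_2)
    ultimately show ?thesis by simp
  qed
  have C: "c \<in> C \<Longrightarrow> c \<in> span C" "c \<in> pdual C \<Longrightarrow> c \<in> span C" for c
    using span_base pdual_subset_span by blast+
  note k = assms(2)[unfolded kite_def]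
  show "e \<in> span C" "x \<in> span C" "y \<in> span C" "u \<in> span C" "f \<in> span C" "g \<in> span C"
    using *[OF subspace_span[of C] C(1) C(1), of e x] *[OF subspace_span[of C] C(1) C(1), of e y]
      *[OF subspace_span[of C] C(2) C(2), of u f] *[OF subspace_span[of C] C(2) C(2), of u g] k
    by blast+
qed

lemma kite_tensor_positive:
  assumes k: "kite C e x y u f g" "kite D e' x' y' u' f' g'" and r: "\<bar>r\<bar> = 1"
  shows "\<phi> \<in> pdual C \<Longrightarrow> \<psi> \<in> pdual D \<Longrightarrow> 0 \<le> ev (kite_tensor r e x y e' x' y') \<phi> \<psi>"
    and "c \<in> C \<Longrightarrow> d \<in> D \<Longrightarrow> 0 \<le> ev (kite_tensor r u f g u' f' g') c d"
  by (rule ev_kite_tensor_nonneg[OF r]; use k in \<open>auto simp: kite_def intro: pdualD pdualD'\<close>)+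

lemma set_kite_tensor:
  assumes "e \<in> span A" "x \<in> span A" "y \<in> span A" "e' \<in> span B" "x' \<in> span B" "y' \<in> span B"
  shows "set (kite_tensor r e x y e' x' y') \<subseteq> span A \<times> span B"
  using assms by (auto simp: kite_tensor_def intro!: span_scale span_neg)

lemma entangleable_kite:
  assumes C: "pointed_cone C" and D: "pointed_cone D"
    and k: "kite C e x y u f g" "kite D e' x' y' u' f' g'"
    and neg: "pairing (kite_tensor (- 1) u f g u' f' g') (kite_tensor 1 e x y e' x' y') < 0"
  shows "entangleable C D"
proof (rule entangleableI[OF _ _ _ _ neg])
  note in_span = kite_in_span[OF C k(1)] kite_in_span[OF D k(2)]
  show "set (kite_tensor 1 e x y e' x' y') \<subseteq> span C \<times> span D"
    "set (kite_tensor (- 1) u f g u' f' g') \<subseteq> span C \<times> span D"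
    by (intro set_kite_tensor in_span)+
qed (use kite_tensor_positive[OF k] in auto)

text \<open>Under the normalization \<open>u \<bullet> e = 1\<close> the equations say that
  \<open>u + f\<close>, \<open>u - f\<close> vanish at \<open>e - x\<close>, \<open>e + x\<close>
  and that \<open>u + g\<close>, \<open>u - g\<close> vanish at \<open>e - y\<close>,
  \<open>e + y\<close>.\<close>

definition tight_kite :: "'v::euclidean_space set \<Rightarrow> 'v \<Rightarrow> 'v \<Rightarrow> 'v \<Rightarrow> 'v \<Rightarrow> 'v \<Rightarrow> 'v \<Rightarrow> bool"
  where "tight_kite C e x y u f g \<longleftrightarrow> kite C e x y u f g \<and>
    u \<bullet> e = 1 \<and> f \<bullet> x = 1 \<and> g \<bullet> y = 1 \<and> u \<bullet> x = f \<bullet> e \<and> u \<bullet> y = g \<bullet> e"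

lemma tight_kite_swap: "tight_kite C e x y u f g \<longleftrightarrow> tight_kite C e y x u g f"
  by (auto simp: tight_kite_def kite_def)

lemma pairing_tight_kites:
  assumes "tight_kite C e x y u f g" "tight_kite D e' x' y' u' f' g'"
  shows "pairing (kite_tensor (- 1) u f g u' f' g') (kite_tensor 1 e x y e' x' y') =
    (f \<bullet> y - g \<bullet> x) * (f' \<bullet> y' - g' \<bullet> x') / 4"
  using assms
  by (simp add: kite_tensor_def tight_kite_def inner_commute[of e] inner_commute[of x] inner_commute[of y]
      inner_commute[of e'] inner_commute[of x'] inner_commute[of y'] field_simps)

lemma entangleable_twisted_twisted:
  assumes C: "pointed_cone C" and D: "pointed_cone D"
    and k: "tight_kite C e x y u f g" "tight_kite D e' x' y' u' f' g'"
    and tw: "f \<bullet> y \<noteq> g \<bullet> x" "f' \<bullet> y' \<noteq> g' \<bullet> x'"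
  shows "entangleable C D"
proof (cases "(f \<bullet> y - g \<bullet> x) * (f' \<bullet> y' - g' \<bullet> x') < 0")
  case True
  then show ?thesis
    using pairing_tight_kites[OF k] k by (intro entangleable_kite[OF C D]) (auto simp: tight_kite_def)
next
  case False
  moreover have "(f \<bullet> y - g \<bullet> x) * (f' \<bullet> y' - g' \<bullet> x') \<noteq> 0" using tw by simp
  ultimately have "(f \<bullet> y - g \<bullet> x) * (g' \<bullet> x' - f' \<bullet> y') < 0"
    by (simp add: algebra_simps)
  moreover have k': "tight_kite D e' y' x' u' g' f'" using k(2) tight_kite_swap by blast
  ultimately show ?thesis
    using pairing_tight_kites[OF k(1) k'] k(1) k' by (intro entangleable_kite[OF C D]) (auto simp: tight_kite_def)
qed

text \<open>The first two conditions make \<open>e - x\<close> and \<open>e + x\<close> smooth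
  points of \<open>C\<close>, the third puts \<open>e\<close> in the relative interior. Independence
  of \<open>g\<close> supplies a direction seen by \<open>g\<close> but not by \<open>u\<close> and
  \<open>f\<close>. Finally \<open>f \<bullet> e = 0\<close> removes the terms with \<open>f\<close>
  when the tensor of functionals is evaluated at \<open>e\<close> and \<open>e'\<close>.\<close>

definition smooth_kite :: "'v::euclidean_space set \<Rightarrow> 'v \<Rightarrow> 'v \<Rightarrow> 'v \<Rightarrow> 'v \<Rightarrow> 'v \<Rightarrow> 'v \<Rightarrow> bool"
  where "smooth_kite C e x y u f g \<longleftrightarrow> tight_kite C e x y u f g \<and>
    (\<forall>\<phi>\<in>pdual C. \<phi> \<bullet> (e - x) = 0 \<longrightarrow> (\<exists>k. \<phi> = k *\<^sub>R (u + f))) \<and>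
    (\<forall>\<phi>\<in>pdual C. \<phi> \<bullet> (e + x) = 0 \<longrightarrow> (\<exists>k. \<phi> = k *\<^sub>R (u - f))) \<and>
    (\<forall>\<phi>\<in>pdual C. \<phi> \<noteq> 0 \<longrightarrow> 0 < \<phi> \<bullet> e) \<and> g \<notin> span {u, f} \<and> f \<bullet> e = 0"

text \<open>The equality case of CHSH: |p| = a unless r + s = 0, |q| = a unless r - s = 0, and |r +
  s| + |r - s| = 2b. If r + s or r - s does vanish, the last equation gives |r| = |s| = b.\<close>

lemma kite_eq_zero_cases:
  fixes a b :: real
  assumes "\<bar>p\<bar> \<le> a" "\<bar>q\<bar> \<le> a" "\<bar>r\<bar> \<le> b" "\<bar>s\<bar> \<le> b" "0 < a" "0 < b"
    and "2 * (a * b) + (p * r + p * s + q * r - q * s) = 0"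
  shows "(\<bar>p\<bar> = a \<and> \<bar>q\<bar> = a) \<or> (\<bar>r\<bar> = b \<and> \<bar>s\<bar> = b)"
proof (rule ccontr)
  assume neg: "\<not> ?thesis"
  have 1: "- (p * (r + s)) \<le> \<bar>p\<bar> * \<bar>r + s\<bar>" "- (q * (r - s)) \<le> \<bar>q\<bar> * \<bar>r - s\<bar>"
    by (metis abs_ge_minus_self abs_mult)+
  have 2: "\<bar>p\<bar> * \<bar>r + s\<bar> \<le> a * \<bar>r + s\<bar>" "\<bar>q\<bar> * \<bar>r - s\<bar> \<le> a * \<bar>r - s\<bar>"
    using assms by (auto intro!: mult_right_mono)
  have 3: "\<bar>r + s\<bar> + \<bar>r - s\<bar> \<le> 2 * b" using assms by auto
  then have 4: "a * \<bar>r + s\<bar> + a * \<bar>r - s\<bar> \<le> 2 * (a * b)"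
    using assms(5) mult_left_mono[OF 3, of a] by (simp add: algebra_simps)
  have eq: "- (p * (r + s)) + - (q * (r - s)) = 2 * (a * b)"
    using assms(7) by (simp add: algebra_simps)
  have e1: "\<bar>p\<bar> * \<bar>r + s\<bar> = a * \<bar>r + s\<bar>" "\<bar>q\<bar> * \<bar>r - s\<bar> = a * \<bar>r - s\<bar>"
    and e2: "a * \<bar>r + s\<bar> + a * \<bar>r - s\<bar> = 2 * (a * b)"
    using 1 2 4 eq by linarith+
  from e2 have e3: "\<bar>r + s\<bar> + \<bar>r - s\<bar> = 2 * b"
    using assms(5) by (metis distrib_left mult.left_commute mult_left_cancel order_less_irrefl)
  have "r + s = 0 \<or> r - s = 0"
    using neg e1 by auto
  then show False using e3 neg assms by auto
qed

text \<open>Such a functional vanishes at one of \<open>e \<plusminus> x\<close> and one of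
  \<open>e \<plusminus> y\<close>. Smoothness makes it a multiple of \<open>u + f\<close> or
  \<open>u - f\<close>. Without twist \<open>x\<close>, \<open>f\<close> and \<open>y\<close>,
  \<open>g\<close> can trade places, so \<open>u + g\<close> or \<open>u - g\<close> vanishes at the
  other of the points \<open>e \<plusminus> x\<close>; smoothness there puts \<open>g\<close> in the
  span of \<open>u\<close> and \<open>f\<close>.\<close>

lemma smooth_kite_corner:
  assumes C: "pointed_cone C" and k: "smooth_kite C e x y u f g" and untwisted: "f \<bullet> y = g \<bullet> x"
    and \<phi>: "\<phi> \<in> pdual C" "\<phi> \<noteq> 0"
  shows "\<not> (\<bar>x \<bullet> \<phi>\<bar> = e \<bullet> \<phi> \<and> \<bar>y \<bullet> \<phi>\<bar> = e \<bullet> \<phi>)"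
proof
  assume *: "\<bar>x \<bullet> \<phi>\<bar> = e \<bullet> \<phi> \<and> \<bar>y \<bullet> \<phi>\<bar> = e \<bullet> \<phi>"
  have t: "tight_kite C e x y u f g" and g: "g \<notin> span {u, f}"
    and s1: "\<And>\<phi>. \<phi> \<in> pdual C \<Longrightarrow> \<phi> \<bullet> (e - x) = 0 \<Longrightarrow> \<exists>k. \<phi> = k *\<^sub>R (u + f)"
    and s2: "\<And>\<phi>. \<phi> \<in> pdual C \<Longrightarrow> \<phi> \<bullet> (e + x) = 0 \<Longrightarrow> \<exists>k. \<phi> = k *\<^sub>R (u - f)"
    using k by (auto simp: smooth_kite_def)
  have ufg: "g \<in> span {u, f}" if "u + g = k *\<^sub>R (u + s *\<^sub>R f)" for k s
  proof -
    have "k *\<^sub>R (u + s *\<^sub>R f) - u \<in> span {u, f}"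
      by (intro span_diff span_scale span_add span_base) auto
    then show ?thesis using that by (metis add_diff_cancel_left')
  qed
  have ufg': "g \<in> span {u, f}" if "u - g = k *\<^sub>R (u + s *\<^sub>R f)" for k s
  proof -
    have "u - k *\<^sub>R (u + s *\<^sub>R f) \<in> span {u, f}"
      by (intro span_diff span_scale span_add span_base) auto
    then show ?thesis using that by (metis diff_diff_eq2 add_diff_cancel_left')
  qed
  have d: "u + g \<in> pdual C" "u - g \<in> pdual C" using t by (auto simp: tight_kite_def kite_def)
  note t' = t[unfolded tight_kite_def]
  consider "\<phi> \<bullet> (e - x) = 0" | "\<phi> \<bullet> (e + x) = 0"
    using * by (auto simp: abs_if inner_simps inner_commute split: if_splits)
  moreover have \<phi>y: "\<phi> \<bullet> (e + y) = 0 \<or> \<phi> \<bullet> (e - y) = 0"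
    using * by (auto simp: abs_if inner_simps inner_commute split: if_splits)
  ultimately show False
  proof cases
    case 1
    then obtain k where k: "\<phi> = k *\<^sub>R (u + f)" using s1 \<phi>(1) by blast
    then have "k \<noteq> 0" using \<phi>(2) by auto
    have "(u + f) \<bullet> (e + y) = 0 \<or> (u + f) \<bullet> (e - y) = 0"
      using \<phi>y \<open>k \<noteq> 0\<close> unfolding k by auto
    \<comment> \<open>In a tight untwisted kite
      \<open>(u + f) \<bullet> (e + y) = (u + g) \<bullet> (e + x)\<close> and
      \<open>(u + f) \<bullet> (e - y) = (u - g) \<bullet> (e + x)\<close>.\<close>
    then have "(u + g) \<bullet> (e + x) = 0 \<or> (u - g) \<bullet> (e + x) = 0"
      using t' untwisted by (auto simp: inner_simps)
    then show False using s2[OF d(1)] s2[OF d(2)] ufg[of _ "-1"] ufg'[of _ "-1"] g by auto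
  next
    case 2
    then obtain k where k: "\<phi> = k *\<^sub>R (u - f)" using s2 \<phi>(1) by blast
    then have "k \<noteq> 0" using \<phi>(2) by auto
    have "(u - f) \<bullet> (e + y) = 0 \<or> (u - f) \<bullet> (e - y) = 0"
      using \<phi>y \<open>k \<noteq> 0\<close> unfolding k by auto
    then have "(u + g) \<bullet> (e - x) = 0 \<or> (u - g) \<bullet> (e - x) = 0"
      using t' untwisted by (auto simp: inner_simps)
    then show False using s1[OF d(1)] s1[OF d(2)] ufg[of _ 1] ufg'[of _ 1] g by auto
  qed
qed

text \<open>Without corners the equality case of CHSH cannot occur, so \<open>?Z\<close> is strictly
  positive on nonzero pairs and a large multiple of it stays positive after
  \<open>e \<otimes> e'\<close> is subtracted. \<open>?S\<close> pairs to 0 with \<open>?Z\<close>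
  but positively with \<open>e \<otimes> e'\<close>.\<close>

lemma entangleable_untwisted_untwisted:
  assumes C: "pointed_cone C" and D: "pointed_cone D"
    and k: "smooth_kite C e x y u f g" "smooth_kite D e' x' y' u' f' g'"
    and untw: "f \<bullet> y = g \<bullet> x" "f' \<bullet> y' = g' \<bullet> x'"
  shows "entangleable C D"
proof -
  let ?Z = "kite_tensor 1 e x y e' x' y'" and ?S = "kite_tensor (- 1) u f g u' f' g'"
  have t: "tight_kite C e x y u f g" "tight_kite D e' x' y' u' f' g'"
    and e: "\<And>\<phi>. \<phi> \<in> pdual C \<Longrightarrow> \<phi> \<noteq> 0 \<Longrightarrow> 0 < e \<bullet> \<phi>"
    and e': "\<And>\<phi>. \<phi> \<in> pdual D \<Longrightarrow> \<phi> \<noteq> 0 \<Longrightarrow> 0 < e' \<bullet> \<phi>"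
    using k by (auto simp: smooth_kite_def inner_commute)
  have kk: "kite C e x y u f g" "kite D e' x' y' u' f' g'" using t by (auto simp: tight_kite_def)
  have pos: "0 < ev ?Z \<phi> \<psi>" if p: "\<phi> \<in> pdual C" "\<psi> \<in> pdual D" "\<phi> \<noteq> 0" "\<psi> \<noteq> 0" for \<phi> \<psi>
  proof -
    have ge: "0 \<le> ev ?Z \<phi> \<psi>" by (rule kite_tensor_positive(1)[OF kk _ p(1,2)]) simp
    have b: "\<bar>x \<bullet> \<phi>\<bar> \<le> e \<bullet> \<phi>" "\<bar>y \<bullet> \<phi>\<bar> \<le> e \<bullet> \<phi>"
      using kk(1) pdualD'[OF p(1), of "e + x"] pdualD'[OF p(1), of "e - x"]
        pdualD'[OF p(1), of "e + y"] pdualD'[OF p(1), of "e - y"]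
      by (auto simp: kite_def inner_simps abs_le_iff)
    have b': "\<bar>x' \<bullet> \<psi>\<bar> \<le> e' \<bullet> \<psi>" "\<bar>y' \<bullet> \<psi>\<bar> \<le> e' \<bullet> \<psi>"
      using kk(2) pdualD'[OF p(2), of "e' + x'"] pdualD'[OF p(2), of "e' - x'"]
        pdualD'[OF p(2), of "e' + y'"] pdualD'[OF p(2), of "e' - y'"]
      by (auto simp: kite_def inner_simps abs_le_iff)
    have "ev ?Z \<phi> \<psi> \<noteq> 0"
    proof
      assume "ev ?Z \<phi> \<psi> = 0"
      then have "2 * ((e \<bullet> \<phi>) * (e' \<bullet> \<psi>)) + ((x \<bullet> \<phi>) * (x' \<bullet> \<psi>) + (x \<bullet> \<phi>) * (y' \<bullet> \<psi>) +
          (y \<bullet> \<phi>) * (x' \<bullet> \<psi>) - (y \<bullet> \<phi>) * (y' \<bullet> \<psi>)) = 0"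
        unfolding ev_kite_tensor by (simp add: field_simps)
      from kite_eq_zero_cases[OF b b' e[OF p(1,3)] e'[OF p(2,4)] this]
      show False
        using smooth_kite_corner[OF C k(1) untw(1) p(1,3)] smooth_kite_corner[OF D k(2) untw(2) p(2,4)]
        by blast
    qed
    with ge show ?thesis by simp
  qed
  obtain N where N: "\<And>\<phi> \<psi>. \<phi> \<in> pdual C \<Longrightarrow> \<psi> \<in> pdual D \<Longrightarrow> 0 \<le> ev [(- e, e')] \<phi> \<psi> + N * ev ?Z \<phi> \<psi>"
  proof (rule ev_domination[OF pointed_cone_pdual[OF C] pointed_cone_pdual[OF D], of ?Z "[(- e, e')]"])
    show "0 \<le> ev ?Z \<phi> \<psi>" if "\<phi> \<in> pdual C" "\<psi> \<in> pdual D" for \<phi> \<psi>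
      by (rule kite_tensor_positive(1)[OF kk _ that]) simp
    show "0 < ev [(- e, e')] \<phi> \<psi>"
      if "\<phi> \<in> pdual C" "\<psi> \<in> pdual D" "\<phi> \<noteq> 0" "\<psi> \<noteq> 0" "ev ?Z \<phi> \<psi> = 0" for \<phi> \<psi>
      using pos[OF that(1-4)] that(5) by simp
  qed blast
  \<comment> \<open>Since \<open>f\<close> and \<open>f'\<close> vanish at \<open>e\<close> and
    \<open>e'\<close>, only one \<open>g\<close> term remains beside the leading 1 in
    \<open>ev ?S e e'\<close>; these bounds keep the value at least 1/2.\<close>
  have "\<bar>g \<bullet> e\<bar> \<le> 1" "\<bar>g' \<bullet> e'\<bar> \<le> 1"
  proof -
    have "e + x + (e - x) \<in> C" "e' + x' + (e' - x') \<in> D"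
      using kk pointed_coneD(4)[OF C, of "e + x" "e - x"] pointed_coneD(4)[OF D, of "e' + x'" "e' - x'"]
      by (auto simp: kite_def)
    then have ee: "2 *\<^sub>R e \<in> C" "2 *\<^sub>R e' \<in> D" by (simp_all add: scaleR_2)
    show "\<bar>g \<bullet> e\<bar> \<le> 1"
      using pdualD[OF _ ee(1), of "u + g"] pdualD[OF _ ee(1), of "u - g"] t(1)
      by (auto simp: tight_kite_def kite_def inner_simps abs_le_iff)
    show "\<bar>g' \<bullet> e'\<bar> \<le> 1"
      using pdualD[OF _ ee(2), of "u' + g'"] pdualD[OF _ ee(2), of "u' - g'"] t(2)
      by (auto simp: tight_kite_def kite_def inner_simps abs_le_iff)
  qed
  then have "\<bar>(g \<bullet> e) * (g' \<bullet> e')\<bar> \<le> 1" by (simp add: abs_mult mult_le_one)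
  moreover have "ev ?S e e' = 1 + (g \<bullet> e) * (g' \<bullet> e') / 2"
    using t k by (simp add: ev_kite_tensor tight_kite_def smooth_kite_def)
  ultimately have Se: "0 < ev ?S e e'" by linarith
  have pair: "pairing ?S ?Z = 0"
    using pairing_tight_kites[OF t] untw by simp
  have neg_left: "ev S (- p) q = - ev S p q" for S :: "('a \<times> 'b) list" and p q
    using ev_simps(4)[of S "- 1"] by simp
  note in_span = kite_in_span[OF C kk(1)] kite_in_span[OF D kk(2)]
  show ?thesis
  proof (rule entangleableI[of "(- e, e') # scale_list N ?Z" C D ?S])
    have "set ?Z \<subseteq> span C \<times> span D" using in_span by (intro set_kite_tensor)
    then have "set (scale_list N ?Z) \<subseteq> span C \<times> span D"
      by (auto simp: scale_list_def intro!: span_scale)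
    then show "set ((- e, e') # scale_list N ?Z) \<subseteq> span C \<times> span D"
      using in_span by (auto simp: span_neg)
    show "set ?S \<subseteq> span C \<times> span D" using in_span by (intro set_kite_tensor)
    show "0 \<le> ev ((- e, e') # scale_list N ?Z) \<phi> \<psi>" if "\<phi> \<in> pdual C" "\<psi> \<in> pdual D" for \<phi> \<psi>
      using N[OF that] by simp
    show "0 \<le> ev ?S c d" if "c \<in> C" "d \<in> D" for c d
      by (rule kite_tensor_positive(2)[OF kk _ that]) simp
    show "pairing ?S ((- e, e') # scale_list N ?Z) < 0"
      using Se pair by (simp add: neg_left)
  qed
qed

text \<open>Functionals vanishing at \<open>p\<close> are multiples of \<open>h\<close>, do not see
  \<open>d\<close>, and are positive on \<open>e\<close>. For all others a multiple of their value
  at \<open>p\<close> makes up for a negative value on the direction, uniformly by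
  compactness.\<close>

lemma smooth_point_perturbation:
  fixes C :: "'v::euclidean_space set"
  assumes C: "pointed_cone C" and p: "p \<in> C" and e: "e \<in> span C" "\<And>\<phi>. \<phi> \<in> pdual C \<Longrightarrow> \<phi> \<noteq> 0 \<Longrightarrow> 0 < \<phi> \<bullet> e"
    and smooth: "\<And>\<phi>. \<phi> \<in> pdual C \<Longrightarrow> \<phi> \<bullet> p = 0 \<Longrightarrow> \<exists>k. \<phi> = k *\<^sub>R h"
    and d: "d \<in> span C" "h \<bullet> d = 0" and "0 < \<epsilon>"
  obtains t0 where "0 < t0" "\<And>t. 0 \<le> t \<Longrightarrow> t \<le> t0 \<Longrightarrow> p + t *\<^sub>R (d + \<epsilon> *\<^sub>R e) \<in> C"
proof -
  let ?K = "pdual C \<inter> sphere 0 1"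
  have "compact ?K"
    using pointed_coneD(1)[OF pointed_cone_pdual[OF C]] by (intro closed_Int_compact compact_sphere)
  moreover have "continuous_on ?K (\<lambda>\<phi>. \<phi> \<bullet> (d + \<epsilon> *\<^sub>R e))" "continuous_on ?K (\<lambda>\<phi>. \<phi> \<bullet> p)"
    by (intro continuous_intros)+
  moreover have "0 < \<phi> \<bullet> (d + \<epsilon> *\<^sub>R e)" if \<phi>: "\<phi> \<in> ?K" "\<phi> \<bullet> p = 0" for \<phi>
  proof -
    obtain k where "\<phi> = k *\<^sub>R h" using smooth[of \<phi>] \<phi> by auto
    then have "\<phi> \<bullet> d = 0" using d(2) by simp
    moreover have "0 < \<phi> \<bullet> e" using \<phi> by (intro e(2)) auto
    ultimately show ?thesis using \<open>0 < \<epsilon>\<close> by (simp add: inner_add_right)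
  qed
  moreover have "0 \<le> \<phi> \<bullet> p" if "\<phi> \<in> ?K" for \<phi> using pdualD[OF _ p] that by blast
  ultimately obtain N where N: "0 \<le> N" "\<And>\<phi>. \<phi> \<in> ?K \<Longrightarrow> 0 \<le> \<phi> \<bullet> (d + \<epsilon> *\<^sub>R e) + N * (\<phi> \<bullet> p)"
    using compact_penalty[of ?K "\<lambda>\<phi>. \<phi> \<bullet> (d + \<epsilon> *\<^sub>R e)" "\<lambda>\<phi>. \<phi> \<bullet> p"] by blast
  show thesis
  \<comment> \<open>This ensures \<open>t * N \<le> 1\<close>: the value at the moved point is then
    \<open>1 - t * N\<close> times the value at \<open>p\<close> plus \<open>t\<close> times the
    penalized form, both nonnegative.\<close>
  proof (rule that[of "1 / (N + 1)"])
    show "0 < 1 / (N + 1)" using N(1) by simp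
    fix t :: real assume t: "0 \<le> t" "t \<le> 1 / (N + 1)"
    then have tN: "t * N \<le> 1" using N(1) by (simp add: field_simps)
    show "p + t *\<^sub>R (d + \<epsilon> *\<^sub>R e) \<in> C"
    proof (rule bipolar[OF C])
      show "p + t *\<^sub>R (d + \<epsilon> *\<^sub>R e) \<in> span C"
        using p d(1) e(1) by (simp add: span_add span_scale span_base)
      fix \<phi> assume \<phi>: "\<phi> \<in> pdual C"
      show "0 \<le> \<phi> \<bullet> (p + t *\<^sub>R (d + \<epsilon> *\<^sub>R e))"
      proof (cases "\<phi> = 0")
        case False
        define \<psi> where "\<psi> = \<phi> /\<^sub>R norm \<phi>"
        have "\<psi> \<in> pdual C"
          unfolding \<psi>_def by (rule pointed_coneD(5)[OF pointed_cone_pdual[OF C] \<phi>]) simp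
        then have K: "\<psi> \<in> ?K" using False by (simp add: \<psi>_def)
        then have "0 \<le> (1 - t * N) * (\<psi> \<bullet> p)" "0 \<le> t * (\<psi> \<bullet> (d + \<epsilon> *\<^sub>R e) + N * (\<psi> \<bullet> p))"
          using N(2)[OF K] tN t(1) pdualD[OF \<open>\<psi> \<in> pdual C\<close> p] by (auto intro: mult_nonneg_nonneg)
        then have "0 \<le> (1 - t * N) * (\<psi> \<bullet> p) + t * (\<psi> \<bullet> (d + \<epsilon> *\<^sub>R e) + N * (\<psi> \<bullet> p))" by simp
        also have "\<dots> = \<psi> \<bullet> (p + t *\<^sub>R (d + \<epsilon> *\<^sub>R e))"
          by (simp add: inner_add_right algebra_simps)
        finally have "0 \<le> norm \<phi> * (\<psi> \<bullet> (p + t *\<^sub>R (d + \<epsilon> *\<^sub>R e)))" by simp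
        moreover have "\<phi> = norm \<phi> *\<^sub>R \<psi>" using False by (simp add: \<psi>_def)
        ultimately show ?thesis by (metis inner_scaleR_left)
      qed simp
    qed
  qed
qed

lemma ev_add_left: "ev S (a + b) q = ev S a q + ev S b q"
  by (induction S) (auto simp: inner_add_right algebra_simps)

text \<open>The pairing starts at 0. Moving \<open>x\<close> by \<open>t * \<sigma>\<close> times a
  direction \<open>d\<close> that \<open>g\<close> sees but \<open>u\<close> and \<open>f\<close> do
  not changes it by -t|w|/4, where \<open>w\<close> is the twist of the second kite. To stay in
  \<open>C\<close> the centre is enlarged by the factor \<open>1 + t * \<epsilon>\<close>, which
  adds only \<open>t * \<epsilon> * K\<close>.\<close>

lemma entangleable_untwisted_twisted:
  fixes C :: "'v::euclidean_space set" and D :: "'w::euclidean_space set"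
  assumes C: "pointed_cone C" and D: "pointed_cone D"
    and k: "smooth_kite C e x y u f g" "tight_kite D e' x' y' u' f' g'"
    and untw: "f \<bullet> y = g \<bullet> x" and tw: "f' \<bullet> y' \<noteq> g' \<bullet> x'"
  shows "entangleable C D"
proof -
  let ?S = "kite_tensor (- 1) u f g u' f' g'"
  have t: "tight_kite C e x y u f g" and g: "g \<notin> span {u, f}"
    and e: "\<And>\<phi>. \<phi> \<in> pdual C \<Longrightarrow> \<phi> \<noteq> 0 \<Longrightarrow> 0 < \<phi> \<bullet> e"
    and s1: "\<And>\<phi>. \<phi> \<in> pdual C \<Longrightarrow> \<phi> \<bullet> (e - x) = 0 \<Longrightarrow> \<exists>k. \<phi> = k *\<^sub>R (u + f)"
    and s2: "\<And>\<phi>. \<phi> \<in> pdual C \<Longrightarrow> \<phi> \<bullet> (e + x) = 0 \<Longrightarrow> \<exists>k. \<phi> = k *\<^sub>R (u - f)"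
    using k(1) by (auto simp: smooth_kite_def)
  have kk: "kite C e x y u f g" using t by (simp add: tight_kite_def)
  note in_span = kite_in_span[OF C kk]
  \<comment> \<open>The rescaled component of \<open>g\<close> orthogonal to \<open>u\<close> and
    \<open>f\<close>; it is nonzero because \<open>g\<close> is not in their span.\<close>
  obtain d where d: "d \<in> span C" "u \<bullet> d = 0" "f \<bullet> d = 0" "g \<bullet> d = 1"
  proof -
    obtain g0 where g0: "g0 \<in> span {u, f}" "\<And>w. w \<in> span {u, f} \<Longrightarrow> w \<bullet> g0 = w \<bullet> g"
      using orthogonal_projection[of "{u, f}" g] by blast
    define r where "r = g - g0"
    have r: "w \<bullet> r = 0" if "w \<in> span {u, f}" for w using g0(2)[OF that] by (simp add: r_def inner_diff_right)
    have "r \<noteq> 0" using g g0(1) by (auto simp: r_def)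
    have gr: "g \<bullet> r = r \<bullet> r" using r[OF g0(1)] by (simp add: r_def inner_diff_left)
    have "span {u, f} \<subseteq> span C" using in_span by (intro span_minimal) auto
    then have "r \<in> span C" using g0(1) in_span(6) by (auto simp: r_def intro!: span_diff)
    then show thesis
      using gr \<open>r \<noteq> 0\<close> r[OF span_base, of u] r[OF span_base, of f]
      by (intro that[of "(1 / (g \<bullet> r)) *\<^sub>R r"]) (auto intro!: span_scale)
  qed
  define w where "w = f' \<bullet> y' - g' \<bullet> x'"
  define \<sigma> where "\<sigma> = sgn w"
  have \<sigma>: "\<sigma> * w = \<bar>w\<bar>" by (simp add: \<sigma>_def sgn_if)
  define K where "K = ev ?S e e'"
  \<comment> \<open>Chosen so that \<open>\<epsilon> * K\<close> is at most |w|/8, half of the first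
    order gain; the \<open>+ 1\<close> covers \<open>K = 0\<close>.\<close>
  define \<epsilon> where "\<epsilon> = \<bar>w\<bar> / (8 * (\<bar>K\<bar> + 1))"
  have w: "\<bar>w\<bar> > 0" using tw by (simp add: w_def)
  then have \<epsilon>: "0 < \<epsilon>" by (simp add: \<epsilon>_def)
  have d': "\<sigma> *\<^sub>R d \<in> span C" "(u - f) \<bullet> (\<sigma> *\<^sub>R d) = 0" "- \<sigma> *\<^sub>R d \<in> span C" "(u + f) \<bullet> (- \<sigma> *\<^sub>R d) = 0"
    using d by (auto simp: inner_simps intro!: span_scale span_neg)
  have mem: "e + x \<in> C" "e - x \<in> C" "e + y \<in> C" "e - y \<in> C" using kk by (auto simp: kite_def)
  obtain t1 where t1: "0 < t1" "\<And>t. 0 \<le> t \<Longrightarrow> t \<le> t1 \<Longrightarrow> (e + x) + t *\<^sub>R (\<sigma> *\<^sub>R d + \<epsilon> *\<^sub>R e) \<in> C"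
    using smooth_point_perturbation[OF C mem(1) in_span(1) e s2 d'(1,2) \<epsilon>] by metis
  obtain t2 where t2: "0 < t2" "\<And>t. 0 \<le> t \<Longrightarrow> t \<le> t2 \<Longrightarrow> (e - x) + t *\<^sub>R (- \<sigma> *\<^sub>R d + \<epsilon> *\<^sub>R e) \<in> C"
    using smooth_point_perturbation[OF C mem(2) in_span(1) e s1 d'(3,4) \<epsilon>] by metis
  define t where "t = min t1 t2"
  have t0: "0 < t" using t1(1) t2(1) by (simp add: t_def)
  have eC: "2 *\<^sub>R e \<in> C" using pointed_coneD(4)[OF C mem(1,2)] by (simp add: scaleR_2)
  have teC: "(t * \<epsilon>) *\<^sub>R e \<in> C"
    using pointed_coneD(5)[OF C eC, of "t * \<epsilon> / 2"] t0 \<epsilon> by simp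
  define E where "E = e + (t * \<epsilon>) *\<^sub>R e"
  define X where "X = x + (t * \<sigma>) *\<^sub>R d"
  have "E + X \<in> C" using t1(2)[of t] t0 by (simp add: t_def E_def X_def algebra_simps)
  moreover have "E - X \<in> C" using t2(2)[of t] t0 by (simp add: t_def E_def X_def algebra_simps)
  moreover have "E + y \<in> C" using pointed_coneD(4)[OF C mem(3) teC] by (simp add: E_def algebra_simps)
  moreover have "E - y \<in> C" using pointed_coneD(4)[OF C mem(4) teC] by (simp add: E_def algebra_simps)
  ultimately have k1: "kite C E X y u f g" using kk by (auto simp: kite_def)
  have k2: "kite D e' x' y' u' f' g'" using k(2) by (simp add: tight_kite_def)
  have "pairing ?S (kite_tensor 1 E X y e' x' y') =
      pairing ?S (kite_tensor 1 e x y e' x' y') + t * \<epsilon> * K + t * \<sigma> / 2 * (ev ?S d x' + ev ?S d y')"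
    by (simp add: kite_tensor_def[of 1] E_def X_def K_def ev_add_left algebra_simps)
  also have "pairing ?S (kite_tensor 1 e x y e' x' y') = 0"
    using pairing_tight_kites[OF \<open>tight_kite C e x y u f g\<close> k(2)] untw by simp
  \<comment> \<open>Only entries with \<open>g\<close> in the first slot survive; they contribute
    -(1 - g' x')/2 and -(f' y' - 1)/2.\<close>
  also have "ev ?S d x' + ev ?S d y' = - w / 2"
    using d k(2) by (simp add: ev_kite_tensor w_def tight_kite_def field_simps)
  finally have "pairing ?S (kite_tensor 1 E X y e' x' y') = t * (\<epsilon> * K - \<bar>w\<bar> / 4)"
    by (simp add: \<sigma>[symmetric] algebra_simps)
  moreover have "\<epsilon> * K < \<bar>w\<bar> / 4"
  proof -
    have "\<epsilon> * K \<le> \<epsilon> * (\<bar>K\<bar> + 1)" using \<epsilon> by (intro mult_left_mono) auto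
    also have "\<dots> = \<bar>w\<bar> / 8" by (simp add: \<epsilon>_def field_simps)
    finally show ?thesis using w by simp
  qed
  ultimately have "pairing ?S (kite_tensor 1 E X y e' x' y') < 0"
    using t0 by (simp add: mult_pos_neg)
  then show ?thesis by (rule entangleable_kite[OF C D k1 k2])
qed

lemma entangleable_smooth_kites:
  assumes C: "pointed_cone C" and D: "pointed_cone D"
    and k: "smooth_kite C e x y u f g" "smooth_kite D e' x' y' u' f' g'"
  shows "entangleable C D"
proof -
  have t: "tight_kite C e x y u f g" "tight_kite D e' x' y' u' f' g'"
    using k by (auto simp: smooth_kite_def)
  show ?thesis
    using entangleable_twisted_twisted[OF C D t] entangleable_untwisted_untwisted[OF C D k]
      entangleable_untwisted_twisted[OF C D k(1) t(2)]
      entangleable_swap[OF entangleable_untwisted_twisted[OF D C k(2) t(1)]] by metis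
qed

section \<open>Simplicial cones\<close>

lemma convex_cone_hull_finite:
  assumes "finite B"
  shows "convex_cone hull B = {\<Sum>b\<in>B. c b *\<^sub>R b | c. \<forall>b\<in>B. (0::real) \<le> c b}" (is "_ = ?S")
proof
  show "convex_cone hull B \<subseteq> ?S"
  proof (rule hull_minimal)
    show "B \<subseteq> ?S"
    proof
      fix b assume b: "b \<in> B"
      have "(\<Sum>b'\<in>B. (if b' = b then 1 else 0) *\<^sub>R b') = (\<Sum>b'\<in>B. if b' = b then b' else 0)"
        by (intro sum.cong) auto
      also have "\<dots> = b" using assms b by simp
      finally show "b \<in> ?S" by (intro CollectI exI[of _ "\<lambda>b'. if b' = b then 1 else 0"]) auto
    qed
    show "convex_cone ?S"
      unfolding convex_cone_iff
    proof (intro conjI ballI allI impI)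
      show "0 \<in> ?S" by (intro CollectI exI[of _ "\<lambda>_. 0"]) auto
      fix x y assume "x \<in> ?S" "y \<in> ?S"
      then obtain c d where "x = (\<Sum>b\<in>B. c b *\<^sub>R b)" "y = (\<Sum>b\<in>B. d b *\<^sub>R b)" "\<forall>b\<in>B. 0 \<le> c b" "\<forall>b\<in>B. 0 \<le> d b"
        by blast
      then show "x + y \<in> ?S"
        by (intro CollectI exI[of _ "\<lambda>b. c b + d b"]) (auto simp: scaleR_add_left sum.distrib)
    next
      fix x and r :: real assume "x \<in> ?S" "0 \<le> r"
      then obtain c where "x = (\<Sum>b\<in>B. c b *\<^sub>R b)" "\<forall>b\<in>B. 0 \<le> c b" by blast
      then show "r *\<^sub>R x \<in> ?S"
        using \<open>0 \<le> r\<close> by (intro CollectI exI[of _ "\<lambda>b. r * c b"]) (auto simp: scaleR_sum_right)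
    qed
  qed
  have "(\<Sum>b\<in>A. c b *\<^sub>R b) \<in> convex_cone hull B" if "A \<subseteq> B" "\<forall>b\<in>B. (0::real) \<le> c b" for c A
    using finite_subset[OF that(1) assms] that
  proof (induction A rule: finite_induct)
    case (insert b A)
    then have "c b *\<^sub>R b \<in> convex_cone hull B"
      by (intro convex_cone_hull_mul hull_inc) auto
    then show ?case using insert by (simp add: convex_cone_hull_add)
  qed (simp add: convex_cone_hull_contains_0)
  then show "?S \<subseteq> convex_cone hull B" by blast
qed

lemma convex_cone_hull_nonneg:
  assumes "x \<in> convex_cone hull B" "\<And>b. b \<in> B \<Longrightarrow> 0 \<le> b \<bullet> w"
  shows "0 \<le> x \<bullet> (w :: 'v::euclidean_space)"
proof -
  have "convex_cone {x. 0 \<le> x \<bullet> w}" by (auto simp: convex_cone_iff inner_add_left)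
  then have "convex_cone hull B \<subseteq> {x. 0 \<le> x \<bullet> w}" using assms(2) by (intro hull_minimal) auto
  then show ?thesis using assms(1) by blast
qed

text \<open>Each \<open>s b\<close> is the component of \<open>b\<close> orthogonal to the span of
  the other basis vectors, rescaled to pair to 1 with \<open>b\<close>.\<close>

lemma dual_family_exists:
  fixes B :: "'v::euclidean_space set"
  assumes B: "independent B"
  obtains s where "\<And>b. b \<in> B \<Longrightarrow> s b \<in> span B" "\<And>b b'. b \<in> B \<Longrightarrow> b' \<in> B \<Longrightarrow> s b \<bullet> b' = (if b = b' then 1 else 0)"
proof -
  have "\<exists>v. v \<in> span B \<and> (\<forall>b'\<in>B. v \<bullet> b' = (if b = b' then 1 else 0))" if b: "b \<in> B" for b
  proof -
    obtain p where p: "p \<in> span (B - {b})" "\<And>w. w \<in> span (B - {b}) \<Longrightarrow> w \<bullet> p = w \<bullet> b"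
      using orthogonal_projection[of "B - {b}" b] by blast
    define r where "r = b - p"
    have nz: "r \<noteq> 0" using p(1) B b by (auto simp: r_def dependent_def)
    have orth: "w \<bullet> r = 0" if "w \<in> span (B - {b})" for w using p(2)[OF that] by (simp add: r_def inner_diff_right)
    have br: "b \<bullet> r = r \<bullet> r" using orth[OF p(1)] by (simp add: r_def inner_diff_left)
    have "r \<in> span B"
      unfolding r_def
      by (rule span_diff[OF span_base[OF b]]) (rule subsetD[OF span_mono p(1)], blast)
    moreover have "r \<bullet> b = r \<bullet> r" using br by (simp add: inner_commute)
    moreover have "r \<bullet> b' = 0" if "b' \<in> B" "b \<noteq> b'" for b'
      using orth[OF span_base, of b'] that by (simp add: inner_commute)
    ultimately show ?thesis
      using nz by (intro exI[of _ "(1 / (r \<bullet> r)) *\<^sub>R r"]) (auto simp: span_scale)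
  qed
  then obtain s where "\<And>b. b \<in> B \<Longrightarrow> s b \<in> span B \<and> (\<forall>b'\<in>B. s b \<bullet> b' = (if b = b' then 1 else 0))"
    by metis
  then show thesis using that by blast
qed

lemma independent_biorthogonal:
  fixes v w :: "'i \<Rightarrow> 'v::euclidean_space"
  assumes "finite I" "\<And>i. i \<in> I \<Longrightarrow> w i \<bullet> v i \<noteq> 0"
    "\<And>i j. i \<in> I \<Longrightarrow> j \<in> I \<Longrightarrow> i \<noteq> j \<Longrightarrow> w i \<bullet> v j = 0"
  shows "independent (v ` I)" "inj_on v I"
proof -
  show inj: "inj_on v I"
  proof (rule inj_onI, rule ccontr)
    fix i j assume "i \<in> I" "j \<in> I" "v i = v j" "i \<noteq> j"
    then show False using assms(2)[of i] assms(3)[of i j] by simp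
  qed
  have "c x = 0" if s: "(\<Sum>x\<in>v ` I. c x *\<^sub>R x) = 0" and x: "x \<in> v ` I" for c x
  proof -
    obtain i where i: "i \<in> I" "x = v i" using x by blast
    have "0 = w i \<bullet> (\<Sum>j\<in>I. c (v j) *\<^sub>R v j)" using s by (simp add: sum.reindex[OF inj])
    also have "\<dots> = (\<Sum>j\<in>I. if j = i then c (v i) * (w i \<bullet> v i) else 0)"
      unfolding inner_sum_right by (intro sum.cong) (use assms(3) i in auto)
    also have "\<dots> = c (v i) * (w i \<bullet> v i)" using assms(1) i by simp
    finally show ?thesis using assms(2) i by simp
  qed
  then show "independent (v ` I)"
    using assms(1) by (intro independent_if_scalars_zero) auto
qed

lemma span_convex_cone_hull: "span (convex_cone hull B) = span (B :: 'v::euclidean_space set)"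
proof
  have "convex_cone (span B)" by (simp add: convex_cone_iff span_zero span_add span_scale)
  then have "convex_cone hull B \<subseteq> span B" by (intro hull_minimal span_superset)
  then show "span (convex_cone hull B) \<subseteq> span B" by (simp add: span_minimal)
  show "span B \<subseteq> span (convex_cone hull B)" by (intro span_mono hull_subset)
qed

text \<open>The dual family of a generating basis generates the dual cone: the coefficients of
  \<open>f\<close> in it are the values \<open>b \<bullet> f\<close>, which are nonnegative.\<close>

lemma simplicial_pdual:
  fixes C :: "'v::euclidean_space set"
  assumes C: "pointed_cone C" and "simplicial C"
  shows "simplicial (pdual C)"
proof -
  obtain B where B: "independent B" "C = convex_cone hull B" using assms(2) by (auto simp: simplicial_def)
  have fin: "finite B" using B(1) by (rule independent_imp_finite)
  have span: "span C = span B" by (simp add: B(2) span_convex_cone_hull)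
  obtain s where s: "\<And>b. b \<in> B \<Longrightarrow> s b \<in> span B"
    "\<And>b b'. b \<in> B \<Longrightarrow> b' \<in> B \<Longrightarrow> s b \<bullet> b' = (if b = b' then 1 else 0)"
    using dual_family_exists[OF B(1)] by blast
  have s2: "b' \<bullet> s b = (if b = b' then 1 else 0)" if "b \<in> B" "b' \<in> B" for b b'
    using s(2)[OF that] by (simp add: inner_commute)
  have s_sum: "b' \<bullet> (\<Sum>b\<in>B. c b *\<^sub>R s b) = c b'" if "b' \<in> B" for b' c
  proof -
    have "b' \<bullet> (\<Sum>b\<in>B. c b *\<^sub>R s b) = (\<Sum>b\<in>B. if b = b' then c b' else 0)"
      unfolding inner_sum_right by (intro sum.cong) (use s2 that in auto)
    then show ?thesis using fin that by simp
  qed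
  have ind: "independent (s ` B)" "inj_on s B"
    using independent_biorthogonal[of B "\<lambda>b. b" s] fin s2 by auto
  have "pdual C = convex_cone hull (s ` B)"
  proof
    show "convex_cone hull (s ` B) \<subseteq> pdual C"
    proof (rule hull_minimal)
      show "convex_cone (pdual C)" using pointed_cone_pdual[OF C] by (simp add: pointed_cone_def)
      have "0 \<le> s b \<bullet> c" if "b \<in> B" "c \<in> C" for b c
        using convex_cone_hull_nonneg[of c B "s b"] that s2 by (simp add: B(2) inner_commute[of "s b"])
      then show "s ` B \<subseteq> pdual C" using s(1) span by (auto simp: pdual_def)
    qed
    show "pdual C \<subseteq> convex_cone hull (s ` B)"
    proof
      fix f assume f: "f \<in> pdual C"
      let ?g = "\<Sum>b\<in>B. (b \<bullet> f) *\<^sub>R s b"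
      have "b \<bullet> (f - ?g) = 0" if "b \<in> B" for b using s_sum[OF that, of "\<lambda>b. b \<bullet> f"] by (simp add: inner_diff_right)
      then have "w \<bullet> (f - ?g) = 0" if "w \<in> span B" for w using orthogonal_to_span_inner that by blast
      moreover have "f - ?g \<in> span B"
        using f s(1) span pdual_subset_span[of C] by (intro span_diff span_sum span_scale) auto
      ultimately have "(f - ?g) \<bullet> (f - ?g) = 0" by blast
      then have fg: "f = ?g" by simp
      have "0 \<le> b \<bullet> f" if "b \<in> B" for b
        using pdualD'[OF f] that by (auto simp: B(2) hull_inc)
      then have "\<forall>x\<in>s ` B. 0 \<le> inv_into B s x \<bullet> f" by (simp add: ind(2))
      moreover have "(\<Sum>x\<in>s ` B. (inv_into B s x \<bullet> f) *\<^sub>R x) = ?g"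
        by (simp add: sum.reindex[OF ind(2)] ind(2))
      from fg[folded this] have "f = (\<Sum>x\<in>s ` B. (inv_into B s x \<bullet> f) *\<^sub>R x)" .
      ultimately show "f \<in> convex_cone hull (s ` B)"
        unfolding convex_cone_hull_finite[OF finite_imageI[OF fin]] mem_Collect_eq
        by (intro exI[of _ "\<lambda>x. inv_into B s x \<bullet> f"] conjI)
    qed
  qed
  then show ?thesis using ind(1) by (auto simp: simplicial_def)
qed

section \<open>Exposed rays\<close>

text \<open>Meant for \<open>D\<close> the dual of a cone \<open>C\<close>: then \<open>x\<close> is
  a point of \<open>C\<close>, and the condition says that \<open>x\<close> is smooth with
  \<open>f\<close> as its only support up to scale.\<close>

definition exposes :: "'v::euclidean_space set \<Rightarrow> 'v \<Rightarrow> 'v \<Rightarrow> bool"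
  where "exposes D x f \<longleftrightarrow> f \<in> D \<and> f \<noteq> 0 \<and> x \<in> pdual D \<and> x \<bullet> f = 0 \<and>
    (\<forall>\<phi>\<in>D. x \<bullet> \<phi> = 0 \<longrightarrow> (\<exists>k. \<phi> = k *\<^sub>R f))"

text \<open>The point of a compact base farthest from a distant centre \<open>M c\<close> is exposed, and it lies on the
  side opposite to that centre.\<close>

lemma exposed_ray_exists:
  fixes D :: "'v::euclidean_space set"
  assumes D: "pointed_cone D" and d: "d \<in> D" "c \<bullet> d < 0"
  obtains f x where "exposes D x f" "c \<bullet> f < 0"
proof -
  obtain e where e: "e \<in> pdual D" "\<And>d. d \<in> D \<Longrightarrow> d \<noteq> 0 \<Longrightarrow> 0 < e \<bullet> d"
    using pdual_interior_functional[OF D] by blast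
  define K where "K = D \<inter> {d. e \<bullet> d = 1}"
  have closedK: "closed K"
    unfolding K_def using pointed_coneD(1)[OF D] closed_hyperplane by (rule closed_Int)
  have scale: "\<phi> /\<^sub>R (e \<bullet> \<phi>) \<in> K" if "\<phi> \<in> D" "\<phi> \<noteq> 0" for \<phi>
    using e(2)[OF that] pointed_coneD(5)[OF D that(1)] by (auto simp: K_def)
  have "d \<noteq> 0" using d(2) by auto
  have "\<exists>R. \<forall>y\<in>K. norm y \<le> R"
  proof -
    let ?S = "D \<inter> sphere 0 1"
    have "compact ?S" using pointed_coneD(1)[OF D] by (intro closed_Int_compact compact_sphere)
    moreover have "continuous_on ?S (\<lambda>y. e \<bullet> y)" by (intro continuous_intros)
    moreover have "d /\<^sub>R norm d \<in> ?S" using pointed_coneD(5)[OF D d(1)] \<open>d \<noteq> 0\<close> by auto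
    then have "?S \<noteq> {}" by blast
    ultimately obtain m where m: "m \<in> ?S" "\<And>y. y \<in> ?S \<Longrightarrow> e \<bullet> m \<le> e \<bullet> y"
      using continuous_attains_inf[of ?S "\<lambda>y. e \<bullet> y"] by blast
    have em: "0 < e \<bullet> m" using m(1) by (intro e(2)) auto
    have "norm y \<le> 1 / (e \<bullet> m)" if y: "y \<in> K" for y
    proof -
      have y': "y \<in> D" "e \<bullet> y = 1" "y \<noteq> 0" using y by (auto simp: K_def)
      have "y /\<^sub>R norm y \<in> ?S" using pointed_coneD(5)[OF D y'(1)] y'(3) by auto
      from m(2)[OF this] have "e \<bullet> m \<le> 1 / norm y" using y' by (simp add: divide_inverse)
      then show ?thesis using em y'(3) by (simp add: field_simps)
    qed
    then show ?thesis by blast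
  qed
  then obtain R where R: "\<And>y. y \<in> K \<Longrightarrow> norm y \<le> R" by blast
  then have compactK: "compact K" using closedK by (meson bounded_iff compact_eq_bounded_closed)
  define d' where "d' = d /\<^sub>R (e \<bullet> d)"
  have d'K: "d' \<in> K" unfolding d'_def by (rule scale[OF d(1) \<open>d \<noteq> 0\<close>])
  have cd': "c \<bullet> d' < 0" using d(2) e(2)[OF d(1) \<open>d \<noteq> 0\<close>] by (simp add: d'_def mult_pos_neg)
  \<comment> \<open>This makes \<open>?q d'\<close> exceed \<open>R\<^sup>2\<close>, whereas any
    \<open>y\<close> in \<open>K\<close> with \<open>c \<bullet> y \<ge> 0\<close> has
    \<open>?q y\<close> at most \<open>R\<^sup>2\<close>.\<close>
  define M where "M = (R\<^sup>2 + 1) / (- 2 * (c \<bullet> d'))"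
  have M: "0 < M" unfolding M_def using cd' by (intro divide_pos_pos) (auto simp: add_nonneg_pos)
  have M2: "- 2 * M * (c \<bullet> d') = R\<^sup>2 + 1" unfolding M_def using cd' by (simp add: field_simps)
  \<comment> \<open>The squared distance to the centre, up to a constant.\<close>
  let ?q = "\<lambda>y. y \<bullet> y - 2 * M * (c \<bullet> y)"
  have "continuous_on K ?q" by (intro continuous_intros)
  then obtain f where f: "f \<in> K" "\<And>y. y \<in> K \<Longrightarrow> ?q y \<le> ?q f"
    using continuous_attains_sup[OF compactK, of ?q] d'K by blast
  have f': "f \<in> D" "e \<bullet> f = 1" "f \<noteq> 0" using f(1) by (auto simp: K_def)
  have cf: "c \<bullet> f < 0"
  proof (rule ccontr)
    assume "\<not> c \<bullet> f < 0"
    then have "?q f \<le> f \<bullet> f" using M by simp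
    also have "f \<bullet> f \<le> R\<^sup>2"
      using R[OF f(1)] by (simp add: power2_norm_eq_inner[symmetric] power_mono)
    also have "\<dots> < d' \<bullet> d' + (R\<^sup>2 + 1)" using inner_ge_zero[of d'] by linarith
    also have "\<dots> = ?q d'" using M2 by simp
    finally show False using f(2)[OF d'K] by simp
  qed
  \<comment> \<open>Half the gradient of \<open>?q\<close> at \<open>f\<close>. Since
    \<open>?q\<close> is strictly convex, its maximizer \<open>f\<close> is the unique maximizer of
    \<open>l\<close> on \<open>K\<close>.\<close>
  define l where "l = f - M *\<^sub>R c"
  have l: "l \<bullet> y < l \<bullet> f" if "y \<in> K" "y \<noteq> f" for y
  proof -
    have "?q y = ?q f + 2 * (l \<bullet> (y - f)) + (y - f) \<bullet> (y - f)"
      by (simp add: l_def inner_simps inner_commute algebra_simps)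
    moreover have "0 < (y - f) \<bullet> (y - f)" using that(2) by simp
    ultimately have "l \<bullet> (y - f) < 0" using f(2)[OF that(1)] by linarith
    then show ?thesis by (simp add: inner_diff_right)
  qed
  \<comment> \<open>As \<open>e\<close> equals 1 on \<open>K\<close>, this is the homogeneous form
    of the affine function taking \<open>y\<close> to
    \<open>l \<bullet> f - l \<bullet> y\<close>.\<close>
  define x' where "x' = (l \<bullet> f) *\<^sub>R e - l"
  have x'f: "x' \<bullet> f = 0" using f'(2) by (simp add: x'_def inner_diff_left)
  have x'K: "0 < x' \<bullet> y" if "y \<in> K" "y \<noteq> f" for y
    using l[OF that] that(1) by (simp add: x'_def K_def inner_diff_left)
  have x'D: "0 < x' \<bullet> \<phi> \<or> \<phi> = (e \<bullet> \<phi>) *\<^sub>R f" if "\<phi> \<in> D" for \<phi>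
  proof (cases "\<phi> = 0 \<or> \<phi> /\<^sub>R (e \<bullet> \<phi>) = f")
    case True
    then show ?thesis
    proof
      assume "\<phi> /\<^sub>R (e \<bullet> \<phi>) = f"
      then have "(e \<bullet> \<phi>) *\<^sub>R f = (e \<bullet> \<phi>) *\<^sub>R (\<phi> /\<^sub>R (e \<bullet> \<phi>))" by (simp only:)
      also have "\<dots> = \<phi>" using e(2)[OF that] by (cases "\<phi> = 0") simp_all
      finally show ?thesis by (rule disjI2[OF sym])
    qed simp
  next
    case False
    then have "0 < x' \<bullet> (\<phi> /\<^sub>R (e \<bullet> \<phi>))" using x'K[OF scale[OF that]] by blast
    then show ?thesis using e(2)[OF that] False by (simp add: zero_less_mult_iff)
  qed
  obtain x where x: "x \<in> span D" "\<And>w. w \<in> span D \<Longrightarrow> w \<bullet> x = w \<bullet> x'"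
    using orthogonal_projection[of D x'] by blast
  have xx': "x \<bullet> \<phi> = x' \<bullet> \<phi>" if "\<phi> \<in> D" for \<phi>
    using x(2)[OF span_base[OF that]] by (simp add: inner_commute)
  have nn: "0 \<le> x' \<bullet> \<phi>" if "\<phi> \<in> D" for \<phi>
    using x'D[OF that]
  proof
    assume "\<phi> = (e \<bullet> \<phi>) *\<^sub>R f"
    then have "x' \<bullet> \<phi> = x' \<bullet> ((e \<bullet> \<phi>) *\<^sub>R f)" by (rule arg_cong)
    also have "\<dots> = 0" using x'f by simp
    finally show ?thesis by simp
  qed simp
  have "x \<in> pdual D" using x(1) xx' nn by (simp add: pdual_def)
  moreover have "\<exists>k. \<phi> = k *\<^sub>R f" if "\<phi> \<in> D" "x \<bullet> \<phi> = 0" for \<phi>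
    using x'D[OF that(1)]
  proof
    assume "0 < x' \<bullet> \<phi>"
    then show ?thesis using xx'[OF that(1)] that(2) by simp
  qed blast
  ultimately have "exposes D x f"
    using xx'[OF f'(1)] f'(1,3) x'f by (simp add: exposes_def)
  then show thesis using that cf by blast
qed

text \<open>A point of \<open>D\<close> outside the hull is cut off by a functional nonnegative on
  \<open>Q\<close>. By \<open>exposed_ray_exists\<close> it is negative on an exposed ray too, but
  such a ray is a nonnegative multiple of a member of \<open>Q\<close>.\<close>

lemma generated_by_exposed_rays:
  fixes D :: "'v::euclidean_space set"
  assumes D: "pointed_cone D" and Q: "finite Q" "Q \<subseteq> D"
    and exp: "\<And>f x. exposes D x f \<Longrightarrow> \<exists>q\<in>Q. \<exists>k\<ge>0. f = k *\<^sub>R q"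
  shows "D = convex_cone hull Q"
proof
  show "convex_cone hull Q \<subseteq> D"
    using D Q(2) by (intro hull_minimal) (auto simp: pointed_cone_def)
  show "D \<subseteq> convex_cone hull Q"
  proof (rule subsetI, rule ccontr)
    fix d assume d: "d \<in> D" "d \<notin> convex_cone hull Q"
    obtain a where a: "a \<bullet> d < 0" "\<And>c. c \<in> convex_cone hull Q \<Longrightarrow> 0 \<le> a \<bullet> c"
      using separate_from_closed_cone[OF closed_convex_cone_hull[OF Q(1)] convex_cone_convex_cone_hull d(2)]
      by blast
    obtain f x where fx: "exposes D x f" "a \<bullet> f < 0" using exposed_ray_exists[OF D d(1) a(1)] by blast
    then obtain q k where "q \<in> Q" "k \<ge> 0" "f = k *\<^sub>R q" using exp by blast
    moreover have "0 \<le> a \<bullet> q" using a(2) hull_inc[OF \<open>q \<in> Q\<close>] by blast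
    ultimately show False using fx(2) by (simp add: mult_less_0_iff)
  qed
qed

text \<open>The exposing \<open>x\<close> vanishes at \<open>f\<close>, hence at every generator
  with a nonzero term in \<open>f\<close>. Such a generator is a multiple of \<open>f\<close> by
  exposure, a positive one by pointedness.\<close>

lemma exposed_multiple_of_generator:
  fixes D :: "'v::euclidean_space set"
  assumes D: "pointed_cone D" and fx: "exposes D x f" and B: "finite B" "B \<subseteq> D" "f \<in> convex_cone hull B"
  obtains b k where "b \<in> B" "0 < k" "f = k *\<^sub>R b"
proof -
  obtain c where c: "f = (\<Sum>b\<in>B. c b *\<^sub>R b)" "\<forall>b\<in>B. (0::real) \<le> c b"
    using B(3) unfolding convex_cone_hull_finite[OF B(1)] by blast
  have f: "f \<in> D" "f \<noteq> 0" "x \<in> pdual D" "x \<bullet> f = 0" "\<And>\<phi>. \<phi> \<in> D \<Longrightarrow> x \<bullet> \<phi> = 0 \<Longrightarrow> \<exists>k. \<phi> = k *\<^sub>R f"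
    using fx by (auto simp: exposes_def)
  have "\<exists>b\<in>B. c b *\<^sub>R b \<noteq> 0"
  proof (rule ccontr)
    assume "\<not> ?thesis"
    then have "f = 0" unfolding c(1) by (intro sum.neutral) blast
    then show False using f(2) by blast
  qed
  then obtain b where b: "b \<in> B" "c b *\<^sub>R b \<noteq> 0" by blast
  have "(\<Sum>b\<in>B. c b * (x \<bullet> b)) = 0" using f(4) unfolding c(1) by (simp add: inner_sum_right)
  moreover have "0 \<le> c b * (x \<bullet> b)" if "b \<in> B" for b
    using c(2) pdualD[OF f(3)] B(2) that by auto
  ultimately have "\<forall>b\<in>B. c b * (x \<bullet> b) = 0" using B(1) by (simp add: sum_nonneg_eq_0_iff)
  then have "x \<bullet> b = 0" using b by auto
  then obtain k where k: "b = k *\<^sub>R f" using f(5) B(2) b(1) by blast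
  have "k \<noteq> 0" using k b(2) by auto
  moreover have "\<not> k < 0"
  proof
    assume "k < 0"
    then have "(1 / (- k)) *\<^sub>R b \<in> D" using B(2) b(1) by (intro pointed_coneD(5)[OF D]) auto
    then have "- f \<in> D" using k \<open>k < 0\<close> by (simp add: k)
    then show False using pointed_coneD(6)[OF D f(1)] f(2) by blast
  qed
  ultimately show thesis using that[OF b(1), of "1 / k"] k by simp
qed

section \<open>Existence of smooth kites\<close>

lemma span_pairE:
  assumes "x \<in> span {a, b}"
  obtains \<alpha> \<beta> where "x = \<alpha> *\<^sub>R a + \<beta> *\<^sub>R b"
proof -
  obtain \<alpha> where "x - \<alpha> *\<^sub>R a \<in> span {b}" using assms by (auto simp: span_insert)
  then obtain \<beta> where "x - \<alpha> *\<^sub>R a = \<beta> *\<^sub>R b" by (auto simp: span_singleton)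
  then show thesis by (intro that[of \<alpha> \<beta>]) (simp add: algebra_simps)
qed

text \<open>If \<open>t\<close> is the maximal quotient, attained at \<open>c\<^sub>0\<close> and
  \<open>\<phi>\<^sub>0\<close>, then suitably scaled copies of both can be subtracted from
  \<open>e\<close> and \<open>u\<close>, and maximality makes the resulting pairs tight. The pair
  \<open>x\<^sub>1\<close>, \<open>f\<^sub>2\<close> gives \<open>2 \<le> t\<close>. For
  \<open>t > 2\<close> the new functional leaves the plane of \<open>f\<^sub>1\<close>,
  \<open>f\<^sub>2\<close> automatically; for \<open>t = 2\<close> the maximum may just return the
  old diameter.\<close>

lemma second_diameter:
  fixes C :: "'v::euclidean_space set"
  assumes C: "pointed_cone C"
    and x: "x\<^sub>1 \<in> C" "x\<^sub>2 \<in> C" and f: "f\<^sub>1 \<in> pdual C" "f\<^sub>2 \<in> pdual C"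
    and vals: "f\<^sub>1 \<bullet> x\<^sub>1 = 0" "f\<^sub>2 \<bullet> x\<^sub>2 = 0" "f\<^sub>1 \<bullet> x\<^sub>2 = 1/2" "f\<^sub>2 \<bullet> x\<^sub>1 = 1/2"
    and u: "u = f\<^sub>1 + f\<^sub>2" "\<And>c. c \<in> C \<Longrightarrow> c \<noteq> 0 \<Longrightarrow> 0 < u \<bullet> c"
    and e: "e = x\<^sub>1 + x\<^sub>2" "\<And>\<phi>. \<phi> \<in> pdual C \<Longrightarrow> \<phi> \<noteq> 0 \<Longrightarrow> 0 < \<phi> \<bullet> e"
    and dim: "\<not> span C \<subseteq> span {f\<^sub>1, f\<^sub>2}"
  obtains y g where "y \<in> C" "e - y \<in> C" "g \<in> pdual C" "u - g \<in> pdual C" "g \<bullet> y = 0"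
    "(u - g) \<bullet> (e - y) = 0" "g \<notin> span {f\<^sub>1, f\<^sub>2}"
proof -
  have ue: "u \<bullet> e = 1" using vals by (simp add: u e inner_simps)
  have eC: "e \<in> C" unfolding e by (rule pointed_coneD(4)[OF C x])
  have uC: "u \<in> pdual C" unfolding u by (rule pointed_coneD(4)[OF pointed_cone_pdual[OF C] f])
  let ?R = "\<lambda>p. (snd p \<bullet> fst p) / ((u \<bullet> fst p) * (snd p \<bullet> e))"
  define K where "K = (C \<inter> sphere 0 1) \<times> (pdual C \<inter> sphere 0 1)"
  have "compact K"
    unfolding K_def using pointed_coneD(1)[OF C] pointed_coneD(1)[OF pointed_cone_pdual[OF C]]
    by (intro compact_Times closed_Int_compact compact_sphere)
  have unit: "c /\<^sub>R norm c \<in> C \<inter> sphere 0 1" if "c \<in> C" "c \<noteq> 0" for c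
    using that pointed_coneD(5)[OF C] by auto
  have unit': "c /\<^sub>R norm c \<in> pdual C \<inter> sphere 0 1" if "c \<in> pdual C" "c \<noteq> 0" for c
    using that pointed_coneD(5)[OF pointed_cone_pdual[OF C]] by auto
  have nz: "x\<^sub>1 \<noteq> 0" "f\<^sub>2 \<noteq> 0" using vals by auto
  have "K \<noteq> {}" using unit[OF x(1) nz(1)] unit'[OF f(2) nz(2)] by (auto simp: K_def)
  have Kpos: "0 < u \<bullet> c" "0 < \<phi> \<bullet> e" if "(c, \<phi>) \<in> K" for c \<phi>
    using that by (auto simp: K_def intro!: u(2) e(2))
  have "continuous_on K ?R"
    by (intro continuous_intros) (use Kpos in \<open>force simp: less_le\<close>)
  then obtain p where p: "p \<in> K" "\<And>q. q \<in> K \<Longrightarrow> ?R q \<le> ?R p"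
    using continuous_attains_sup[OF \<open>compact K\<close> \<open>K \<noteq> {}\<close>] by blast
  obtain c\<^sub>0 \<phi>\<^sub>0 where p_eq: "p = (c\<^sub>0, \<phi>\<^sub>0)" by (cases p)
  define t where "t = ?R p"
  have c0: "c\<^sub>0 \<in> C" "c\<^sub>0 \<noteq> 0" "\<phi>\<^sub>0 \<in> pdual C" "\<phi>\<^sub>0 \<noteq> 0" "0 < u \<bullet> c\<^sub>0" "0 < \<phi>\<^sub>0 \<bullet> e"
    using p(1) Kpos[of c\<^sub>0 \<phi>\<^sub>0] by (auto simp: K_def p_eq)
  have t_eq: "\<phi>\<^sub>0 \<bullet> c\<^sub>0 = t * ((u \<bullet> c\<^sub>0) * (\<phi>\<^sub>0 \<bullet> e))"
    using c0 by (simp add: t_def p_eq)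
  have bound: "\<phi> \<bullet> c \<le> t * ((u \<bullet> c) * (\<phi> \<bullet> e))" if "c \<in> C" "\<phi> \<in> pdual C" for c \<phi>
  proof (cases "c = 0 \<or> \<phi> = 0")
    case False
    have "?R (c /\<^sub>R norm c, \<phi> /\<^sub>R norm \<phi>) \<le> t"
      unfolding t_def using unit[of c] unit'[of \<phi>] False that by (intro p(2)) (auto simp: K_def)
    moreover have "?R (c /\<^sub>R norm c, \<phi> /\<^sub>R norm \<phi>) = (\<phi> \<bullet> c) / ((u \<bullet> c) * (\<phi> \<bullet> e))"
      using False by simp
    moreover have "0 < (u \<bullet> c) * (\<phi> \<bullet> e)" using u(2)[of c] e(2)[of \<phi>] that False by simp
    ultimately show ?thesis by (simp add: pos_divide_le_eq)
  qed auto
  have t2: "2 \<le> t"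
    using bound[OF x(1) f(2)] vals by (simp add: u e inner_simps)
  have in_C: "e - r *\<^sub>R c \<in> C" if "c \<in> C" "t * r * (u \<bullet> c) \<le> 1" "0 \<le> r" for r c
  proof (rule bipolar[OF C])
    show "e - r *\<^sub>R c \<in> span C" using eC that(1) by (simp add: span_base span_diff span_scale)
    fix \<phi> assume \<phi>: "\<phi> \<in> pdual C"
    have "r * (\<phi> \<bullet> c) \<le> r * (t * ((u \<bullet> c) * (\<phi> \<bullet> e)))"
      using bound[OF that(1) \<phi>] that(3) by (rule mult_left_mono)
    also have "\<dots> = (t * r * (u \<bullet> c)) * (\<phi> \<bullet> e)" by simp
    also have "\<dots> \<le> 1 * (\<phi> \<bullet> e)" using that(2) pdualD[OF \<phi> eC] by (rule mult_right_mono)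
    finally show "0 \<le> \<phi> \<bullet> (e - r *\<^sub>R c)" by (simp add: inner_diff_right)
  qed
  have in_pdual: "u - r *\<^sub>R \<phi> \<in> pdual C" if "\<phi> \<in> pdual C" "t * r * (\<phi> \<bullet> e) \<le> 1" "0 \<le> r" for r \<phi>
  proof -
    have "0 \<le> (u - r *\<^sub>R \<phi>) \<bullet> c" if c: "c \<in> C" for c
    proof -
      have "r * (\<phi> \<bullet> c) \<le> r * (t * ((u \<bullet> c) * (\<phi> \<bullet> e)))"
        using bound[OF c \<open>\<phi> \<in> pdual C\<close>] \<open>0 \<le> r\<close> by (rule mult_left_mono)
      also have "\<dots> = (t * r * (\<phi> \<bullet> e)) * (u \<bullet> c)" by simp
      also have "\<dots> \<le> 1 * (u \<bullet> c)"
        using \<open>t * r * (\<phi> \<bullet> e) \<le> 1\<close> pdualD[OF uC c] by (rule mult_right_mono)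
      finally show ?thesis by (simp add: inner_diff_left)
    qed
    moreover have "u - r *\<^sub>R \<phi> \<in> span C"
      using uC that(1) pdual_subset_span[of C] by (intro span_diff span_scale) auto
    ultimately show ?thesis by (simp add: pdual_def)
  qed
  show thesis
  proof (cases "t = 2")
    case True
    txt \<open>Here \<open>c \<mapsto> 2 (u c) e - c\<close> maps \<open>C\<close> into itself, so every boundary point starts an affine diameter
      and the support functional can be chosen freely.\<close>
    obtain h where h: "h \<in> span C" "h \<notin> span {f\<^sub>1, f\<^sub>2}" using dim by blast
    have "C \<inter> sphere 0 1 \<noteq> {}" using unit[OF x(1) nz(1)] by blast
    moreover have "compact (C \<inter> sphere 0 1)"
      using pointed_coneD(1)[OF C] by (intro closed_Int_compact compact_sphere)
    moreover have "continuous_on (C \<inter> sphere 0 1) (\<lambda>c. - (h \<bullet> c) / (u \<bullet> c))"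
      by (intro continuous_intros) (use u(2) in \<open>force simp: less_le\<close>)
    ultimately obtain y where "y \<in> C \<inter> sphere 0 1"
      and ymax: "\<And>c. c \<in> C \<inter> sphere 0 1 \<Longrightarrow> - (h \<bullet> c) / (u \<bullet> c) \<le> - (h \<bullet> y) / (u \<bullet> y)"
      using continuous_attains_sup[of "C \<inter> sphere 0 1" "\<lambda>c. - (h \<bullet> c) / (u \<bullet> c)"] by blast
    then have y: "y \<in> C" "norm y = 1" by auto
    \<comment> \<open>The least factor for which \<open>m *\<^sub>R u + h\<close> is nonnegative on
      \<open>C\<close>. The sum vanishes at the maximizer \<open>y\<close>, and \<open>h\<close>
      keeps it out of the plane.\<close>
    define m where "m = - (h \<bullet> y) / (u \<bullet> y)"
    define \<phi> where "\<phi> = m *\<^sub>R u + h"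
    have uy: "0 < u \<bullet> y" using y by (intro u(2)) auto
    have \<phi>y: "\<phi> \<bullet> y = 0" using uy by (simp add: \<phi>_def m_def inner_simps)
    have \<phi>nn: "0 \<le> \<phi> \<bullet> c" if "c \<in> C" for c
    proof (cases "c = 0")
      case False
      have uc: "0 < u \<bullet> c" using u(2) that False by blast
      have "- (h \<bullet> (c /\<^sub>R norm c)) / (u \<bullet> (c /\<^sub>R norm c)) \<le> m"
        unfolding m_def by (intro ymax unit[OF that False])
      then have "- (h \<bullet> c) / (u \<bullet> c) \<le> m" using False by simp
      then have "- (h \<bullet> c) \<le> m * (u \<bullet> c)" using pos_divide_le_eq[OF uc] by blast
      then show ?thesis by (simp add: \<phi>_def inner_add_left)
    qed simp
    have \<phi>C: "\<phi> \<in> pdual C"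
      using \<phi>nn h(1) uC pdual_subset_span[of C] by (auto simp: pdual_def \<phi>_def intro!: span_add span_scale)
    have u_span: "u \<in> span {f\<^sub>1, f\<^sub>2}" unfolding u by (intro span_add span_base) auto
    have \<phi>_span: "\<phi> \<notin> span {f\<^sub>1, f\<^sub>2}"
    proof
      assume "\<phi> \<in> span {f\<^sub>1, f\<^sub>2}"
      then have "\<phi> - m *\<^sub>R u \<in> span {f\<^sub>1, f\<^sub>2}" using u_span by (intro span_diff span_scale)
      then show False using h(2) by (simp add: \<phi>_def)
    qed
    then have "\<phi> \<noteq> 0" using span_zero by blast
    then have \<phi>e: "0 < \<phi> \<bullet> e" using e(2) \<phi>C by blast
    let ?y = "(1 / (2 * (u \<bullet> y))) *\<^sub>R y" and ?g = "(1 / (2 * (\<phi> \<bullet> e))) *\<^sub>R \<phi>"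
    show thesis
    proof (rule that[of ?y ?g])
      show "?y \<in> C" using uy by (intro pointed_coneD(5)[OF C y(1)]) simp
      show "e - ?y \<in> C" using uy True by (intro in_C y(1)) auto
      show "?g \<in> pdual C" using \<phi>e by (intro pointed_coneD(5)[OF pointed_cone_pdual[OF C] \<phi>C]) simp
      show "u - ?g \<in> pdual C" using \<phi>e True by (intro in_pdual \<phi>C) auto
      show "?g \<bullet> ?y = 0" using \<phi>y by simp
      show "(u - ?g) \<bullet> (e - ?y) = 0" using \<phi>y uy \<phi>e ue by (simp add: inner_simps)
      show "?g \<notin> span {f\<^sub>1, f\<^sub>2}"
      proof
        assume "?g \<in> span {f\<^sub>1, f\<^sub>2}"
        then have "(2 * (\<phi> \<bullet> e)) *\<^sub>R ?g \<in> span {f\<^sub>1, f\<^sub>2}" by (rule span_scale)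
        then show False using \<phi>_span \<phi>e by simp
      qed
    qed
  next
    case False
    with t2 have t: "2 < t" by simp
    define y where "y = e - (1 / (t * (u \<bullet> c\<^sub>0))) *\<^sub>R c\<^sub>0"
    define g where "g = (1 / (t * (\<phi>\<^sub>0 \<bullet> e))) *\<^sub>R \<phi>\<^sub>0"
    have ey: "e - y = (1 / (t * (u \<bullet> c\<^sub>0))) *\<^sub>R c\<^sub>0" by (simp add: y_def)
    have yC: "y \<in> C" unfolding y_def using c0 t by (intro in_C) auto
    have eyC: "e - y \<in> C" unfolding ey using c0 t by (intro pointed_coneD(5)[OF C c0(1)]) auto
    have gC: "g \<in> pdual C"
      unfolding g_def using c0 t by (intro pointed_coneD(5)[OF pointed_cone_pdual[OF C] c0(3)]) auto
    have ugC: "u - g \<in> pdual C" unfolding g_def using c0 t by (intro in_pdual) auto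
    have ge: "g \<bullet> e = 1 / t" using c0 t by (simp add: g_def)
    have uey: "u \<bullet> (e - y) = 1 / t" unfolding ey using c0 t by simp
    have gey: "g \<bullet> (e - y) = 1 / t" unfolding ey g_def using c0 t t_eq by simp
    have gy: "g \<bullet> y = 0" using ge gey by (simp add: inner_diff_right)
    have ugy: "(u - g) \<bullet> (e - y) = 0" using uey gey by (simp add: inner_diff_left)
    have uy: "u \<bullet> y = 1 - 1 / t" using uey ue by (simp add: inner_diff_right)
    \<comment> \<open>Complementary slackness: \<open>g\<close> vanishes at \<open>y\<close>,
      \<open>u - g\<close> at \<open>e - y\<close>, and \<open>u\<close> at neither. So one of the
      coefficients of \<open>g\<close> is 0 and the other is 1, which gives
      \<open>g \<bullet> e = 1/2\<close> and \<open>t = 2\<close>.\<close>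
    have "g \<notin> span {f\<^sub>1, f\<^sub>2}"
    proof
      assume "g \<in> span {f\<^sub>1, f\<^sub>2}"
      then obtain \<alpha> \<beta> where g: "g = \<alpha> *\<^sub>R f\<^sub>1 + \<beta> *\<^sub>R f\<^sub>2" by (rule span_pairE)
      have ab: "0 \<le> \<alpha>" "0 \<le> \<beta>" "\<alpha> \<le> 1" "\<beta> \<le> 1"
        using pdualD[OF gC x(1)] pdualD[OF gC x(2)] pdualD[OF ugC x(1)] pdualD[OF ugC x(2)] vals
        by (auto simp: g u inner_simps)
      have fy: "0 \<le> f\<^sub>1 \<bullet> y" "0 \<le> f\<^sub>2 \<bullet> y" "0 \<le> f\<^sub>1 \<bullet> (e - y)" "0 \<le> f\<^sub>2 \<bullet> (e - y)"
        using pdualD[OF f(1) yC] pdualD[OF f(2) yC] pdualD[OF f(1) eyC] pdualD[OF f(2) eyC] by auto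
      have "\<alpha> * (f\<^sub>1 \<bullet> y) + \<beta> * (f\<^sub>2 \<bullet> y) = 0" using gy by (simp add: g inner_simps)
      then have z1: "\<alpha> * (f\<^sub>1 \<bullet> y) = 0" "\<beta> * (f\<^sub>2 \<bullet> y) = 0"
        using ab fy by (simp_all add: add_nonneg_eq_0_iff)
      have "u - g = (1 - \<alpha>) *\<^sub>R f\<^sub>1 + (1 - \<beta>) *\<^sub>R f\<^sub>2" by (simp add: g u algebra_simps)
      then have "(1 - \<alpha>) * (f\<^sub>1 \<bullet> (e - y)) + (1 - \<beta>) * (f\<^sub>2 \<bullet> (e - y)) = 0"
        using ugy by (simp add: inner_add_left)
      moreover have "0 \<le> (1 - \<alpha>) * (f\<^sub>1 \<bullet> (e - y))" "0 \<le> (1 - \<beta>) * (f\<^sub>2 \<bullet> (e - y))"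
        using ab fy by (auto intro!: mult_nonneg_nonneg)
      ultimately have z2: "(1 - \<alpha>) * (f\<^sub>1 \<bullet> (e - y)) = 0" "(1 - \<beta>) * (f\<^sub>2 \<bullet> (e - y)) = 0"
        by (simp_all only: add_nonneg_eq_0_iff)
      have uey': "0 < f\<^sub>1 \<bullet> (e - y) + f\<^sub>2 \<bullet> (e - y)" using uey t by (simp add: u inner_add_left)
      have uy': "0 < f\<^sub>1 \<bullet> y + f\<^sub>2 \<bullet> y" using uy t by (simp add: u inner_add_left)
      have ge': "\<alpha> / 2 + \<beta> / 2 = 1 / t" using ge vals by (simp add: g e inner_simps)
      have "\<alpha> + \<beta> = 1"
        using z1 z2 uey' uy' by auto
      then have "1 / t = 1 / 2" using ge' by linarith
      then show False using t by (simp add: field_simps)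
    qed
    then show thesis using that yC eyC gC ugC gy ugy by blast
  qed
qed

text \<open>The kite has the doubled ends of two diameters through \<open>e\<close> as its points:
  \<open>x\<^sub>1\<close>, \<open>x\<^sub>2\<close>, smooth by hypothesis, and the pair
  \<open>y\<close>, \<open>e - y\<close> from \<open>second_diameter\<close>.\<close>

lemma smooth_kite_exists:
  fixes C :: "'v::euclidean_space set"
  assumes C: "pointed_cone C"
    and x: "x\<^sub>1 \<in> C" "x\<^sub>2 \<in> C" "x\<^sub>1 \<noteq> 0" "x\<^sub>2 \<noteq> 0" and f: "f\<^sub>1 \<in> pdual C" "f\<^sub>2 \<in> pdual C"
    and zero: "f\<^sub>1 \<bullet> x\<^sub>1 = 0" "f\<^sub>2 \<bullet> x\<^sub>2 = 0"
    and smooth: "\<And>\<phi>. \<phi> \<in> pdual C \<Longrightarrow> \<phi> \<bullet> x\<^sub>1 = 0 \<Longrightarrow> \<exists>k. \<phi> = k *\<^sub>R f\<^sub>1"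
      "\<And>\<phi>. \<phi> \<in> pdual C \<Longrightarrow> \<phi> \<bullet> x\<^sub>2 = 0 \<Longrightarrow> \<exists>k. \<phi> = k *\<^sub>R f\<^sub>2"
    and diag: "\<And>c. c \<in> C \<Longrightarrow> f\<^sub>1 \<bullet> c = 0 \<Longrightarrow> f\<^sub>2 \<bullet> c = 0 \<Longrightarrow> c = 0"
    and dim: "\<not> span C \<subseteq> span {f\<^sub>1, f\<^sub>2}"
  obtains e x y u f g where "smooth_kite C e x y u f g"
proof -
  have pos: "0 < f\<^sub>1 \<bullet> x\<^sub>2" "0 < f\<^sub>2 \<bullet> x\<^sub>1"
    using pdualD[OF f(1) x(2)] pdualD[OF f(2) x(1)] diag[OF x(2)] diag[OF x(1)] zero x(3,4)
    by (auto simp: less_le)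
  \<comment> \<open>With the value 1/2 at the opposite end for both functionals, their sum is 1 at
    \<open>e\<close> and their difference is 0 there.\<close>
  define h\<^sub>1 where "h\<^sub>1 = (1 / (2 * (f\<^sub>1 \<bullet> x\<^sub>2))) *\<^sub>R f\<^sub>1"
  define h\<^sub>2 where "h\<^sub>2 = (1 / (2 * (f\<^sub>2 \<bullet> x\<^sub>1))) *\<^sub>R f\<^sub>2"
  define u where "u = h\<^sub>1 + h\<^sub>2"
  define e where "e = x\<^sub>1 + x\<^sub>2"
  have hC: "h\<^sub>1 \<in> pdual C" "h\<^sub>2 \<in> pdual C"
    using pos f by (auto simp: h\<^sub>1_def h\<^sub>2_def intro!: pointed_coneD(5)[OF pointed_cone_pdual[OF C]])
  have vals: "h\<^sub>1 \<bullet> x\<^sub>1 = 0" "h\<^sub>2 \<bullet> x\<^sub>2 = 0" "h\<^sub>1 \<bullet> x\<^sub>2 = 1/2" "h\<^sub>2 \<bullet> x\<^sub>1 = 1/2"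
    using zero pos by (auto simp: h\<^sub>1_def h\<^sub>2_def)
  have smooth': "\<exists>k. \<phi> = k *\<^sub>R h\<^sub>1" if \<phi>: "\<phi> \<in> pdual C" "\<phi> \<bullet> x\<^sub>1 = 0" for \<phi>
  proof -
    obtain k where "\<phi> = k *\<^sub>R f\<^sub>1" using smooth(1)[OF \<phi>] by blast
    then have "\<phi> = (k * (2 * (f\<^sub>1 \<bullet> x\<^sub>2))) *\<^sub>R h\<^sub>1" using pos by (simp add: h\<^sub>1_def)
    then show ?thesis by blast
  qed
  have smooth'': "\<exists>k. \<phi> = k *\<^sub>R h\<^sub>2" if \<phi>: "\<phi> \<in> pdual C" "\<phi> \<bullet> x\<^sub>2 = 0" for \<phi>
  proof -
    obtain k where "\<phi> = k *\<^sub>R f\<^sub>2" using smooth(2)[OF \<phi>] by blast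
    then have "\<phi> = (k * (2 * (f\<^sub>2 \<bullet> x\<^sub>1))) *\<^sub>R h\<^sub>2" using pos by (simp add: h\<^sub>2_def)
    then show ?thesis by blast
  qed
  have upos: "0 < u \<bullet> c" if c: "c \<in> C" "c \<noteq> 0" for c
  proof -
    have nn: "0 \<le> h\<^sub>1 \<bullet> c" "0 \<le> h\<^sub>2 \<bullet> c" using pdualD hC c(1) by blast+
    have "\<not> (h\<^sub>1 \<bullet> c = 0 \<and> h\<^sub>2 \<bullet> c = 0)"
      using diag[OF c(1)] c(2) pos by (auto simp: h\<^sub>1_def h\<^sub>2_def)
    then show ?thesis using nn by (auto simp: u_def inner_add_left)
  qed
  \<comment> \<open>A functional vanishing at both ends is a multiple of \<open>h\<^sub>1\<close> by
    smoothness at \<open>x\<^sub>1\<close>, and \<open>h\<^sub>1\<close> does not vanish at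
    \<open>x\<^sub>2\<close>.\<close>
  have epos: "0 < \<phi> \<bullet> e" if \<phi>: "\<phi> \<in> pdual C" "\<phi> \<noteq> 0" for \<phi>
  proof -
    have nn: "0 \<le> \<phi> \<bullet> x\<^sub>1" "0 \<le> \<phi> \<bullet> x\<^sub>2" using pdualD[OF \<phi>(1)] x(1,2) by blast+
    have "\<not> (\<phi> \<bullet> x\<^sub>1 = 0 \<and> \<phi> \<bullet> x\<^sub>2 = 0)"
    proof
      assume z: "\<phi> \<bullet> x\<^sub>1 = 0 \<and> \<phi> \<bullet> x\<^sub>2 = 0"
      then obtain k where k: "\<phi> = k *\<^sub>R h\<^sub>1" using smooth' \<phi>(1) by blast
      then have "k = 0" using z vals by simp
      then show False using k \<phi>(2) by simp
    qed
    then show ?thesis using nn by (auto simp: e_def inner_add_right)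
  qed
  have span_h: "span {h\<^sub>1, h\<^sub>2} \<subseteq> span {f\<^sub>1, f\<^sub>2}"
    by (intro span_minimal) (simp_all add: h\<^sub>1_def h\<^sub>2_def span_scale span_base)
  then have "\<not> span C \<subseteq> span {h\<^sub>1, h\<^sub>2}" using dim by blast
  then obtain y g where yg: "y \<in> C" "e - y \<in> C" "g \<in> pdual C" "u - g \<in> pdual C" "g \<bullet> y = 0"
      "(u - g) \<bullet> (e - y) = 0" "g \<notin> span {h\<^sub>1, h\<^sub>2}"
    using second_diameter[OF C x(1,2) hC vals u_def upos e_def epos] by blast
  have half: "2 *\<^sub>R c \<in> C" if "c \<in> C" for c using pointed_coneD(5)[OF C that] by simp
  have half': "2 *\<^sub>R c \<in> pdual C" if "c \<in> pdual C" for c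
    using pointed_coneD(5)[OF pointed_cone_pdual[OF C] that] by simp
  define X where "X = x\<^sub>2 - x\<^sub>1"
  define Y where "Y = e - 2 *\<^sub>R y"
  define F where "F = h\<^sub>1 - h\<^sub>2"
  define G where "G = 2 *\<^sub>R g - u"
  have eqs: "e + X = 2 *\<^sub>R x\<^sub>2" "e - X = 2 *\<^sub>R x\<^sub>1" "e + Y = 2 *\<^sub>R (e - y)" "e - Y = 2 *\<^sub>R y"
    "u + F = 2 *\<^sub>R h\<^sub>1" "u - F = 2 *\<^sub>R h\<^sub>2" "u + G = 2 *\<^sub>R g" "u - G = 2 *\<^sub>R (u - g)"
    by (simp_all add: e_def X_def Y_def u_def F_def G_def algebra_simps scaleR_2)
  have "kite C e X Y u F G"
    unfolding kite_def eqs using half half' x(1,2) yg(1-4) hC by blast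
  moreover have "u \<bullet> e = 1" "F \<bullet> X = 1" "u \<bullet> X = F \<bullet> e" "F \<bullet> e = 0"
    using vals by (simp_all add: u_def e_def F_def X_def inner_simps)
  moreover have "G \<bullet> Y = 1" "u \<bullet> Y = G \<bullet> e"
    using yg(5,6) \<open>u \<bullet> e = 1\<close> by (simp_all add: G_def Y_def inner_simps)
  ultimately have "tight_kite C e X Y u F G" "F \<bullet> e = 0" by (auto simp: tight_kite_def)
  moreover have "\<exists>k. \<phi> = k *\<^sub>R (u + F)" if \<phi>: "\<phi> \<in> pdual C" "\<phi> \<bullet> (e - X) = 0" for \<phi>
  proof -
    obtain k where "\<phi> = k *\<^sub>R h\<^sub>1" using smooth'[OF \<phi>(1)] \<phi>(2) eqs(2) by auto
    then have "\<phi> = (k / 2) *\<^sub>R (u + F)" by (simp add: eqs)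
    then show ?thesis by blast
  qed
  moreover have "\<exists>k. \<phi> = k *\<^sub>R (u - F)" if \<phi>: "\<phi> \<in> pdual C" "\<phi> \<bullet> (e + X) = 0" for \<phi>
  proof -
    obtain k where "\<phi> = k *\<^sub>R h\<^sub>2" using smooth''[OF \<phi>(1)] \<phi>(2) eqs(1) by auto
    then have "\<phi> = (k / 2) *\<^sub>R (u - F)" by (simp add: eqs)
    then show ?thesis by blast
  qed
  moreover have "G \<notin> span {u, F}"
  proof
    assume G: "G \<in> span {u, F}"
    have "{u, F} \<subseteq> span {h\<^sub>1, h\<^sub>2}"
      by (simp add: u_def F_def span_add span_diff span_base)
    then have sub: "span {u, F} \<subseteq> span {h\<^sub>1, h\<^sub>2}" by (simp add: span_minimal)
    have "u \<in> span {u, F}" by (simp add: span_base)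
    then have "(1/2) *\<^sub>R (G + u) \<in> span {u, F}" using G by (intro span_scale span_add)
    moreover have "(1/2) *\<^sub>R (G + u) = g" by (simp add: G_def)
    ultimately show False using yg(7) sub by auto
  qed
  ultimately have "smooth_kite C e X Y u F G"
    unfolding smooth_kite_def using epos by blast
  then show thesis by (rule that)
qed

text \<open>Otherwise every exposed ray shares a proper face with a fixed one \<open>f\<^sub>1\<close>, hence lies in one of the
  finitely many simplicial faces exposed by the generators \<open>B\<close> of the dual face at \<open>f\<^sub>1\<close>.  So \<open>D\<close> is
  polyhedral, its edges at \<open>f\<^sub>1\<close> lead to rays \<open>r b\<close> dual to \<open>B\<close>, and there is no room for further rays.\<close>

lemma opposite_exposed_rays_exist:
  fixes D :: "'v::euclidean_space set"
  assumes D: "pointed_cone D" and nonsimp: "\<not> simplicial D"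
    and faces: "\<And>x. x \<in> pdual D \<Longrightarrow> x \<noteq> 0 \<Longrightarrow> simplicial (cone_face D x)"
    and dual_faces: "\<And>f. f \<in> D \<Longrightarrow> f \<noteq> 0 \<Longrightarrow> simplicial (cone_face (pdual D) f)"
  shows "\<exists>f\<^sub>1 x\<^sub>1 f\<^sub>2 x\<^sub>2. exposes D x\<^sub>1 f\<^sub>1 \<and> exposes D x\<^sub>2 f\<^sub>2 \<and>
    (\<forall>c\<in>pdual D. c \<bullet> f\<^sub>1 = 0 \<and> c \<bullet> f\<^sub>2 = 0 \<longrightarrow> c = 0)"
proof (rule ccontr)
  assume neg: "\<not> ?thesis"
  have adj: "\<exists>c\<in>pdual D. c \<noteq> 0 \<and> c \<bullet> f\<^sub>1 = 0 \<and> c \<bullet> f\<^sub>2 = 0"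
    if "exposes D x\<^sub>1 f\<^sub>1" "exposes D x\<^sub>2 f\<^sub>2" for x\<^sub>1 f\<^sub>1 x\<^sub>2 f\<^sub>2
    using that neg by blast
  have C: "pointed_cone (pdual D)" by (rule pointed_cone_pdual[OF D])
  have exD: "f \<in> D" "f \<noteq> 0" if "exposes D x f" for f x using that by (auto simp: exposes_def)
  obtain d where d: "d \<in> D" "d \<noteq> 0"
  proof (rule ccontr)
    assume "\<not> thesis"
    then have "D = {0}" using pointed_coneD(3)[OF D] that by blast
    then have "D = convex_cone hull {}" by simp
    then show False using nonsimp independent_empty unfolding simplicial_def by blast
  qed
  obtain e where e: "e \<in> pdual D" "\<And>d. d \<in> D \<Longrightarrow> d \<noteq> 0 \<Longrightarrow> 0 < e \<bullet> d"
    using pdual_interior_functional[OF D] by blast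
  have "(- e) \<bullet> d < 0" using e(2)[OF d] by simp
  then obtain f\<^sub>1 x\<^sub>1 where f1: "exposes D x\<^sub>1 f\<^sub>1"
    using exposed_ray_exists[OF D d(1)] by blast
  note f1D = exD[OF f1]
  obtain B where B: "independent B" "cone_face (pdual D) f\<^sub>1 = convex_cone hull B"
    using dual_faces[OF f1D] by (auto simp: simplicial_def)
  have finB: "finite B" using B(1) by (rule independent_imp_finite)
  have BF: "b \<in> pdual D" "b \<bullet> f\<^sub>1 = 0" "b \<noteq> 0" if "b \<in> B" for b
  proof -
    have "b \<in> cone_face (pdual D) f\<^sub>1" unfolding B(2) by (rule hull_inc[OF that])
    then show "b \<in> pdual D" "b \<bullet> f\<^sub>1 = 0" by (auto simp: cone_face_def inner_commute)
    show "b \<noteq> 0" using B(1) that dependent_zero by blast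
  qed
  \<comment> \<open>The vector from \<open>adj\<close> is a nonnegative combination of
    \<open>B\<close>, and every generator with nonzero coefficient must vanish at \<open>f\<close>
    too.\<close>
  have facet: "\<exists>b\<in>B. b \<bullet> f = 0" if f: "exposes D x f" for f x
  proof -
    obtain c where c: "c \<in> pdual D" "c \<noteq> 0" "c \<bullet> f\<^sub>1 = 0" "c \<bullet> f = 0" using adj[OF f1 f] by blast
    then have "c \<in> convex_cone hull B"
      unfolding B(2)[symmetric] by (auto simp: cone_face_def inner_commute)
    then obtain \<gamma> where \<gamma>: "c = (\<Sum>b\<in>B. \<gamma> b *\<^sub>R b)" "\<forall>b\<in>B. (0::real) \<le> \<gamma> b"
      unfolding convex_cone_hull_finite[OF finB] by blast
    have "(\<Sum>b\<in>B. \<gamma> b * (b \<bullet> f)) = 0" using c(4) unfolding \<gamma>(1) by (simp add: inner_sum_left)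
    moreover have "0 \<le> \<gamma> b * (b \<bullet> f)" if "b \<in> B" for b
      using \<gamma>(2) pdualD[OF BF(1)[OF that] exD(1)[OF f]] that by simp
    ultimately have z: "\<forall>b\<in>B. \<gamma> b * (b \<bullet> f) = 0" using finB by (simp add: sum_nonneg_eq_0_iff)
    show ?thesis
    proof (rule ccontr)
      assume "\<not> ?thesis"
      then have "\<forall>b\<in>B. \<gamma> b = 0" using z by auto
      then have "c = 0" unfolding \<gamma>(1) by (intro sum.neutral) auto
      then show False using c(2) by blast
    qed
  qed
  have "\<exists>R. independent R \<and> cone_face D b = convex_cone hull R" if "b \<in> B" for b
    using faces[OF BF(1)[OF that] BF(3)[OF that]] by (simp add: simplicial_def)
  then obtain R where R: "\<And>b. b \<in> B \<Longrightarrow> independent (R b)" "\<And>b. b \<in> B \<Longrightarrow> cone_face D b = convex_cone hull (R b)"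
    by metis
  have finR: "finite (R b)" if "b \<in> B" for b using R(1)[OF that] by (rule independent_imp_finite)
  have RD: "R b \<subseteq> D" if "b \<in> B" for b
    using hull_subset[of "R b" convex_cone] unfolding R(2)[OF that, symmetric] by (auto simp: cone_face_def)
  have on_facet: "\<exists>r\<in>R b. \<exists>k>0. f = k *\<^sub>R r" if f: "exposes D x f" and b: "b \<in> B" "b \<bullet> f = 0" for f x b
  proof -
    have "f \<in> convex_cone hull (R b)"
      unfolding R(2)[OF b(1), symmetric] using exD(1)[OF f] b(2) by (simp add: cone_face_def)
    from exposed_multiple_of_generator[OF D f finR[OF b(1)] RD[OF b(1)] this] show ?thesis by blast
  qed
  \<comment> \<open>Only exposed generators are kept, so that \<open>on_facet\<close> can later be
    applied to members of \<open>P\<close> themselves.\<close>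
  define P where "P = {r \<in> (\<Union>b\<in>B. R b). \<exists>x. exposes D x r}"
  have finP: "finite P" unfolding P_def using finB finR by auto
  have PD: "P \<subseteq> D" using exD by (auto simp: P_def)
  have "\<exists>r\<in>P. \<exists>k\<ge>0. f = k *\<^sub>R r" if f: "exposes D x f" for f x
  proof -
    obtain b where b: "b \<in> B" "b \<bullet> f = 0" using facet[OF f] by blast
    obtain r k where r: "r \<in> R b" "0 < k" "f = k *\<^sub>R r" using on_facet[OF f b] by blast
    have "exposes D x r"
      unfolding exposes_def
    proof (intro conjI ballI impI)
      show "r \<in> D" using RD[OF b(1)] r(1) by blast
      show "r \<noteq> 0" "x \<in> pdual D" "x \<bullet> r = 0" using f r by (auto simp: exposes_def)
      fix \<phi> assume "\<phi> \<in> D" "x \<bullet> \<phi> = 0"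
      then obtain k' where "\<phi> = k' *\<^sub>R f" using f by (auto simp: exposes_def)
      then show "\<exists>k. \<phi> = k *\<^sub>R r" using r(3) by auto
    qed
    then have "r \<in> P" using r(1) b(1) by (auto simp: P_def)
    moreover have "0 \<le> k" using r(2) by simp
    ultimately show ?thesis using r(3) by blast
  qed
  then have DP: "D = convex_cone hull P" by (rule generated_by_exposed_rays[OF D finP PD])
  \<comment> \<open>The tangent cone of \<open>D\<close> at \<open>f\<^sub>1\<close>, closed because
    \<open>P\<close> is finite. Its dual is the face generated by \<open>B\<close>, so
    \<open>B\<close> suffices to test membership; this is \<open>in_H\<close>.\<close>
  let ?H = "convex_cone hull (insert (- f\<^sub>1) P)"
  have finfP: "finite (insert (- f\<^sub>1) P)" using finP by simp
  have in_H: "v \<in> ?H" if v: "v \<in> span D" "\<And>b. b \<in> B \<Longrightarrow> 0 \<le> b \<bullet> v" for v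
  proof (rule ccontr)
    assume "v \<notin> ?H"
    then obtain a where a: "a \<bullet> v < 0" "\<And>c. c \<in> ?H \<Longrightarrow> 0 \<le> a \<bullet> c"
      using separate_from_closed_cone[OF closed_convex_cone_hull[OF finfP] convex_cone_convex_cone_hull] by blast
    have aD: "0 \<le> a \<bullet> c" if "c \<in> D" for c
      using a(2)[of c] that hull_mono[of P "insert (- f\<^sub>1) P" convex_cone] DP by auto
    have "0 \<le> a \<bullet> (- f\<^sub>1)" by (rule a(2)) (simp add: hull_inc)
    then have af1: "a \<bullet> f\<^sub>1 = 0" using aD[OF f1D(1)] by simp
    obtain c where c: "c \<in> span D" "\<And>w. w \<in> span D \<Longrightarrow> w \<bullet> c = w \<bullet> a"
      using orthogonal_projection[of D a] by blast
    have ca: "c \<bullet> w = a \<bullet> w" if "w \<in> span D" for w using c(2)[OF that] by (simp add: inner_commute)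
    have "c \<in> pdual D" using c(1) aD ca[OF span_base] by (simp add: pdual_def)
    then have "c \<in> convex_cone hull B"
      unfolding B(2)[symmetric] using af1 ca[OF span_base[OF f1D(1)]] by (simp add: cone_face_def inner_commute)
    then have "0 \<le> c \<bullet> v" using v(2) by (rule convex_cone_hull_nonneg)
    then show False using a(1) ca[OF v(1)] by simp
  qed
  obtain s where s: "\<And>b. b \<in> B \<Longrightarrow> s b \<in> span B" "\<And>b b'. b \<in> B \<Longrightarrow> b' \<in> B \<Longrightarrow> s b \<bullet> b' = (if b = b' then 1 else 0)"
    using dual_family_exists[OF B(1)] by blast
  have spanB: "span B \<subseteq> span D"
    using BF(1) pdual_subset_span[of D] by (intro span_minimal) auto
  have "\<exists>r\<in>P. 0 < b\<^sub>0 \<bullet> r \<and> (\<forall>b\<in>B. b \<noteq> b\<^sub>0 \<longrightarrow> b \<bullet> r = 0)" if b0: "b\<^sub>0 \<in> B" for b\<^sub>0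
  proof -
    \<comment> \<open>In a representation of \<open>s b\<^sub>0\<close> over \<open>?H\<close> all
      terms are nonnegative on \<open>B\<close>. A term positive on \<open>b\<^sub>0\<close> must
      therefore vanish on the rest of \<open>B\<close>; it is the edge dual to
      \<open>b\<^sub>0\<close>.\<close>
    have "s b\<^sub>0 \<in> ?H"
      using s b0 spanB by (intro in_H) (auto simp: inner_commute[of _ "s b\<^sub>0"])
    then obtain c where c: "s b\<^sub>0 = (\<Sum>p\<in>insert (- f\<^sub>1) P. c p *\<^sub>R p)" "\<forall>p\<in>insert (- f\<^sub>1) P. (0::real) \<le> c p"
      unfolding convex_cone_hull_finite[OF finfP] by blast
    have ev: "(\<Sum>p\<in>insert (- f\<^sub>1) P. c p * (b \<bullet> p)) = (if b\<^sub>0 = b then 1 else 0)" if "b \<in> B" for b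
    proof -
      have "b \<bullet> s b\<^sub>0 = (if b\<^sub>0 = b then 1 else 0)" using s(2)[OF b0 that] by (simp add: inner_commute)
      then show ?thesis unfolding c(1) inner_sum_right by simp
    qed
    have nn: "0 \<le> c p * (b \<bullet> p)" if "b \<in> B" "p \<in> insert (- f\<^sub>1) P" for b p
      using c(2) that BF(2)[OF that(1)] pdualD[OF BF(1)[OF that(1)]] PD by auto
    have "\<exists>p\<in>insert (- f\<^sub>1) P. c p * (b\<^sub>0 \<bullet> p) \<noteq> 0"
    proof (rule ccontr)
      assume "\<not> ?thesis"
      then have "(\<Sum>p\<in>insert (- f\<^sub>1) P. c p * (b\<^sub>0 \<bullet> p)) = 0" by (intro sum.neutral) auto
      then show False using ev[OF b0] by simp
    qed
    then obtain p where p: "p \<in> insert (- f\<^sub>1) P" "c p * (b\<^sub>0 \<bullet> p) \<noteq> 0" by blast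
    have "p \<noteq> - f\<^sub>1" using p(2) BF(2)[OF b0] by auto
    then have pP: "p \<in> P" using p(1) by blast
    have "b \<bullet> p = 0" if b: "b \<in> B" "b \<noteq> b\<^sub>0" for b
    proof -
      have "\<forall>p\<in>insert (- f\<^sub>1) P. c p * (b \<bullet> p) = 0"
        using ev[OF b(1)] b(2) by (subst sum_nonneg_eq_0_iff[OF finfP nn[OF b(1)], symmetric]) auto
      then show ?thesis using p by auto
    qed
    moreover have "0 < b\<^sub>0 \<bullet> p"
      using p(2) pdualD[OF BF(1)[OF b0], of p] pP PD by (auto simp: less_le)
    ultimately show ?thesis using pP by blast
  qed
  then obtain r where r: "\<And>b. b \<in> B \<Longrightarrow> r b \<in> P" "\<And>b. b \<in> B \<Longrightarrow> 0 < b \<bullet> r b"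
      "\<And>b b'. b \<in> B \<Longrightarrow> b' \<in> B \<Longrightarrow> b' \<noteq> b \<Longrightarrow> b' \<bullet> r b = 0"
    by metis
  \<comment> \<open>Both \<open>v\<close> and \<open>- v\<close> lie in \<open>?H\<close>, so they
    are members of \<open>D\<close> up to multiples of \<open>f\<^sub>1\<close>. These two members
    add up to a multiple of \<open>f\<^sub>1\<close>, where \<open>x\<^sub>1\<close> vanishes; hence
    both lie on the ray that \<open>x\<^sub>1\<close> exposes.\<close>
  have orth_B: "\<exists>k. v = k *\<^sub>R f\<^sub>1" if v: "v \<in> span D" "\<And>b. b \<in> B \<Longrightarrow> b \<bullet> v = 0" for v
  proof -
    have split: "\<exists>d\<in>D. \<exists>a\<ge>0. w = d - a *\<^sub>R f\<^sub>1" if "w \<in> ?H" for w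
    proof -
      have "?H \<subseteq> {d - a *\<^sub>R f\<^sub>1 |d a. d \<in> D \<and> 0 \<le> a}"
      proof (rule hull_minimal)
        have "- f\<^sub>1 = 0 - 1 *\<^sub>R f\<^sub>1" "\<And>p. p = p - 0 *\<^sub>R f\<^sub>1" by simp_all
        then show "insert (- f\<^sub>1) P \<subseteq> {d - a *\<^sub>R f\<^sub>1 |d a. d \<in> D \<and> 0 \<le> a}"
          using PD pointed_coneD(3)[OF D] zero_le_one by blast
        show "convex_cone {d - a *\<^sub>R f\<^sub>1 |d a. d \<in> D \<and> 0 \<le> a}"
          unfolding convex_cone_iff
        proof (intro conjI ballI allI impI)
          show "0 \<in> {d - a *\<^sub>R f\<^sub>1 |d a. d \<in> D \<and> 0 \<le> a}"
            using pointed_coneD(3)[OF D] by (intro CollectI exI[of _ 0]) auto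
        next
          fix x y assume "x \<in> {d - a *\<^sub>R f\<^sub>1 |d a. d \<in> D \<and> 0 \<le> a}" "y \<in> {d - a *\<^sub>R f\<^sub>1 |d a. d \<in> D \<and> 0 \<le> a}"
          then obtain d a d' a' where "x = d - a *\<^sub>R f\<^sub>1" "y = d' - a' *\<^sub>R f\<^sub>1" "d \<in> D" "d' \<in> D" "0 \<le> a" "0 \<le> a'" by blast
          then have "x + y = (d + d') - (a + a') *\<^sub>R f\<^sub>1" "d + d' \<in> D" "0 \<le> a + a'"
            using pointed_coneD(4)[OF D] by (auto simp: algebra_simps)
          then show "x + y \<in> {d - a *\<^sub>R f\<^sub>1 |d a. d \<in> D \<and> 0 \<le> a}" by blast
        next
          fix x and c :: real assume "x \<in> {d - a *\<^sub>R f\<^sub>1 |d a. d \<in> D \<and> 0 \<le> a}" "0 \<le> c"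
          then obtain d a where "x = d - a *\<^sub>R f\<^sub>1" "d \<in> D" "0 \<le> a" by blast
          then have "c *\<^sub>R x = c *\<^sub>R d - (c * a) *\<^sub>R f\<^sub>1" "c *\<^sub>R d \<in> D" "0 \<le> c * a"
            using pointed_coneD(5)[OF D] \<open>0 \<le> c\<close> by (auto simp: algebra_simps)
          then show "c *\<^sub>R x \<in> {d - a *\<^sub>R f\<^sub>1 |d a. d \<in> D \<and> 0 \<le> a}" by blast
        qed
      qed
      then show ?thesis using that by blast
    qed
    have "v \<in> ?H" "- v \<in> ?H" using v by (auto intro!: in_H simp: span_neg)
    then obtain d a d' a' where dd: "v = d - a *\<^sub>R f\<^sub>1" "- v = d' - a' *\<^sub>R f\<^sub>1" "d \<in> D" "d' \<in> D"
      using split by blast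
    have x1: "x\<^sub>1 \<in> pdual D" "x\<^sub>1 \<bullet> f\<^sub>1 = 0" "\<And>\<phi>. \<phi> \<in> D \<Longrightarrow> x\<^sub>1 \<bullet> \<phi> = 0 \<Longrightarrow> \<exists>k. \<phi> = k *\<^sub>R f\<^sub>1"
      using f1 by (auto simp: exposes_def)
    have "d + d' = (a + a') *\<^sub>R f\<^sub>1" using dd(1,2) by (simp add: algebra_simps)
    then have "x\<^sub>1 \<bullet> d + x\<^sub>1 \<bullet> d' = 0" using x1(2) by (metis inner_add_right inner_scaleR_right mult_zero_right)
    then have "x\<^sub>1 \<bullet> d = 0" using pdualD[OF x1(1) dd(3)] pdualD[OF x1(1) dd(4)] by linarith
    then obtain k where "d = k *\<^sub>R f\<^sub>1" using x1(3)[OF dd(3)] by blast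
    then have "v = (k - a) *\<^sub>R f\<^sub>1" using dd(1) by (simp add: algebra_simps)
    then show ?thesis by blast
  qed
  have r_ex: "\<exists>x. exposes D x (r b)" if "b \<in> B" for b using r(1)[OF that] by (auto simp: P_def)
  have rD: "r b \<in> D" if "b \<in> B" for b using r(1)[OF that] PD by blast
  let ?Q = "insert f\<^sub>1 (r ` B)"
  have "\<exists>q\<in>?Q. \<exists>k\<ge>0. f = k *\<^sub>R q" if f: "exposes D x f" for f x
  proof -
    obtain b\<^sub>0 where b0: "b\<^sub>0 \<in> B" "b\<^sub>0 \<bullet> f = 0" using facet[OF f] by blast
    note fD = exD[OF f]
    \<comment> \<open>The part of \<open>f\<close> visible to \<open>B\<close>; by
      \<open>orth_B\<close> the rest is a multiple of \<open>f\<^sub>1\<close>. Leaving out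
      \<open>b\<^sub>0\<close>, which vanishes at \<open>f\<close>, keeps every summand in the face
      of \<open>D\<close> at \<open>b\<^sub>0\<close>.\<close>
    let ?w = "\<Sum>b\<in>B - {b\<^sub>0}. ((b \<bullet> f) / (b \<bullet> r b)) *\<^sub>R r b"
    have "b \<bullet> (f - ?w) = 0" if b: "b \<in> B" for b
    proof -
      have "b \<bullet> ?w = (\<Sum>b'\<in>B - {b\<^sub>0}. if b' = b then b \<bullet> f else 0)"
        unfolding inner_sum_right
      proof (intro sum.cong refl)
        fix b' assume b': "b' \<in> B - {b\<^sub>0}"
        then show "b \<bullet> (((b' \<bullet> f) / (b' \<bullet> r b')) *\<^sub>R r b') = (if b' = b then b \<bullet> f else 0)"
          using r(2)[of b'] r(3)[of b' b] b by auto
      qed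
      also have "\<dots> = b \<bullet> f" using finB b b0(2) by (cases "b = b\<^sub>0") auto
      finally show ?thesis by (simp add: inner_diff_right)
    qed
    moreover have "f - ?w \<in> span D"
      using fD(1) rD by (intro span_diff span_sum span_scale span_base) auto
    ultimately obtain k where k: "f - ?w = k *\<^sub>R f\<^sub>1" using orth_B by blast
    have f_eq: "f = k *\<^sub>R f\<^sub>1 + ?w" using k by (simp add: algebra_simps)
    have coef: "0 \<le> (b \<bullet> f) / (b \<bullet> r b)" if "b \<in> B" for b
      using pdualD[OF BF(1)[OF that] fD(1)] r(2)[OF that] by simp
    \<comment> \<open>The face at \<open>b\<^sub>0\<close> is simplicial, and
      \<open>f\<^sub>1\<close> lies on one of its generators. The coordinate along that generator is
      nonnegative at \<open>f\<close> and zero on the edges in \<open>?w\<close>, which lie on other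
      generators; so it equals a positive multiple of \<open>k\<close>.\<close>
    have "0 \<le> k"
    proof (rule ccontr)
      assume neg: "\<not> 0 \<le> k"
      obtain \<rho> \<kappa> where \<rho>: "\<rho> \<in> R b\<^sub>0" "0 < \<kappa>" "f\<^sub>1 = \<kappa> *\<^sub>R \<rho>"
        using on_facet[OF f1 b0(1) BF(2)[OF b0(1)]] by blast
      obtain t where "\<And>b. b \<in> R b\<^sub>0 \<Longrightarrow> t b \<in> span (R b\<^sub>0)"
        and t: "\<And>b b'. b \<in> R b\<^sub>0 \<Longrightarrow> b' \<in> R b\<^sub>0 \<Longrightarrow> t b \<bullet> b' = (if b = b' then 1 else 0)"
        using dual_family_exists[OF R(1)[OF b0(1)]] by blast
      have "f \<in> convex_cone hull (R b\<^sub>0)"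
        unfolding R(2)[OF b0(1), symmetric] using fD(1) b0(2) by (simp add: cone_face_def)
      moreover have "0 \<le> b \<bullet> t \<rho>" if "b \<in> R b\<^sub>0" for b
        using t[OF \<rho>(1) that] by (simp add: inner_commute)
      ultimately have "0 \<le> f \<bullet> t \<rho>" by (rule convex_cone_hull_nonneg)
      moreover have "t \<rho> \<bullet> f\<^sub>1 = \<kappa>" using t[OF \<rho>(1) \<rho>(1)] \<rho>(3) by simp
      moreover have "t \<rho> \<bullet> r b = 0" if b: "b \<in> B - {b\<^sub>0}" for b
      proof -
        have b': "b \<in> B" "b\<^sub>0 \<bullet> r b = 0" using b r(3)[of b b\<^sub>0] b0(1) by auto
        obtain x' where "exposes D x' (r b)" using r_ex[OF b'(1)] by blast
        from on_facet[OF this b0(1) b'(2)] obtain \<rho>' \<kappa>' where \<rho>': "\<rho>' \<in> R b\<^sub>0" "r b = \<kappa>' *\<^sub>R \<rho>'" by blast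
        have "\<rho>' \<noteq> \<rho>"
        proof
          assume "\<rho>' = \<rho>"
          then have "r b = (\<kappa>' / \<kappa>) *\<^sub>R f\<^sub>1" using \<rho> \<rho>' by simp
          then have "b \<bullet> r b = 0" using BF(2)[OF b'(1)] by simp
          then show False using r(2)[OF b'(1)] by simp
        qed
        then show ?thesis using t[OF \<rho>(1) \<rho>'(1)] \<rho>'(2) by simp
      qed
      then have "t \<rho> \<bullet> ?w = 0" unfolding inner_sum_right by (intro sum.neutral) auto
      moreover have "t \<rho> \<bullet> f = t \<rho> \<bullet> (k *\<^sub>R f\<^sub>1 + ?w)" using f_eq by (rule arg_cong)
      ultimately have "0 \<le> k * \<kappa>" by (simp only: inner_add_right inner_scaleR_right inner_commute[of f] add_0_right)
      then show False using neg \<rho>(2) by (simp add: zero_le_mult_iff)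
    qed
    have "k *\<^sub>R f\<^sub>1 + ?w \<in> convex_cone hull ?Q"
    proof (intro convex_cone_hull_add)
      show "k *\<^sub>R f\<^sub>1 \<in> convex_cone hull ?Q" using \<open>0 \<le> k\<close> by (intro convex_cone_hull_mul hull_inc) auto
      have "(\<Sum>b\<in>A. ((b \<bullet> f) / (b \<bullet> r b)) *\<^sub>R r b) \<in> convex_cone hull ?Q" if "A \<subseteq> B" for A
        using finite_subset[OF that finB] that
      proof (induction A rule: finite_induct)
        case (insert b A)
        then have "((b \<bullet> f) / (b \<bullet> r b)) *\<^sub>R r b \<in> convex_cone hull ?Q"
          using coef by (intro convex_cone_hull_mul hull_inc) auto
        then show ?case using insert by (simp add: convex_cone_hull_add)
      qed (simp add: convex_cone_hull_contains_0)
      then show "?w \<in> convex_cone hull ?Q" by blast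
    qed
    then have "f \<in> convex_cone hull ?Q" using f_eq by (simp only:)
    moreover have "finite ?Q" "?Q \<subseteq> D" using finB f1D(1) rD by auto
    ultimately obtain q k where q: "q \<in> ?Q" "0 < k" "f = k *\<^sub>R q"
      using exposed_multiple_of_generator[OF D f] by blast
    from q(2) have "0 \<le> k" by simp
    then show ?thesis using q(1,3) by blast
  qed
  then have "D = convex_cone hull ?Q"
    using finB f1D(1) rD by (intro generated_by_exposed_rays[OF D]) auto
  moreover have "independent ?Q"
  proof (rule independent_insertI)
    show "independent (r ` B)"
      using independent_biorthogonal(1)[of B "\<lambda>b. b" r] finB r(2,3) by force
    show "f\<^sub>1 \<notin> span (r ` B)"
    proof
      assume "f\<^sub>1 \<in> span (r ` B)"
      then obtain u where u: "f\<^sub>1 = (\<Sum>x\<in>r ` B. u x *\<^sub>R x)"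
        unfolding span_finite[OF finite_imageI[OF finB]] by blast
      have inj: "inj_on r B"
        using independent_biorthogonal(2)[of B "\<lambda>b. b" r] finB r(2,3) by force
      have "u (r b) = 0" if b: "b \<in> B" for b
      proof -
        have "0 = b \<bullet> (\<Sum>b'\<in>B. u (r b') *\<^sub>R r b')" using BF(2)[OF b] u by (simp add: sum.reindex[OF inj])
        also have "\<dots> = (\<Sum>b'\<in>B. if b' = b then u (r b) * (b \<bullet> r b) else 0)"
          unfolding inner_sum_right by (intro sum.cong) (use r(3)[of _ b] b in auto)
        also have "\<dots> = u (r b) * (b \<bullet> r b)" using finB b by simp
        finally show ?thesis using r(2)[OF b] by simp
      qed
      then have "f\<^sub>1 = 0" unfolding u by (intro sum.neutral) auto
      then show False using f1D(2) by blast
    qed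
  qed
  ultimately show False using nonsimp by (auto simp: simplicial_def)
qed

section \<open>Nonsimplicial cones are entangleable\<close>

text \<open>Opposite exposed rays are taken in the dual cone, so that the exposing points are smooth
  points of \<open>C\<close>. If an exposing point were 0, or if \<open>f\<^sub>1\<close>,
  \<open>f\<^sub>2\<close> spanned everything, the dual cone would be generated by one or two
  independent functionals.\<close>

lemma smooth_kite_of_nonsimplicial:
  fixes C :: "'v::euclidean_space set"
  assumes C: "pointed_cone C" and nonsimp: "\<not> simplicial C"
    and faces: "\<And>h. h \<in> pdual C \<Longrightarrow> h \<noteq> 0 \<Longrightarrow> simplicial (cone_face C h)"
    and dual_faces: "\<And>x. x \<in> C \<Longrightarrow> x \<noteq> 0 \<Longrightarrow> simplicial (cone_face (pdual C) x)"
  obtains e x y u f g where "smooth_kite C e x y u f g"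
proof -
  let ?D = "pdual C"
  have D: "pointed_cone ?D" by (rule pointed_cone_pdual[OF C])
  have DD: "pdual ?D = C" by (rule pdual_pdual[OF C])
  have nonsimpD: "\<not> simplicial ?D" using simplicial_pdual[OF D] nonsimp DD by auto
  obtain f\<^sub>1 x\<^sub>1 f\<^sub>2 x\<^sub>2 where ex: "exposes ?D x\<^sub>1 f\<^sub>1" "exposes ?D x\<^sub>2 f\<^sub>2"
    and diag: "\<And>c. c \<in> C \<Longrightarrow> c \<bullet> f\<^sub>1 = 0 \<Longrightarrow> c \<bullet> f\<^sub>2 = 0 \<Longrightarrow> c = 0"
    using opposite_exposed_rays_exist[OF D nonsimpD] faces dual_faces unfolding DD by blast
  note ex' = ex[unfolded exposes_def DD]
  have x_nz: "x \<noteq> 0" if "exposes ?D x f" for x f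
  proof
    assume x0: "x = 0"
    have f: "f \<in> ?D" "f \<noteq> 0" and all: "\<And>\<phi>. \<phi> \<in> ?D \<Longrightarrow> \<exists>k. \<phi> = k *\<^sub>R f"
      using that x0 by (auto simp: exposes_def)
    have "?D \<subseteq> convex_cone hull {f}"
    proof
      fix \<phi> assume \<phi>: "\<phi> \<in> ?D"
      obtain k where k: "\<phi> = k *\<^sub>R f" using all[OF \<phi>] by blast
      have "\<not> k < 0"
      proof
        assume "k < 0"
        then have "(1 / (- k)) *\<^sub>R \<phi> \<in> ?D" by (intro pointed_coneD(5)[OF D \<phi>]) simp
        moreover have "(1 / (- k)) *\<^sub>R \<phi> = - f" using \<open>k < 0\<close> by (simp add: k)
        ultimately show False using pointed_coneD(6)[OF D f(1)] f(2) by simp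
      qed
      then show "\<phi> \<in> convex_cone hull {f}" unfolding k by (intro convex_cone_hull_mul hull_inc) auto
    qed
    moreover have "convex_cone hull {f} \<subseteq> ?D"
      using D f(1) by (intro hull_minimal) (auto simp: pointed_cone_def)
    ultimately have "?D = convex_cone hull {f}" by (rule subset_antisym)
    moreover have "independent {f}" using f(2) by simp
    ultimately show False using nonsimpD unfolding simplicial_def by blast
  qed
  have nz: "x\<^sub>1 \<noteq> 0" "x\<^sub>2 \<noteq> 0" using x_nz ex by blast+
  have pos: "0 < f\<^sub>1 \<bullet> x\<^sub>2" "0 < f\<^sub>2 \<bullet> x\<^sub>1"
  proof -
    have "f\<^sub>1 \<bullet> x\<^sub>2 \<noteq> 0" using diag[of x\<^sub>2] ex' nz by (auto simp: inner_commute)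
    moreover have "f\<^sub>2 \<bullet> x\<^sub>1 \<noteq> 0" using diag[of x\<^sub>1] ex' nz by (auto simp: inner_commute)
    ultimately show "0 < f\<^sub>1 \<bullet> x\<^sub>2" "0 < f\<^sub>2 \<bullet> x\<^sub>1"
      using pdualD[of f\<^sub>1 C x\<^sub>2] pdualD[of f\<^sub>2 C x\<^sub>1] ex' by (auto simp: less_le)
  qed
  have zero: "f\<^sub>1 \<bullet> x\<^sub>1 = 0" "f\<^sub>2 \<bullet> x\<^sub>2 = 0" using ex' by (auto simp: inner_commute)
  have dim: "\<not> span C \<subseteq> span {f\<^sub>1, f\<^sub>2}"
  proof
    assume sub: "span C \<subseteq> span {f\<^sub>1, f\<^sub>2}"
    have "?D \<subseteq> convex_cone hull {f\<^sub>1, f\<^sub>2}"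
    proof
      fix \<phi> assume \<phi>: "\<phi> \<in> ?D"
      then have "\<phi> \<in> span {f\<^sub>1, f\<^sub>2}" using sub pdual_subset_span[of C] by blast
      then obtain \<alpha> \<beta> where ab: "\<phi> = \<alpha> *\<^sub>R f\<^sub>1 + \<beta> *\<^sub>R f\<^sub>2" by (rule span_pairE)
      have "0 \<le> \<alpha> * (f\<^sub>1 \<bullet> x\<^sub>2)" "0 \<le> \<beta> * (f\<^sub>2 \<bullet> x\<^sub>1)"
        using pdualD[OF \<phi>, of x\<^sub>1] pdualD[OF \<phi>, of x\<^sub>2] ex' zero by (auto simp: ab inner_add_left)
      then have "0 \<le> \<alpha>" "0 \<le> \<beta>" using pos by (auto simp: zero_le_mult_iff)
      then show "\<phi> \<in> convex_cone hull {f\<^sub>1, f\<^sub>2}"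
        unfolding ab by (intro convex_cone_hull_add convex_cone_hull_mul hull_inc) auto
    qed
    moreover have "convex_cone hull {f\<^sub>1, f\<^sub>2} \<subseteq> ?D"
      using D ex' by (intro hull_minimal) (auto simp: pointed_cone_def)
    ultimately have "?D = convex_cone hull {f\<^sub>1, f\<^sub>2}" by (rule subset_antisym)
    moreover have "independent {f\<^sub>1, f\<^sub>2}"
    proof (rule independent_insertI)
      show "f\<^sub>1 \<notin> span {f\<^sub>2}" using pos zero by (auto simp: span_singleton)
      show "independent {f\<^sub>2}" using ex' by simp
    qed
    ultimately show False using nonsimpD unfolding simplicial_def by blast
  qed
  show thesis
  proof (rule smooth_kite_exists[OF C _ _ nz _ _ zero _ _ _ dim])
    show "x\<^sub>1 \<in> C" "x\<^sub>2 \<in> C" "f\<^sub>1 \<in> ?D" "f\<^sub>2 \<in> ?D" using ex' by blast+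
    show "\<exists>k. \<phi> = k *\<^sub>R f\<^sub>1" if "\<phi> \<in> ?D" "\<phi> \<bullet> x\<^sub>1 = 0" for \<phi>
      using ex'(1) that by (auto simp: inner_commute)
    show "\<exists>k. \<phi> = k *\<^sub>R f\<^sub>2" if "\<phi> \<in> ?D" "\<phi> \<bullet> x\<^sub>2 = 0" for \<phi>
      using ex'(2) that by (auto simp: inner_commute)
    show "c = 0" if "c \<in> C" "f\<^sub>1 \<bullet> c = 0" "f\<^sub>2 \<bullet> c = 0" for c
      using diag that by (simp add: inner_commute)
  qed (rule that)
qed

theorem entangleable_nonsimplicial:
  fixes C :: "'v::euclidean_space set" and D :: "'w::euclidean_space set"
  assumes "pointed_cone C" "pointed_cone D" "\<not> simplicial C" "\<not> simplicial D"
  shows "entangleable C D"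
  using assms
proof (induction "dim C + dim D" arbitrary: C D rule: less_induct)
  case less
  note C = less.prems(1) and D = less.prems(2)
  have dual: "\<not> simplicial (pdual C)" "\<not> simplicial (pdual D)"
    using simplicial_pdual[OF pointed_cone_pdual[OF C]] simplicial_pdual[OF pointed_cone_pdual[OF D]]
      pdual_pdual[OF C] pdual_pdual[OF D] less.prems(3,4) by auto
  have dims: "dim (pdual C) = dim C" "dim (pdual D) = dim D"
    using span_pdual[OF C] span_pdual[OF D] by (metis dim_span)+
  note pC = pointed_cone_pdual[OF C] and pD = pointed_cone_pdual[OF D]
  have span: "h \<in> pdual C \<Longrightarrow> h \<in> span C" "h \<in> C \<Longrightarrow> h \<in> span (pdual C)" for h
    using pdual_subset_span[of C] span_pdual[OF C] span_base by blast+
  have span': "h \<in> pdual D \<Longrightarrow> h \<in> span D" "h \<in> D \<Longrightarrow> h \<in> span (pdual D)" for h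
    using pdual_subset_span[of D] span_pdual[OF D] span_base by blast+
  show ?case
  proof (rule ccontr)
    assume neg: "\<not> entangleable C D"
    \<comment> \<open>Together with equality of dimensions this lets the induction hypothesis reach
      the faces of \<open>pdual C\<close> and \<open>pdual D\<close>.\<close>
    have neg': "\<not> entangleable (pdual C) (pdual D)" using neg entangleable_pdual[OF C D] by blast
    have 1: "simplicial (cone_face C h)" if h: "h \<in> pdual C" "h \<noteq> 0" for h
      using less.hyps[of "cone_face C h" D] dim_cone_face_less[OF span(1)[OF h(1)] h(2)]
        pointed_cone_face[OF C] D less.prems(4) entangleable_face[OF C D h(1)] neg by auto
    have 2: "simplicial (cone_face (pdual C) x)" if x: "x \<in> C" "x \<noteq> 0" for x
      using less.hyps[of "cone_face (pdual C) x" "pdual D"] dim_cone_face_less[OF span(2)[OF x(1)] x(2)]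
        pointed_cone_face[OF pC] pD dual(2) dims x pdual_pdual[OF C]
        entangleable_face[OF pC pD, of x] neg' by auto
    have 3: "simplicial (cone_face D h)" if h: "h \<in> pdual D" "h \<noteq> 0" for h
      using less.hyps[of C "cone_face D h"] dim_cone_face_less[OF span'(1)[OF h(1)] h(2)]
        pointed_cone_face[OF D] C less.prems(3) entangleable_face[OF D C h(1)] neg
        entangleable_swap[of C "cone_face D h"] entangleable_swap[of D C] by auto
    have 4: "simplicial (cone_face (pdual D) x)" if x: "x \<in> D" "x \<noteq> 0" for x
      using less.hyps[of "pdual C" "cone_face (pdual D) x"] dim_cone_face_less[OF span'(2)[OF x(1)] x(2)]
        pointed_cone_face[OF pD] pC dual(1) dims x pdual_pdual[OF D]
        entangleable_face[OF pD pC, of x] neg'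
        entangleable_swap[of "pdual C" "cone_face (pdual D) x"] entangleable_swap[of "pdual D" "pdual C"] by auto
    obtain e x y u f g where k: "smooth_kite C e x y u f g"
      using smooth_kite_of_nonsimplicial[OF C less.prems(3) 1 2] by blast
    obtain e' x' y' u' f' g' where k': "smooth_kite D e' x' y' u' f' g'"
      using smooth_kite_of_nonsimplicial[OF D less.prems(4) 3 4] by blast
    from neg entangleable_smooth_kites[OF C D k k'] show False by blast
  qed
qed

section \<open>Real structure of a complex *-vector space\<close>

lemma star_0 [simp]: "star (0 :: 'a::complex_star_vector) = 0"
  using star_scaleC[of 0 "0 :: 'a"] by simp

lemma star_minus: "star (- x) = - star (x :: 'a::complex_star_vector)"
  using star_add[of x "- x"] by (simp add: eq_neg_iff_add_eq_0 add.commute)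

lemma star_diff: "star (x - y) = star x - star (y :: 'a::complex_star_vector)"
  using star_add[of x "- y"] by (simp add: star_minus)

lemma star_scaleR: "star (r *\<^sub>R x) = r *\<^sub>R star (x :: 'a::complex_star_vector)"
  by (simp add: scaleR_scaleC star_scaleC)

lemma star_sum: "star (sum f I) = (\<Sum>i\<in>I. star (f i :: 'a::complex_star_vector))"
  by (induction I rule: infinite_finite_induct) (auto simp: star_add)

lemma subspace_selfadjoint: "subspace (selfadjoint :: 'a::complex_star_vector set)"
  by (auto simp: subspace_def selfadjoint_def star_add star_scaleR)

definition re_part :: "'a::complex_star_vector \<Rightarrow> 'a"
  where "re_part a = (1/2) *\<^sub>C (a + star a)"

definition im_part :: "'a::complex_star_vector \<Rightarrow> 'a"
  where "im_part a = (- \<i>/2) *\<^sub>C (a - star a)"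

lemma re_part_selfadjoint: "re_part a \<in> selfadjoint"
  by (simp add: re_part_def selfadjoint_def star_scaleC star_add add.commute)

lemma im_part_selfadjoint: "im_part a \<in> selfadjoint"
proof -
  have "star (im_part a) = (\<i>/2) *\<^sub>C (star a - a)"
    by (simp add: im_part_def star_scaleC star_diff star_minus)
  also have "\<dots> = im_part a"
    by (simp add: im_part_def complex_vector.scale_right_diff_distrib complex_vector.scale_minus_left)
  finally show ?thesis by (simp add: selfadjoint_def)
qed

lemma re_im_decomposition: "a = re_part a + \<i> *\<^sub>C im_part a"
proof -
  have "re_part a + \<i> *\<^sub>C im_part a = (1/2) *\<^sub>C (a + star a) + (1/2) *\<^sub>C (a - star a)"
    by (simp add: re_part_def im_part_def scaleC_scaleC)
  also have "\<dots> = (1/2) *\<^sub>C (a + a)"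
    by (simp add: scaleC_add_right complex_vector.scale_right_diff_distrib)
  also have "\<dots> = (1/2 + 1/2) *\<^sub>C a"
    by (simp only: scaleC_add_left scaleC_add_right)
  also have "\<dots> = a" by (simp add: scaleC_one)
  finally show ?thesis by simp
qed

lemma re_part_add: "re_part (a + b) = re_part a + re_part b"
  by (simp add: re_part_def star_add scaleC_add_right algebra_simps)

lemma im_part_add: "im_part (a + b) = im_part a + im_part b"
  by (simp add: im_part_def star_add scaleC_add_right complex_vector.scale_right_diff_distrib algebra_simps)

lemma re_part_of_selfadjoint: "v \<in> selfadjoint \<Longrightarrow> re_part v = v"
proof -
  assume "v \<in> selfadjoint"
  then have "re_part v = (1/2) *\<^sub>C v + (1/2) *\<^sub>C v"
    by (simp add: re_part_def selfadjoint_def scaleC_add_right)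
  also have "\<dots> = (1/2 + 1/2) *\<^sub>C v" by (simp only: scaleC_add_left)
  finally show "re_part v = v" by (simp add: scaleC_one)
qed

lemma im_part_of_selfadjoint: "v \<in> selfadjoint \<Longrightarrow> im_part v = 0"
  by (simp add: im_part_def selfadjoint_def)

lemma re_im_unique:
  assumes "v \<in> selfadjoint" "w \<in> selfadjoint"
  shows "re_part (v + \<i> *\<^sub>C w) = v" "im_part (v + \<i> *\<^sub>C w) = w"
proof -
  have st: "star v = v" "star w = w" using assms by (auto simp: selfadjoint_def)
  have "re_part (\<i> *\<^sub>C w) = 0"
    by (simp add: re_part_def star_scaleC st complex_vector.scale_minus_left)
  then show "re_part (v + \<i> *\<^sub>C w) = v"
    using re_part_of_selfadjoint[OF assms(1)] by (simp add: re_part_add)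
  have "im_part (\<i> *\<^sub>C w) = (- \<i>/2) *\<^sub>C (\<i> *\<^sub>C w + \<i> *\<^sub>C w)"
    by (simp add: im_part_def star_scaleC st complex_vector.scale_minus_left)
  also have "\<dots> = (- \<i>/2 * (\<i> + \<i>)) *\<^sub>C w"
    by (simp only: scaleC_add_left[symmetric] scaleC_scaleC)
  also have "\<dots> = w" by (simp add: scaleC_one)
  finally show "im_part (v + \<i> *\<^sub>C w) = w"
    using im_part_of_selfadjoint[OF assms(1)] by (simp add: im_part_add)
qed

lemma re_im_scaleC:
  "re_part (c *\<^sub>C a) = Re c *\<^sub>R re_part a - Im c *\<^sub>R im_part a"
  "im_part (c *\<^sub>C a) = Im c *\<^sub>R re_part a + Re c *\<^sub>R im_part a"
proof -
  let ?v = "Re c *\<^sub>R re_part a - Im c *\<^sub>R im_part a" and ?w = "Im c *\<^sub>R re_part a + Re c *\<^sub>R im_part a"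
  have "c *\<^sub>C a = (of_real (Re c) + \<i> * of_real (Im c)) *\<^sub>C (re_part a + \<i> *\<^sub>C im_part a)"
    using re_im_decomposition[of a] complex_eq[of c] by simp
  also have "\<dots> = ?v + \<i> *\<^sub>C ?w"
  proof -
    have "(\<i> * of_real (Im c)) *\<^sub>C \<i> *\<^sub>C im_part a = - (Im c *\<^sub>R im_part a)"
    proof -
      have "(\<i> * of_real (Im c)) * \<i> = - of_real (Im c)" by (simp add: algebra_simps)
      then show ?thesis by (simp add: scaleR_scaleC scaleC_scaleC complex_vector.scale_minus_left)
    qed
    then show ?thesis
      by (simp add: scaleR_scaleC scaleC_add_left scaleC_add_right scaleC_scaleC algebra_simps)
  qed
  finally have eq: "c *\<^sub>C a = ?v + \<i> *\<^sub>C ?w" .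
  have "?v \<in> selfadjoint" "?w \<in> selfadjoint"
    using re_part_selfadjoint[of a] im_part_selfadjoint[of a] subspace_selfadjoint
    by (auto intro!: subspace_add subspace_diff subspace_scale)
  then show "re_part (c *\<^sub>C a) = ?v" "im_part (c *\<^sub>C a) = ?w"
    unfolding eq by (rule re_im_unique)+
qed

definition complexify :: "('a::complex_star_vector \<Rightarrow> real) \<Rightarrow> 'a \<Rightarrow> complex"
  where "complexify r a = of_real (r (re_part a)) + \<i> * of_real (r (im_part a))"

text \<open>Restricted to selfadjoint elements because the coordinate maps to which it is applied
  are inverses taken on that set only.\<close>

definition sa_linear :: "('a::complex_star_vector \<Rightarrow> real) \<Rightarrow> bool"
  where "sa_linear r \<longleftrightarrow> (\<forall>v\<in>selfadjoint. \<forall>w\<in>selfadjoint. r (v + w) = r v + r w) \<and>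
    (\<forall>c. \<forall>v\<in>selfadjoint. r (c *\<^sub>R v) = c * r v)"

lemma clinear_complexify:
  assumes "sa_linear r"
  shows "clinear (complexify r)"
proof
  have add: "r (v + w) = r v + r w" if "v \<in> selfadjoint" "w \<in> selfadjoint" for v w
    using assms that by (simp add: sa_linear_def)
  have scale: "r (c *\<^sub>R v) = c * r v" if "v \<in> selfadjoint" for c v
    using assms that by (simp add: sa_linear_def)
  have mem: "c *\<^sub>R re_part a \<in> selfadjoint" "c *\<^sub>R im_part a \<in> selfadjoint" for c and a :: 'a
    using re_part_selfadjoint im_part_selfadjoint subspace_selfadjoint by (auto intro!: subspace_scale)
  fix a b :: 'a and c :: complex
  show "complexify r (a + b) = complexify r a + complexify r b"
    by (simp add: complexify_def re_part_add im_part_add add re_part_selfadjoint im_part_selfadjoint algebra_simps)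
  have "r (re_part (c *\<^sub>C a)) = r (Re c *\<^sub>R re_part a + (- Im c) *\<^sub>R im_part a)"
    by (simp add: re_im_scaleC)
  also have "\<dots> = Re c * r (re_part a) - Im c * r (im_part a)"
    by (simp only: add[OF mem(1) mem(2)] scale[OF re_part_selfadjoint] scale[OF im_part_selfadjoint])
  finally have 1: "r (re_part (c *\<^sub>C a)) = Re c * r (re_part a) - Im c * r (im_part a)" .
  have 2: "r (im_part (c *\<^sub>C a)) = Im c * r (re_part a) + Re c * r (im_part a)"
    by (simp only: re_im_scaleC add[OF mem(1) mem(2)] scale[OF re_part_selfadjoint] scale[OF im_part_selfadjoint])
  show "complexify r (c *\<^sub>C a) = c *\<^sub>C complexify r a"
    by (simp add: complexify_def 1 2 complex_eq_iff)
qed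

lemma complexify_selfadjoint:
  assumes "sa_linear r" "v \<in> selfadjoint"
  shows "complexify r v = of_real (r v)"
proof -
  have "r (0 *\<^sub>R v) = 0 * r v" using assms unfolding sa_linear_def by blast
  then show ?thesis
    using assms by (simp add: complexify_def re_part_of_selfadjoint im_part_of_selfadjoint)
qed

section \<open>Archimedean cones of selfadjoint elements\<close>

text \<open>The operator system axioms at matrix size 1, freed from 1 by 1 matrices.\<close>

definition archimedean_cone :: "'a::complex_star_vector set \<Rightarrow> 'a \<Rightarrow> bool"
  where "archimedean_cone C e \<longleftrightarrow> C \<subseteq> selfadjoint \<and> convex_cone C \<and> (\<forall>x\<in>C. - x \<in> C \<longrightarrow> x = 0) \<and>
    e \<in> selfadjoint \<and> (\<forall>v\<in>selfadjoint. \<exists>r>0. r *\<^sub>R e - v \<in> C) \<and>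
    (\<forall>v\<in>selfadjoint. (\<forall>r>0. r *\<^sub>R e + v \<in> C) \<longrightarrow> v \<in> C)"

lemma archimedean_coneD:
  assumes "archimedean_cone C e"
  shows "C \<subseteq> selfadjoint" "convex_cone C" "x \<in> C \<Longrightarrow> - x \<in> C \<Longrightarrow> x = 0" "e \<in> selfadjoint"
    "v \<in> selfadjoint \<Longrightarrow> \<exists>r>0. r *\<^sub>R e - v \<in> C"
    "v \<in> selfadjoint \<Longrightarrow> (\<And>r. r > 0 \<Longrightarrow> r *\<^sub>R e + v \<in> C) \<Longrightarrow> v \<in> C"
  using assms by (simp_all add: archimedean_cone_def)

lemma base_cone_archimedean:
  assumes "operator_system M e"
  shows "archimedean_cone (base_cone M) e"
proof -
  interpret operator_system M e by fact
  let ?m = "\<lambda>x :: 'a. Matrix.mat 1 1 (\<lambda>_. x)"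
  have inj: "x = y" if eq: "?m x = ?m y" for x y
  proof -
    have "x = ?m x $$ (0, 0)" by simp
    also have "\<dots> = ?m y $$ (0, 0)" by (simp only: eq)
    also have "\<dots> = y" by simp
    finally show ?thesis .
  qed
  have add: "?m x + ?m y = ?m (x + y)" for x y by (intro eq_matI) auto
  have scale: "map_mat (scaleR r) (?m x) = ?m (r *\<^sub>R x)" for r x by (intro eq_matI) auto
  have neg: "- ?m x = ?m (- x)" for x by (intro eq_matI) auto
  have sub: "?m x - ?m y = ?m (x - y)" for x y by (intro eq_matI) auto
  have zero: "0\<^sub>m 1 1 = ?m 0" by (intro eq_matI) auto
  have st: "mat_star (?m x) = ?m (star x)" for x by (intro eq_matI) (auto simp: mat_star_def)
  have unit: "diag_unit e 1 = ?m e" by (intro eq_matI) (auto simp: diag_unit_def)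
  have carrier: "?m x \<in> carrier_mat 1 1" for x by simp
  have one: "(1::nat) \<ge> 1" by simp
  have sa: "?m x \<in> carrier_mat 1 1 \<and> mat_star (?m x) = ?m x" if "x \<in> selfadjoint" for x
    using st[of x] carrier[of x] that by (simp only: selfadjoint_def mem_Collect_eq)
  have mem: "x \<in> base_cone M \<longleftrightarrow> ?m x \<in> M 1" for x by (simp only: base_cone_def mem_Collect_eq)
  show ?thesis
    unfolding archimedean_cone_def convex_cone_iff
  proof (intro conjI ballI allI impI subsetI)
    fix x assume "x \<in> base_cone M"
    then have "mat_star (?m x) = ?m x" using cone_carrier[OF one] unfolding mem by blast
    then have "?m (star x) = ?m x" by (simp only: st)
    then have "star x = x" by (rule inj)
    then show "x \<in> selfadjoint" by (simp add: selfadjoint_def)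
  next
    show "0 \<in> base_cone M" using cone_zero[OF one] by (simp only: zero mem)
  next
    fix x y assume "x \<in> base_cone M" "y \<in> base_cone M"
    then show "x + y \<in> base_cone M"
      unfolding mem add[symmetric] by (rule cone_add[OF one])
  next
    fix x and c :: real assume "x \<in> base_cone M" "0 \<le> c"
    then show "c *\<^sub>R x \<in> base_cone M"
      unfolding mem scale[symmetric] by (rule cone_scale[OF one])
  next
    fix x assume "x \<in> base_cone M" "- x \<in> base_cone M"
    then have "?m x = 0\<^sub>m 1 1"
      unfolding mem neg[symmetric] by (rule cone_pointed[OF one])
    then have "?m x = ?m 0" by (simp only: zero)
    then show "x = 0" by (rule inj)
  next
    show "e \<in> selfadjoint" using unit_selfadjoint by (simp add: selfadjoint_def)
  next
    fix v :: 'a assume v: "v \<in> selfadjoint"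
    obtain r where r: "r > 0" "map_mat ((*\<^sub>R) r) (diag_unit e 1) - ?m v \<in> M 1"
      using order_unit[OF one conjunct1[OF sa[OF v]] conjunct2[OF sa[OF v]]] by blast
    have "r *\<^sub>R e - v \<in> base_cone M" using r(2) by (simp only: mem unit scale sub)
    with r(1) show "\<exists>r>0. r *\<^sub>R e - v \<in> base_cone M" by blast
  next
    fix v :: 'a assume v: "v \<in> selfadjoint" "\<forall>r>0. r *\<^sub>R e + v \<in> base_cone M"
    have "map_mat ((*\<^sub>R) r) (diag_unit e 1) + ?m v \<in> M 1" if "r > 0" for r
    proof -
      have "r *\<^sub>R e + v \<in> base_cone M" using v(2) that by blast
      then show ?thesis by (simp only: mem unit scale add)
    qed
    then have "?m v \<in> M 1"
      using archimedean[OF one conjunct1[OF sa[OF v(1)]] conjunct2[OF sa[OF v(1)]]] by blast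
    then show "v \<in> base_cone M" by (simp only: mem)
  qed
qed

text \<open>Complex scalars mix real and imaginary parts with real coefficients, so the parts of a
  complex spanning set span the selfadjoint elements over the reals.\<close>

lemma selfadjoint_finite_basis:
  fixes B :: "'a::complex_star_vector set"
  assumes "finite B" "complex_vector.span B = UNIV"
  obtains B' :: "'a set" where "finite B'" "independent B'" "span B' = selfadjoint"
proof -
  let ?S = "re_part ` B \<union> im_part ` B"
  have sub: "?S \<subseteq> selfadjoint" using re_part_selfadjoint im_part_selfadjoint by blast
  have reim: "re_part a \<in> span ?S \<and> im_part a \<in> span ?S" for a
  proof -
    have "a \<in> complex_vector.span B" using assms(2) by simp
    then show ?thesis
    proof (induction rule: complex_vector.span_induct_alt)
      case base
      have "re_part (0::'a) = 0" "im_part (0::'a) = 0" by (simp_all add: re_part_def im_part_def)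
      then show ?case by (simp add: span_zero)
    next
      case (step c x y)
      have "re_part x \<in> span ?S" "im_part x \<in> span ?S" using step(1) by (auto intro!: span_base)
      then show ?case
        using step(2) by (simp add: re_part_add im_part_add re_im_scaleC span_add span_diff span_scale)
    qed
  qed
  have "v \<in> span ?S" if "v \<in> selfadjoint" for v
    using re_part_of_selfadjoint[OF that] reim[of v] by simp
  then have "selfadjoint \<subseteq> span ?S" by blast
  moreover have "span ?S \<subseteq> selfadjoint" using sub subspace_selfadjoint by (rule span_minimal)
  ultimately have span: "span ?S = selfadjoint" by blast
  obtain B' where B': "B' \<subseteq> ?S" "independent B'" "?S \<subseteq> span B'"
    using maximal_independent_subset by blast
  have "finite B'" using assms(1) by (intro finite_subset[OF B'(1)]) simp
  moreover have "span B' = selfadjoint"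
    using span_mono[OF B'(1)] span_minimal[OF B'(3) subspace_span] span by blast
  ultimately show thesis using that B'(2) by blast
qed

text \<open>The statement fixes no Euclidean space, so one is attached to the type: its coordinates are
  indexed by a chosen finite real basis of the selfadjoint elements.  The extra index \<open>0\<close> keeps
  the type inhabited when that basis is empty or when the space is infinite-dimensional.\<close>

definition sa_basis :: "'a::complex_star_vector set"
  where "sa_basis = (if \<exists>B::'a set. finite B \<and> independent B \<and> span B = selfadjoint
    then SOME B. finite B \<and> independent B \<and> span B = selfadjoint else {})"

lemma finite_sa_basis: "finite (sa_basis :: 'a::complex_star_vector set)"
proof (cases "\<exists>B::'a set. finite B \<and> independent B \<and> span B = selfadjoint")
  case True
  from someI_ex[OF this] show ?thesis using True by (simp add: sa_basis_def)
qed (simp only: sa_basis_def if_False finite.emptyI)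

lemma sa_basis:
  assumes "\<exists>B::'a::complex_star_vector set. finite B \<and> independent B \<and> span B = selfadjoint"
  shows "independent (sa_basis :: 'a set)" "span sa_basis = (selfadjoint :: 'a set)"
proof -
  have "finite (sa_basis::'a set) \<and> independent (sa_basis::'a set) \<and> span sa_basis = (selfadjoint::'a set)"
    using someI_ex[OF assms] assms by (simp add: sa_basis_def)
  then show "independent (sa_basis :: 'a set)" "span sa_basis = (selfadjoint :: 'a set)" by auto
qed

typedef (overloaded) ('a::complex_star_vector) sa_index = "insert 0 (sa_basis :: 'a set)"
  by blast

instance sa_index :: (complex_star_vector) finite
proof
  have "(UNIV :: 'a sa_index set) = Abs_sa_index ` (insert 0 (sa_basis :: 'a set))"
    by (rule type_definition.univ[OF type_definition_sa_index])
  moreover have "finite (Abs_sa_index ` (insert 0 (sa_basis :: 'a set)))" by (simp add: finite_sa_basis)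
  ultimately show "finite (UNIV :: 'a sa_index set)" by (simp only:)
qed

lemma selfadjoint_coordinates:
  assumes "\<exists>B::'a::complex_star_vector set. finite B \<and> independent B \<and> span B = selfadjoint"
  obtains \<Psi> :: "real ^ ('a::complex_star_vector) sa_index \<Rightarrow> 'a" and Y
  where "linear \<Psi>" "subspace Y" "inj_on \<Psi> Y" "\<Psi> ` Y = selfadjoint"
proof -
  let ?B = "sa_basis :: 'a set"
  note B = sa_basis[OF assms] and fin = finite_sa_basis[where 'a='a]
  have B0: "0 \<notin> ?B" using B(1) dependent_zero by blast
  have rep: "Rep_sa_index (Abs_sa_index b) = b" if "b \<in> ?B" for b
    using that by (simp add: Abs_sa_index_inverse)
  define \<Psi> :: "real ^ 'a sa_index \<Rightarrow> 'a" where "\<Psi> y = (\<Sum>b\<in>?B. vec_nth y (Abs_sa_index b) *\<^sub>R b)" for y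
  \<comment> \<open>\<open>\<Psi>\<close> ignores the coordinate at the extra index; fixing it at 0
    restores injectivity.\<close>
  define Y :: "(real ^ 'a sa_index) set" where "Y = {y. vec_nth y (Abs_sa_index 0) = 0}"
  show thesis
  proof (rule that[of \<Psi> Y])
    show lin: "linear \<Psi>"
      by (intro linearI) (auto simp: \<Psi>_def scaleR_add_left sum.distrib scaleR_sum_right)
    show sub: "subspace Y" by (auto simp: subspace_def Y_def)
    have "y = 0" if y: "y \<in> Y" "\<Psi> y = 0" for y
    proof -
      have "vec_nth y (Abs_sa_index b) = 0" if "b \<in> ?B" for b
        using independentD[OF B(1) fin subset_refl, of "\<lambda>b. vec_nth y (Abs_sa_index b)"] y(2) that
        by (simp add: \<Psi>_def)
      then have "vec_nth y i = 0" for i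
        using y(1) by (cases i) (auto simp: Y_def)
      then show "y = 0" by (simp add: Finite_Cartesian_Product.vec_eq_iff)
    qed
    note zero = this
    show "inj_on \<Psi> Y"
    proof (intro inj_onI)
      fix x y assume "x \<in> Y" "y \<in> Y" "\<Psi> x = \<Psi> y"
      then have "x - y = 0"
        by (intro zero subspace_diff[OF sub]) (simp_all add: linear_diff[OF lin])
      then show "x = y" by simp
    qed
    show "\<Psi> ` Y = selfadjoint"
    proof
      show "\<Psi> ` Y \<subseteq> selfadjoint"
        unfolding B(2)[symmetric] \<Psi>_def by (intro image_subsetI span_sum span_scale span_base)
      show "selfadjoint \<subseteq> \<Psi> ` Y"
      proof
        fix v :: 'a assume "v \<in> selfadjoint"
        then obtain c where c: "v = (\<Sum>b\<in>?B. c b *\<^sub>R b)"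
          unfolding B(2)[symmetric] span_finite[OF fin] by blast
        define y :: "real ^ 'a sa_index" where "y = (\<chi> i. if Rep_sa_index i = 0 then 0 else c (Rep_sa_index i))"
        have "vec_nth y (Abs_sa_index b) = c b" if "b \<in> ?B" for b
          using that rep[OF that] B0 by (auto simp: y_def)
        then have "\<Psi> y = v" unfolding \<Psi>_def c by (intro sum.cong) auto
        moreover have "y \<in> Y" by (simp add: Y_def y_def Abs_sa_index_inverse)
        ultimately show "v \<in> \<Psi> ` Y" by blast
      qed
    qed
  qed
qed

section \<open>Coordinates\<close>

locale coordinatized_cone =
  fixes \<Psi> :: "'v::euclidean_space \<Rightarrow> 'a::complex_star_vector" and Y :: "'v set"
    and C :: "'a set" and e :: 'a
  assumes lin: "linear \<Psi>" and sub: "subspace Y" and inj: "inj_on \<Psi> Y" and image: "\<Psi> ` Y = selfadjoint"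
    and arch: "archimedean_cone C e"
begin

definition pull :: "'v set"
  where "pull = {y \<in> Y. \<Psi> y \<in> C}"

definition coord :: "'a \<Rightarrow> 'v"
  where "coord = inv_into Y \<Psi>"

lemma C_sa: "C \<subseteq> selfadjoint" and C_cone: "convex_cone C" and e_sa: "e \<in> selfadjoint"
  using archimedean_coneD(1,2,4)[OF arch] by blast+

lemma e_in_C: "e \<in> C"
proof -
  have "(0::'a) \<in> selfadjoint" using subspace_0[OF subspace_selfadjoint] .
  then obtain r where r: "r > 0" "r *\<^sub>R e - 0 \<in> C" using archimedean_coneD(5)[OF arch] by blast
  then have "(1 / r) *\<^sub>R (r *\<^sub>R e - 0) \<in> C" by (intro convex_cone_scaleR[OF C_cone]) auto
  then show ?thesis using r(1) by simp
qed

lemma coord_in: "v \<in> selfadjoint \<Longrightarrow> coord v \<in> Y"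
  and Psi_coord: "v \<in> selfadjoint \<Longrightarrow> \<Psi> (coord v) = v"
  unfolding coord_def using image by (auto intro: inv_into_into f_inv_into_f)

lemma coord_Psi: "y \<in> Y \<Longrightarrow> coord (\<Psi> y) = y"
  unfolding coord_def by (rule inv_into_f_f[OF inj])

lemma Psi_sa: "y \<in> Y \<Longrightarrow> \<Psi> y \<in> selfadjoint"
  using image by blast

lemma coord_in_pull: "v \<in> C \<Longrightarrow> coord v \<in> pull"
  using C_sa coord_in Psi_coord by (auto simp: pull_def)

lemma coord_add:
  assumes "v \<in> selfadjoint" "w \<in> selfadjoint"
  shows "coord (v + w) = coord v + coord w"
proof -
  have "coord v + coord w \<in> Y" using assms by (intro subspace_add[OF sub] coord_in)
  from coord_Psi[OF this] show ?thesis using assms by (simp add: linear_add[OF lin] Psi_coord)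
qed

lemma coord_scale:
  assumes "v \<in> selfadjoint"
  shows "coord (c *\<^sub>R v) = c *\<^sub>R coord v"
proof -
  have "c *\<^sub>R coord v \<in> Y" using assms by (intro subspace_scale[OF sub] coord_in)
  from coord_Psi[OF this] show ?thesis using assms by (simp add: linear_scale[OF lin] Psi_coord)
qed

text \<open>A multiple of \<open>e\<close> dominates each vector of an orthonormal basis and its
  negative. A short \<open>z\<close> has small coefficients, so the multiples of \<open>e\<close>
  consumed by its expansion add up to at most one \<open>e\<close>.\<close>

lemma unit_interior:
  obtains \<delta> where "0 < \<delta>" "\<And>z. z \<in> Y \<Longrightarrow> norm z \<le> \<delta> \<Longrightarrow> e + \<Psi> z \<in> C"
proof -
  have "\<exists>B. B \<subseteq> Y \<and> pairwise real_inner_class.orthogonal B \<and> (\<forall>b\<in>B. norm b = 1) \<and>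
      independent B \<and> span B = Y"
    by (rule orthonormal_basis_subspace[OF sub]) blast
  then obtain B where B: "B \<subseteq> Y" "pairwise real_inner_class.orthogonal B" "\<And>b. b \<in> B \<Longrightarrow> norm b = 1"
      "independent B" "span B = Y"
    by metis
  have fin: "finite B" using B(4) by (rule independent_imp_finite)
  have "\<exists>r>0. r *\<^sub>R e + \<Psi> b \<in> C \<and> r *\<^sub>R e - \<Psi> b \<in> C" if "b \<in> B" for b
  proof -
    have sa: "\<Psi> b \<in> selfadjoint" "- \<Psi> b \<in> selfadjoint"
      using Psi_sa B(1) that subspace_neg[OF subspace_selfadjoint] by blast+
    obtain r where r: "r > 0" "r *\<^sub>R e - \<Psi> b \<in> C"
      using archimedean_coneD(5)[OF arch sa(1)] by blast
    obtain s where s: "s > 0" "s *\<^sub>R e - - \<Psi> b \<in> C"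
      using archimedean_coneD(5)[OF arch sa(2)] by blast
    have re: "t *\<^sub>R e \<in> C" if "t > 0" for t
      using e_in_C that by (intro convex_cone_scaleR[OF C_cone]) auto
    have "s *\<^sub>R e + (r *\<^sub>R e - \<Psi> b) \<in> C" "r *\<^sub>R e + (s *\<^sub>R e - - \<Psi> b) \<in> C"
      using convex_cone_add[OF C_cone re[OF s(1)] r(2)] convex_cone_add[OF C_cone re[OF r(1)] s(2)] .
    then have "(r + s) *\<^sub>R e - \<Psi> b \<in> C" "(r + s) *\<^sub>R e + \<Psi> b \<in> C" by (simp_all add: algebra_simps)
    then show ?thesis using r(1) s(1) by (intro exI[of _ "r + s"]) auto
  qed
  then obtain r where r: "\<And>b. b \<in> B \<Longrightarrow> r b > 0" "\<And>b. b \<in> B \<Longrightarrow> r b *\<^sub>R e + \<Psi> b \<in> C"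
      "\<And>b. b \<in> B \<Longrightarrow> r b *\<^sub>R e - \<Psi> b \<in> C"
    by metis
  \<comment> \<open>The \<open>+ 1\<close> keeps \<open>R\<close> positive when the basis is
    empty.\<close>
  define R where "R = sum r B + 1"
  have R: "0 < R" unfolding R_def using r(1) by (intro add_nonneg_pos sum_nonneg) (auto simp: less_imp_le)
  show thesis
  proof (rule that[of "1 / R"])
    show "0 < 1 / R" using R by simp
    fix z assume z: "z \<in> Y" "norm z \<le> 1 / R"
    have z_eq: "(\<Sum>b\<in>B. (z \<bullet> b) *\<^sub>R b) = z"
      using orthonormal_basis_expand[OF B(2,3) _ fin] z(1) B(5) by blast
    have zb: "\<bar>z \<bullet> b\<bar> \<le> 1 / R" if "b \<in> B" for b
      using Cauchy_Schwarz_ineq2[of z b] B(3)[OF that] z(2) by simp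
    have summand: "(\<bar>z \<bullet> b\<bar> * r b) *\<^sub>R e + (z \<bullet> b) *\<^sub>R \<Psi> b \<in> C" if b: "b \<in> B" for b
    proof (cases "0 \<le> z \<bullet> b")
      case True
      then have "(z \<bullet> b) *\<^sub>R (r b *\<^sub>R e + \<Psi> b) \<in> C" using r(2)[OF b] by (intro convex_cone_scaleR[OF C_cone])
      then show ?thesis using True by (simp add: scaleR_add_right)
    next
      case False
      then have "(- (z \<bullet> b)) *\<^sub>R (r b *\<^sub>R e - \<Psi> b) \<in> C" using r(3)[OF b] by (intro convex_cone_scaleR[OF C_cone]) auto
      then show ?thesis using False by (simp add: scaleR_diff_right algebra_simps)
    qed
    have sum_in: "(\<Sum>b\<in>A. g b) \<in> C" if "\<And>b. b \<in> A \<Longrightarrow> g b \<in> C" for A and g :: "'v \<Rightarrow> 'a"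
      using that
    proof (induction A rule: infinite_finite_induct)
      case (insert b A)
      then have "g b \<in> C" "sum g A \<in> C" by blast+
      then show ?case using insert(1,2) by (simp add: convex_cone_add[OF C_cone])
    qed (simp_all add: convex_cone_contains_0[OF C_cone])
    define s where "s = (\<Sum>b\<in>B. \<bar>z \<bullet> b\<bar> * r b)"
    have "s \<le> (\<Sum>b\<in>B. 1 / R * r b)"
      unfolding s_def using zb r(1) by (intro sum_mono mult_right_mono) (auto simp: less_imp_le)
    also have "\<dots> = sum r B / R" by (simp add: sum_divide_distrib)
    also have "\<dots> \<le> 1" using R by (simp add: R_def)
    finally have "(1 - s) *\<^sub>R e \<in> C" using e_in_C by (intro convex_cone_scaleR[OF C_cone]) auto
    moreover have "(\<Sum>b\<in>B. (\<bar>z \<bullet> b\<bar> * r b) *\<^sub>R e + (z \<bullet> b) *\<^sub>R \<Psi> b) \<in> C" by (rule sum_in[OF summand])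
    ultimately have "(1 - s) *\<^sub>R e + (\<Sum>b\<in>B. (\<bar>z \<bullet> b\<bar> * r b) *\<^sub>R e + (z \<bullet> b) *\<^sub>R \<Psi> b) \<in> C"
      by (rule convex_cone_add[OF C_cone])
    moreover have "(\<Sum>b\<in>B. (\<bar>z \<bullet> b\<bar> * r b) *\<^sub>R e + (z \<bullet> b) *\<^sub>R \<Psi> b) = s *\<^sub>R e + \<Psi> z"
    proof -
      have "\<Psi> (\<Sum>b\<in>B. (z \<bullet> b) *\<^sub>R b) = (\<Sum>b\<in>B. (z \<bullet> b) *\<^sub>R \<Psi> b)"
        by (simp add: linear_sum[OF lin] linear_scale[OF lin])
      then have "\<Psi> z = (\<Sum>b\<in>B. (z \<bullet> b) *\<^sub>R \<Psi> b)" by (simp only: z_eq)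
      then show ?thesis by (simp add: sum.distrib s_def scaleR_sum_left)
    qed
    ultimately show "e + \<Psi> z \<in> C" by (simp add: algebra_simps)
  qed
qed

text \<open>Closedness is where the Archimedean property enters. For a limit \<open>l\<close> and
  \<open>r > 0\<close>, the vector \<open>r *\<^sub>R e + \<Psi> l\<close> is a member of the cone
  plus \<open>r\<close> times a point near \<open>e\<close>, and the latter is in the cone by
  \<open>unit_interior\<close>.\<close>

lemma pointed_cone_pull: "pointed_cone pull"
  unfolding pointed_cone_def
proof (intro conjI ballI impI)
  show "convex_cone pull"
    unfolding convex_cone_iff pull_def
    using convex_cone_contains_0[OF C_cone] convex_cone_add[OF C_cone] convex_cone_scaleR[OF C_cone]
    by (auto simp: linear_0[OF lin] linear_add[OF lin] linear_scale[OF lin]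
        intro: subspace_0[OF sub] subspace_add[OF sub] subspace_scale[OF sub])
  show "x = 0" if "x \<in> pull" "- x \<in> pull" for x
  proof -
    have "\<Psi> x = 0"
      using that archimedean_coneD(3)[OF arch, of "\<Psi> x"] by (simp add: pull_def linear_neg[OF lin])
    then show ?thesis
      using that(1) inj_onD[OF inj, of x 0] subspace_0[OF sub] by (simp add: pull_def linear_0[OF lin])
  qed
  show "closed pull"
    unfolding closed_sequential_limits
  proof (intro allI impI, elim conjE)
    fix y l assume y: "\<forall>n. y n \<in> pull" and l: "y \<longlonglongrightarrow> l"
    have "y n \<in> Y" for n using y by (auto simp: pull_def)
    then have lY: "l \<in> Y" using closed_sequentially[OF closed_subspace[OF sub] _ l] by blast
    obtain \<delta> where \<delta>: "0 < \<delta>" "\<And>z. z \<in> Y \<Longrightarrow> norm z \<le> \<delta> \<Longrightarrow> e + \<Psi> z \<in> C" using unit_interior by blast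
    have "\<Psi> l \<in> C"
    proof (rule archimedean_coneD(6)[OF arch Psi_sa[OF lY]])
      fix r :: real assume r: "r > 0"
      obtain n where n: "norm (y n - l) < r * \<delta>"
        using LIMSEQ_D[OF l, of "r * \<delta>"] r \<delta>(1) by auto
      let ?z = "(1 / r) *\<^sub>R (l - y n)"
      have yn: "y n \<in> Y" "\<Psi> (y n) \<in> C" using y by (auto simp: pull_def)
      have "?z \<in> Y" using lY yn(1) by (intro subspace_scale[OF sub] subspace_diff[OF sub])
      moreover have "norm ?z \<le> \<delta>"
      proof -
        have "norm ?z = norm (y n - l) / r" using r by (simp add: norm_minus_commute)
        then show ?thesis using n r by (simp add: pos_divide_le_eq mult.commute)
      qed
      ultimately have "r *\<^sub>R (e + \<Psi> ?z) \<in> C"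
        using \<delta>(2) r by (intro convex_cone_scaleR[OF C_cone]) auto
      then have "r *\<^sub>R (e + \<Psi> ?z) + \<Psi> (y n) \<in> C" using yn(2) by (rule convex_cone_add[OF C_cone])
      moreover have "r *\<^sub>R (e + \<Psi> ?z) = r *\<^sub>R e + \<Psi> l - \<Psi> (y n)"
        using r by (simp add: linear_scale[OF lin] linear_diff[OF lin] scaleR_add_right)
      ultimately show "r *\<^sub>R e + \<Psi> l \<in> C" by simp
    qed
    then show "l \<in> pull" using lY by (simp add: pull_def)
  qed
qed

lemma span_pull: "span pull = Y"
proof
  show "span pull \<subseteq> Y" using sub by (intro span_minimal) (auto simp: pull_def)
  show "Y \<subseteq> span pull"
  proof
    fix y assume y: "y \<in> Y"
    obtain r where r: "r > 0" "r *\<^sub>R e - \<Psi> y \<in> C" using archimedean_coneD(5)[OF arch Psi_sa[OF y]] by blast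
    let ?c = "coord e"
    have c: "?c \<in> Y" "\<Psi> ?c = e" using coord_in[OF e_sa] Psi_coord[OF e_sa] by auto
    have "?c \<in> pull" using c e_in_C by (simp add: pull_def)
    moreover have "r *\<^sub>R ?c - y \<in> pull"
      using c y r(2) by (simp add: pull_def linear_diff[OF lin] linear_scale[OF lin] subspace_diff[OF sub] subspace_scale[OF sub])
    ultimately have "r *\<^sub>R ?c - (r *\<^sub>R ?c - y) \<in> span pull" by (intro span_diff span_scale span_base)
    then show "y \<in> span pull" by simp
  qed
qed

lemma simplicial_pull:
  assumes "simplicial pull"
  shows "simplicial_cone_in selfadjoint C"
proof -
  obtain B where B: "independent B" "pull = convex_cone hull B" using assms by (auto simp: simplicial_def)
  have spanB: "span B = Y" using span_pull by (simp add: B(2) span_convex_cone_hull)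
  have "independent (\<Psi> ` B)" using linear_independent_injective_image[OF lin B(1)] spanB inj by simp
  moreover have "span (\<Psi> ` B) = selfadjoint" using linear_span_image[OF lin, of B] spanB image by simp
  moreover have "C = \<Psi> ` pull"
  proof
    show "C \<subseteq> \<Psi> ` pull"
    proof
      fix v assume "v \<in> C"
      then have "coord v \<in> pull" "\<Psi> (coord v) = v" using coord_in_pull Psi_coord C_sa by auto
      then show "v \<in> \<Psi> ` pull" by force
    qed
  qed (auto simp: pull_def)
  then have "C = convex_cone hull (\<Psi> ` B)" using convex_cone_hull_linear_image[OF lin] by (simp add: B(2))
  ultimately show ?thesis unfolding simplicial_cone_in_def by blast
qed

definition functional :: "'v \<Rightarrow> 'a \<Rightarrow> complex"
  where "functional s = complexify (\<lambda>v. s \<bullet> coord v)"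

lemma sa_linear_coord: "sa_linear (\<lambda>v. s \<bullet> coord v)"
  by (simp add: sa_linear_def coord_add coord_scale inner_add_right)

lemma clinear_functional: "clinear (functional s)"
  unfolding functional_def by (rule clinear_complexify[OF sa_linear_coord])

lemma functional_selfadjoint: "v \<in> selfadjoint \<Longrightarrow> functional s v = of_real (s \<bullet> coord v)"
  unfolding functional_def by (rule complexify_selfadjoint[OF sa_linear_coord])

lemma functional_in_dual_cone:
  assumes "w \<in> pdual pull"
  shows "functional w \<in> dual_cone C"
proof -
  have "0 \<le> functional w v" if "v \<in> C" for v
    using pdualD[OF assms coord_in_pull[OF that]] functional_selfadjoint[of v w] that C_sa
    by (auto simp: less_eq_complex_def)
  then show ?thesis using clinear_functional by (simp add: dual_cone_def)
qed

text \<open>This is \<open>bipolar\<close> in coordinates, tested with the functionals coming from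
  \<open>pdual pull\<close>.\<close>

lemma dual_cone_selfadjoint:
  assumes t: "t \<in> selfadjoint" and pos: "\<And>\<psi>. \<psi> \<in> dual_cone C \<Longrightarrow> 0 \<le> \<psi> t"
  shows "t \<in> C"
proof -
  have "coord t \<in> pull"
  proof (rule bipolar[OF pointed_cone_pull])
    show "coord t \<in> span pull" using coord_in[OF t] by (simp add: span_pull)
    fix w assume "w \<in> pdual pull"
    then have "0 \<le> functional w t" by (intro pos functional_in_dual_cone)
    then show "0 \<le> w \<bullet> coord t" by (simp add: functional_selfadjoint[OF t] less_eq_complex_def)
  qed
  then show ?thesis using Psi_coord[OF t] by (simp add: pull_def)
qed

text \<open>Every selfadjoint element is a difference of two members of \<open>C\<close>, so a
  positive functional is real there and is represented by the inner product.\<close>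

lemma dual_cone_coordinates:
  assumes \<phi>: "\<phi> \<in> dual_cone C"
  obtains w where "w \<in> pdual pull" "\<And>p. p \<in> Y \<Longrightarrow> \<phi> (\<Psi> p) = of_real (w \<bullet> p)"
proof -
  have clin: "clinear \<phi>" and pos: "\<And>y. y \<in> C \<Longrightarrow> 0 \<le> \<phi> y" using \<phi> by (auto simp: dual_cone_def)
  interpret p: Vector_Spaces.linear scaleC scaleC \<phi> by (rule clin)
  have scaleR: "\<phi> (r *\<^sub>R x) = of_real r * \<phi> x" for r x
    by (simp add: scaleR_scaleC p.scale)
  have real: "Im (\<phi> (\<Psi> y)) = 0" if y: "y \<in> Y" for y
  proof -
    obtain r where r: "r > 0" "r *\<^sub>R e - \<Psi> y \<in> C" using archimedean_coneD(5)[OF arch Psi_sa[OF y]] by blast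
    have "\<phi> (\<Psi> y) = of_real r * \<phi> e - \<phi> (r *\<^sub>R e - \<Psi> y)" by (simp add: p.diff scaleR)
    moreover have "Im (\<phi> e) = 0" "Im (\<phi> (r *\<^sub>R e - \<Psi> y)) = 0"
      using pos[OF e_in_C] pos[OF r(2)] by (auto simp: less_eq_complex_def)
    ultimately show ?thesis by simp
  qed
  let ?f = "\<lambda>y. Re (\<phi> (\<Psi> y))"
  have "linear ?f"
    by (intro linearI) (simp_all add: linear_add[OF lin] linear_scale[OF lin] p.add scaleR)
  \<comment> \<open>\<open>adjoint ?f 1\<close> is the Riesz vector of \<open>?f\<close>.\<close>
  then have adj: "adjoint ?f 1 \<bullet> y = ?f y" for y
    using adjoint_works[of ?f y 1] by (simp add: inner_commute)
  obtain w where w: "w \<in> span pull" "\<And>y. y \<in> span pull \<Longrightarrow> y \<bullet> w = y \<bullet> adjoint ?f 1"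
    using orthogonal_projection[of pull "adjoint ?f 1"] by blast
  have wy: "w \<bullet> y = ?f y" if "y \<in> Y" for y
    using w(2)[of y] that adj[of y] by (simp add: span_pull inner_commute)
  show thesis
  proof (rule that[of w])
    show "\<phi> (\<Psi> p) = of_real (w \<bullet> p)" if "p \<in> Y" for p
      using wy[OF that] real[OF that] by (simp add: complex_eq_iff)
    have "0 \<le> w \<bullet> y" if "y \<in> pull" for y
      using that wy[of y] pos[of "\<Psi> y"] by (auto simp: pull_def less_eq_complex_def)
    then show "w \<in> pdual pull" using w(1) by (simp add: pdual_def)
  qed
qed

end

section \<open>Separable and dual separable cones\<close>

lemma clinear_tensor_functional:
  fixes \<phi> :: "'a::complex_vector \<Rightarrow> complex" and \<psi> :: "'b::complex_vector \<Rightarrow> complex"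
  assumes "clinear \<phi>" "clinear \<psi>"
  shows "clinear (tensor_functional \<phi> \<psi>)"
  using theI'[OF tensor_functional_unique[OF assms]] by (simp add: tensor_functional_def)

lemma selfadjoint_sum: "(\<And>i. i \<in> I \<Longrightarrow> f i \<in> selfadjoint) \<Longrightarrow> sum f I \<in> (selfadjoint :: 'a::complex_star_vector set)"
  using subspace_sum[OF subspace_selfadjoint] by blast

lemma selfadjoint_tensor_mult: "a \<in> selfadjoint \<Longrightarrow> b \<in> selfadjoint \<Longrightarrow> a \<otimes>\<^sub>C b \<in> selfadjoint"
  by (simp add: selfadjoint_def star_tensor_mult)

lemma sep_cone_subset_dual_sep_cone:
  assumes "C \<subseteq> selfadjoint" "D \<subseteq> selfadjoint"
  shows "sep_cone C D \<subseteq> dual_sep_cone C D"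
proof
  fix x assume "x \<in> sep_cone C D"
  then obtain k :: nat and a b where x: "x = (\<Sum>j<k. a j \<otimes>\<^sub>C b j)" and ab: "\<forall>j<k. a j \<in> C" "\<forall>j<k. b j \<in> D"
    by (auto simp: sep_cone_def)
  have "0 \<le> tensor_functional \<phi> \<psi> x" if "\<phi> \<in> dual_cone C" "\<psi> \<in> dual_cone D" for \<phi> \<psi>
  proof -
    have lin: "clinear \<phi>" "clinear \<psi>" using that by (auto simp: dual_cone_def)
    interpret L: Vector_Spaces.linear scaleC scaleC "tensor_functional \<phi> \<psi>"
      by (rule clinear_tensor_functional[OF lin])
    have "tensor_functional \<phi> \<psi> x = (\<Sum>j<k. \<phi> (a j) * \<psi> (b j))"
      unfolding x by (simp add: L.sum tensor_functional_mult[OF lin])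
    also have "0 \<le> \<dots>" using that ab by (intro sum_nonneg mult_nonneg_nonneg) (auto simp: dual_cone_def)
    finally show ?thesis .
  qed
  moreover have "x \<in> selfadjoint"
    unfolding x using ab assms by (intro selfadjoint_sum selfadjoint_tensor_mult) auto
  ultimately show "x \<in> dual_sep_cone C D" by (simp add: dual_sep_cone_def)
qed

text \<open>\<open>Z\<close> becomes a tensor \<open>x\<close> and \<open>S\<close> a functional
  \<open>W\<close> on tensors. \<open>W\<close> takes the negative value \<open>pairing S Z\<close>
  at \<open>x\<close>, but is nonnegative on separable tensors.\<close>

lemma entangled_tensor:
  fixes \<Psi> :: "'v::euclidean_space \<Rightarrow> 'a::complex_star_vector" and \<Psi>' :: "'w::euclidean_space \<Rightarrow> 'b::complex_star_vector"
  assumes "coordinatized_cone \<Psi> Y C e" "coordinatized_cone \<Psi>' Y' D e'"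
    and ent: "entangleable (coordinatized_cone.pull \<Psi> Y C) (coordinatized_cone.pull \<Psi>' Y' D)"
  shows "sep_cone C D \<noteq> dual_sep_cone C D"
proof -
  interpret c: coordinatized_cone \<Psi> Y C e by fact
  interpret d: coordinatized_cone \<Psi>' Y' D e' by fact
  obtain Z S where Z: "set Z \<subseteq> Y \<times> Y'" and S: "set S \<subseteq> Y \<times> Y'"
    and Zpos: "\<And>\<phi> \<psi>. \<phi> \<in> pdual c.pull \<Longrightarrow> \<psi> \<in> pdual d.pull \<Longrightarrow> 0 \<le> ev Z \<phi> \<psi>"
    and Spos: "\<And>a b. a \<in> c.pull \<Longrightarrow> b \<in> d.pull \<Longrightarrow> 0 \<le> ev S a b" and neg: "pairing S Z < 0"
    using entangleableE[OF ent] unfolding c.span_pull d.span_pull by blast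
  define x where "x = (\<Sum>(p, q)\<leftarrow>Z. \<Psi> p \<otimes>\<^sub>C \<Psi>' q)"
  have val: "tensor_functional \<phi> \<psi> x = of_real (ev Z w w')"
    if lin: "clinear \<phi>" "clinear \<psi>" and w: "\<And>p. p \<in> Y \<Longrightarrow> \<phi> (\<Psi> p) = of_real (w \<bullet> p)"
      "\<And>p. p \<in> Y' \<Longrightarrow> \<psi> (\<Psi>' p) = of_real (w' \<bullet> p)" for \<phi> \<psi> w w'
  proof -
    interpret L: Vector_Spaces.linear scaleC scaleC "tensor_functional \<phi> \<psi>"
      by (rule clinear_tensor_functional[OF lin])
    show ?thesis
      unfolding x_def using Z
      by (induction Z) (auto simp: L.zero L.add tensor_functional_mult[OF lin] w inner_commute)
  qed
  have "x \<in> selfadjoint"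
    unfolding x_def using Z
  proof (induction Z)
    case (Cons pq Z)
    then have "\<Psi> (fst pq) \<otimes>\<^sub>C \<Psi>' (snd pq) \<in> selfadjoint"
      by (intro selfadjoint_tensor_mult c.Psi_sa d.Psi_sa) auto
    then show ?case
      using Cons by (simp add: case_prod_unfold subspace_add[OF subspace_selfadjoint])
  qed (simp add: subspace_0[OF subspace_selfadjoint])
  moreover have "0 \<le> tensor_functional \<phi> \<psi> x" if \<phi>: "\<phi> \<in> dual_cone C" and \<psi>: "\<psi> \<in> dual_cone D" for \<phi> \<psi>
  proof -
    obtain w where w: "w \<in> pdual c.pull" "\<And>p. p \<in> Y \<Longrightarrow> \<phi> (\<Psi> p) = of_real (w \<bullet> p)"
      using c.dual_cone_coordinates[OF \<phi>] by blast
    obtain w' where w': "w' \<in> pdual d.pull" "\<And>p. p \<in> Y' \<Longrightarrow> \<psi> (\<Psi>' p) = of_real (w' \<bullet> p)"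
      using d.dual_cone_coordinates[OF \<psi>] by blast
    have "tensor_functional \<phi> \<psi> x = of_real (ev Z w w')"
      using \<phi> \<psi> by (intro val w(2) w'(2)) (auto simp: dual_cone_def)
    then show ?thesis using Zpos[OF w(1) w'(1)] by (simp add: less_eq_complex_def)
  qed
  ultimately have "x \<in> dual_sep_cone C D" by (simp add: dual_sep_cone_def)
  moreover have "x \<notin> sep_cone C D"
  proof
    assume "x \<in> sep_cone C D"
    then obtain k :: nat and a b where x: "x = (\<Sum>j<k. a j \<otimes>\<^sub>C b j)" and ab: "\<forall>j<k. a j \<in> C" "\<forall>j<k. b j \<in> D"
      by (auto simp: sep_cone_def)
    define W where "W y = (\<Sum>(s, t)\<leftarrow>S. tensor_functional (c.functional s) (d.functional t) y)" for y
    have "W x = of_real (pairing S Z)"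
    proof -
      have tf: "tensor_functional (c.functional s) (d.functional t) x = of_real (ev Z s t)" for s t
        by (intro val c.clinear_functional d.clinear_functional)
          (simp_all add: c.functional_selfadjoint[OF c.Psi_sa] d.functional_selfadjoint[OF d.Psi_sa] c.coord_Psi d.coord_Psi)
      have "(\<Sum>(s, t)\<leftarrow>S. of_real (ev Z s t)) = (of_real (pairing S Z) :: complex)" for S
        by (induction S) auto
      then show ?thesis by (simp add: W_def tf)
    qed
    moreover have "W x = (\<Sum>j<k. of_real (ev S (c.coord (a j)) (d.coord (b j))))"
    proof -
      have tf: "tensor_functional (c.functional s) (d.functional t) x =
          (\<Sum>j<k. of_real ((s \<bullet> c.coord (a j)) * (t \<bullet> d.coord (b j))))" for s t
      proof -
        interpret L: Vector_Spaces.linear scaleC scaleC "tensor_functional (c.functional s) (d.functional t)"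
          by (rule clinear_tensor_functional[OF c.clinear_functional d.clinear_functional])
        have "c.functional s (a j) * d.functional t (b j) = of_real ((s \<bullet> c.coord (a j)) * (t \<bullet> d.coord (b j)))"
          if "j < k" for j
          using ab that c.C_sa d.C_sa by (simp add: c.functional_selfadjoint d.functional_selfadjoint subset_iff)
        then show ?thesis
          unfolding x L.sum tensor_functional_mult[OF c.clinear_functional d.clinear_functional]
          by (intro sum.cong) auto
      qed
      have "(\<Sum>(s, t)\<leftarrow>S. \<Sum>j<k. of_real ((s \<bullet> c.coord (a j)) * (t \<bullet> d.coord (b j)))) =
          (\<Sum>j<k. of_real (ev S (c.coord (a j)) (d.coord (b j))) :: complex)" for S
        by (induction S) (auto simp: sum.distrib)
      then show ?thesis by (simp add: W_def tf)
    qed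
    ultimately have "(of_real (pairing S Z) :: complex) = of_real (\<Sum>j<k. ev S (c.coord (a j)) (d.coord (b j)))"
      by simp
    then have "pairing S Z = (\<Sum>j<k. ev S (c.coord (a j)) (d.coord (b j)))"
      by (simp only: of_real_eq_iff)
    also have "\<dots> \<ge> 0"
      using ab by (intro sum_nonneg Spos c.coord_in_pull d.coord_in_pull) auto
    finally show False using neg by simp
  qed
  ultimately show ?thesis by blast
qed

text \<open>Stated for an abstract bilinear map, so that it applies to both factors of the tensor product.\<close>

lemma separable_of_simplicial_factor:
  fixes bil :: "'a::complex_star_vector \<Rightarrow> 'b::complex_star_vector \<Rightarrow> 't::complex_star_vector"
    and F :: "('a \<Rightarrow> complex) \<Rightarrow> ('b \<Rightarrow> complex) \<Rightarrow> 't \<Rightarrow> complex"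
  assumes fin: "finite B0" "span B0 = (selfadjoint :: 'a set)" and simp: "simplicial_cone_in selfadjoint C"
    and D: "\<And>t. t \<in> selfadjoint \<Longrightarrow> (\<And>\<psi>. \<psi> \<in> dual_cone D \<Longrightarrow> 0 \<le> \<psi> t) \<Longrightarrow> t \<in> D"
    and add_left: "\<And>a a' b. bil (a + a') b = bil a b + bil a' b"
    and add_right: "\<And>a b b'. bil a (b + b') = bil a b + bil a b'"
    and scale: "\<And>c a b. bil (c *\<^sub>C a) b = bil a (c *\<^sub>C b)" "\<And>c a b. bil a (c *\<^sub>C b) = c *\<^sub>C bil a b"
    and star: "\<And>a b. star (bil a b) = bil (star a) (star b)"
    and gen: "\<exists>Z. x = (\<Sum>(a, b)\<leftarrow>Z. bil a b)"
    and F: "\<And>\<phi> \<psi>. clinear \<phi> \<Longrightarrow> clinear \<psi> \<Longrightarrow> clinear (F \<phi> \<psi>)"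
      "\<And>\<phi> \<psi> a b. clinear \<phi> \<Longrightarrow> clinear \<psi> \<Longrightarrow> F \<phi> \<psi> (bil a b) = \<phi> a * \<psi> b"
    and x: "x \<in> selfadjoint"
    and pos: "\<And>\<phi> \<psi>. \<phi> \<in> dual_cone C \<Longrightarrow> \<psi> \<in> dual_cone D \<Longrightarrow> 0 \<le> F \<phi> \<psi> x"
  shows "\<exists>(k::nat) a b. x = (\<Sum>j<k. bil (a j) (b j)) \<and> (\<forall>j<k. a j \<in> C) \<and> (\<forall>j<k. b j \<in> D)"
proof -
  obtain B where B: "independent B" "span B = selfadjoint" "C = convex_cone hull B"
    using simp by (auto simp: simplicial_cone_in_def)
  have "B \<subseteq> span B0" using span_superset[of B] B(2) fin(2) by simp
  then have finB: "finite B" using real_vector.independent_span_bound[OF fin(1) B(1)] by blast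
  have B_sa: "b \<in> selfadjoint" if "b \<in> B" for b using span_base[OF that] B(2) by simp
  define r where "r b v = real_vector.representation B v b" for b v
  have r_lin: "sa_linear (r b)" for b
    unfolding sa_linear_def r_def
    using real_vector.representation_add[OF B(1)] real_vector.representation_scale[OF B(1)] B(2) by auto
  have r_sum: "(\<Sum>b\<in>B. r b v *\<^sub>R b) = v" if "v \<in> selfadjoint" for v
    unfolding r_def using real_vector.sum_representation_eq[OF B(1) _ finB subset_refl] B(2) that by simp
  have r_basis: "r b b' = (if b = b' then 1 else 0)" if "b' \<in> B" for b b'
    unfolding r_def using real_vector.representation_basis[OF B(1) that] by simp
  define \<beta> where "\<beta> b = complexify (r b)" for b
  have \<beta>_lin: "clinear (\<beta> b)" for b unfolding \<beta>_def by (rule clinear_complexify[OF r_lin])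
  have \<beta>_sa: "\<beta> b v = of_real (r b v)" if "v \<in> selfadjoint" for b v
    unfolding \<beta>_def by (rule complexify_selfadjoint[OF r_lin that])
  have \<beta>_sum: "(\<Sum>b\<in>B. \<beta> b a *\<^sub>C b) = a" for a
  proof -
    have "(\<Sum>b\<in>B. \<beta> b a *\<^sub>C b) = (\<Sum>b\<in>B. r b (re_part a) *\<^sub>R b) + \<i> *\<^sub>C (\<Sum>b\<in>B. r b (im_part a) *\<^sub>R b)"
      by (simp add: \<beta>_def complexify_def scaleC_add_left scaleR_scaleC scaleC_scaleC sum.distrib complex_vector.scale_sum_right)
    also have "\<dots> = re_part a + \<i> *\<^sub>C im_part a"
      by (simp only: r_sum[OF re_part_selfadjoint] r_sum[OF im_part_selfadjoint])
    finally show ?thesis by (simp only: re_im_decomposition[symmetric])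
  qed
  have bil_0: "bil a 0 = 0" "bil 0 b = 0" for a b
    using add_right[of a 0 0] add_left[of 0 0 b] by simp_all
  have bil_sum: "bil (sum f B) b = (\<Sum>i\<in>B. bil (f i) b)" for f b
    by (induction B rule: infinite_finite_induct) (simp_all add: add_left bil_0)
  obtain Z where Z: "x = (\<Sum>(a, b)\<leftarrow>Z. bil a b)" using gen by blast
  \<comment> \<open>Expanding first factors along \<open>B\<close> gathers everything into one
    second factor per basis vector.\<close>
  have "\<exists>t. (\<Sum>(a, b)\<leftarrow>Z. bil a b) = (\<Sum>b\<in>B. bil b (t b))" for Z
  proof (induction Z)
    case Nil
    then show ?case by (intro exI[of _ "\<lambda>_. 0"]) (simp add: bil_0)
  next
    case (Cons p Z)
    then obtain t where t: "(\<Sum>(a, b)\<leftarrow>Z. bil a b) = (\<Sum>b\<in>B. bil b (t b))" by blast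
    obtain a c where p: "p = (a, c)" by (cases p)
    have "bil a c = bil (\<Sum>b\<in>B. \<beta> b a *\<^sub>C b) c" by (simp only: \<beta>_sum)
    also have "\<dots> = (\<Sum>b\<in>B. bil b (\<beta> b a *\<^sub>C c))" by (simp only: bil_sum scale(1))
    finally have "(\<Sum>(a, b)\<leftarrow>p # Z. bil a b) = (\<Sum>b\<in>B. bil b (\<beta> b a *\<^sub>C c + t b))"
      by (simp add: p t add_right sum.distrib)
    then show ?case by (intro exI[of _ "\<lambda>b. \<beta> b a *\<^sub>C c + t b"])
  qed
  then obtain t where t: "x = (\<Sum>b\<in>B. bil b (t b))" using Z by blast
  \<comment> \<open>Members of \<open>B\<close> are selfadjoint, so the involution acts on the
    second factors alone; averaging \<open>x\<close> with \<open>star x\<close> replaces these by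
    their real parts.\<close>
  have t': "x = (\<Sum>b\<in>B. bil b (re_part (t b)))"
  proof -
    have "star x = (\<Sum>b\<in>B. bil b (star (t b)))"
      unfolding t star_sum by (intro sum.cong refl) (use B_sa in \<open>simp add: star selfadjoint_def\<close>)
    then have "re_part x = (\<Sum>b\<in>B. bil b (re_part (t b)))"
      unfolding re_part_def by (simp add: t[symmetric] add_right scale(2) complex_vector.scale_sum_right[symmetric] sum.distrib)
    then show ?thesis using re_part_of_selfadjoint[OF x] by simp
  qed
  have \<beta>_dual: "\<beta> b \<in> dual_cone C" if b: "b \<in> B" for b
  proof -
    have "0 \<le> \<beta> b c" if "c \<in> C" for c
    proof -
      obtain \<gamma> where \<gamma>: "c = (\<Sum>b\<in>B. \<gamma> b *\<^sub>R b)" "\<forall>b\<in>B. (0::real) \<le> \<gamma> b"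
        using \<open>c \<in> C\<close> unfolding B(3) convex_cone_hull_finite[OF finB] by blast
      interpret L: Vector_Spaces.linear scaleC scaleC "\<beta> b" by (rule \<beta>_lin)
      have "\<beta> b c = (\<Sum>b'\<in>B. of_real (\<gamma> b') * \<beta> b b')"
        unfolding \<gamma>(1) by (simp add: L.sum scaleR_scaleC L.scale)
      also have "\<dots> = (\<Sum>b'\<in>B. if b' = b then of_real (\<gamma> b) else 0)"
        by (intro sum.cong refl) (auto simp: \<beta>_sa[OF B_sa] r_basis)
      also have "\<dots> = of_real (\<gamma> b)" using finB b by simp
      finally show ?thesis using \<gamma>(2) b by (simp add: less_eq_complex_def)
    qed
    then show ?thesis using \<beta>_lin by (simp add: dual_cone_def)
  qed
  \<comment> \<open>Testing \<open>x\<close> with the coordinate functional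
    \<open>\<beta> b\<close>, positive on \<open>C\<close>, isolates the second factor at
    \<open>b\<close>.\<close>
  have t_in_D: "re_part (t b) \<in> D" if b: "b \<in> B" for b
  proof (rule D[OF re_part_selfadjoint])
    fix \<psi> assume \<psi>: "\<psi> \<in> dual_cone D"
    then have lin: "clinear \<psi>" by (simp add: dual_cone_def)
    interpret L: Vector_Spaces.linear scaleC scaleC "F (\<beta> b) \<psi>" by (rule F(1)[OF \<beta>_lin lin])
    have "F (\<beta> b) \<psi> x = (\<Sum>b'\<in>B. \<beta> b b' * \<psi> (re_part (t b')))"
      unfolding t' L.sum F(2)[OF \<beta>_lin lin] ..
    also have "\<dots> = (\<Sum>b'\<in>B. if b' = b then \<psi> (re_part (t b)) else 0)"
      by (intro sum.cong refl) (auto simp: \<beta>_sa[OF B_sa] r_basis)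
    also have "\<dots> = \<psi> (re_part (t b))" using finB b by simp
    finally show "0 \<le> \<psi> (re_part (t b))" using pos[OF \<beta>_dual[OF b] \<psi>] by simp
  qed
  obtain h where h: "bij_betw h {0..<card B} B" using ex_bij_betw_nat_finite[OF finB] by blast
  have h': "bij_betw h {..<card B} B" using h by (simp add: atLeast0LessThan)
  have hB: "h j \<in> B" if "j < card B" for j using bij_betwE[OF h'] that by blast
  have "x = (\<Sum>j<card B. bil (h j) (re_part (t (h j))))"
    using sum.reindex_bij_betw[OF h', of "\<lambda>b. bil b (re_part (t b))"] t' by simp
  moreover have "h j \<in> C" if "j < card B" for j using hB[OF that] by (simp add: B(3) hull_inc)
  ultimately show ?thesis using t_in_D hB
    by (intro exI[of _ "card B"] exI[of _ h] exI[of _ "\<lambda>j. re_part (t (h j))"]) blast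
qed

lemma tensor_sum_of_products: "\<exists>Z. x = (\<Sum>(a, b)\<leftarrow>Z. a \<otimes>\<^sub>C b)"
proof (induction x rule: tensor_induct)
  case zero
  show ?case by (rule exI[of _ "[]"]) simp
next
  case (add c a b x)
  then obtain Z where "x = (\<Sum>(a, b)\<leftarrow>Z. a \<otimes>\<^sub>C b)" by blast
  then show ?case by (intro exI[of _ "(c *\<^sub>C a, b) # Z"]) (simp add: tensor_mult_scaleC_left)
qed

lemma dual_sep_cone_subset_sep_cone:
  fixes C :: "'a::complex_star_vector set" and D :: "'b::complex_star_vector set"
    and B :: "'a set" and B' :: "'b set"
  assumes "coordinatized_cone \<Psi> Y C e" "coordinatized_cone \<Psi>' Y' D e'"
    and fin: "finite B" "span B = selfadjoint" "finite B'" "span B' = selfadjoint"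
    and simp: "simplicial_cone_in selfadjoint C \<or> simplicial_cone_in selfadjoint D"
  shows "dual_sep_cone C D \<subseteq> sep_cone C D"
proof
  interpret c: coordinatized_cone \<Psi> Y C e by fact
  interpret d: coordinatized_cone \<Psi>' Y' D e' by fact
  fix x assume "x \<in> dual_sep_cone C D"
  then have x: "x \<in> selfadjoint"
    and pos: "\<And>\<phi> \<psi>. \<phi> \<in> dual_cone C \<Longrightarrow> \<psi> \<in> dual_cone D \<Longrightarrow> 0 \<le> tensor_functional \<phi> \<psi> x"
    by (auto simp: dual_sep_cone_def)
  from simp have "\<exists>(k::nat) a b. x = (\<Sum>j<k. a j \<otimes>\<^sub>C b j) \<and> (\<forall>j<k. a j \<in> C) \<and> (\<forall>j<k. b j \<in> D)"
  proof
    assume s: "simplicial_cone_in selfadjoint C"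
    show ?thesis
      by (rule separable_of_simplicial_factor[where bil = "(\<otimes>\<^sub>C)" and F = tensor_functional, OF fin(1,2) s])
        (simp_all add: d.dual_cone_selfadjoint tensor_mult_add_left tensor_mult_add_right tensor_mult_scaleC_left
          tensor_mult_scaleC_right star_tensor_mult tensor_sum_of_products clinear_tensor_functional
          tensor_functional_mult x pos)
  next
    assume s: "simplicial_cone_in selfadjoint D"
    have "\<exists>Z. x = (\<Sum>(b, a)\<leftarrow>Z. a \<otimes>\<^sub>C b)"
    proof -
      obtain Z where "x = (\<Sum>(a, b)\<leftarrow>Z. a \<otimes>\<^sub>C b)" using tensor_sum_of_products by blast
      moreover have "(\<Sum>(b, a)\<leftarrow>map prod.swap Z. a \<otimes>\<^sub>C b) = (\<Sum>(a, b)\<leftarrow>Z. a \<otimes>\<^sub>C b)" for Z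
        by (induction Z) auto
      ultimately show ?thesis by metis
    qed
    then have "\<exists>(k::nat) b a. x = (\<Sum>j<k. a j \<otimes>\<^sub>C b j) \<and> (\<forall>j<k. b j \<in> D) \<and> (\<forall>j<k. a j \<in> C)"
      by (intro separable_of_simplicial_factor[where bil = "\<lambda>b a. a \<otimes>\<^sub>C b" and F = "\<lambda>\<psi> \<phi>. tensor_functional \<phi> \<psi>",
            OF fin(3,4) s])
        (simp_all add: c.dual_cone_selfadjoint tensor_mult_add_left tensor_mult_add_right tensor_mult_scaleC_left
          tensor_mult_scaleC_right star_tensor_mult clinear_tensor_functional
          tensor_functional_mult x pos mult.commute)
    then show ?thesis by blast
  qed
  then show "x \<in> sep_cone C D" by (auto simp: sep_cone_def)
qed

theorem theorem1p3:
  fixes R :: "nat \<Rightarrow> 'a::complex_star_vector mat set" and eR :: 'a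
    and T :: "nat \<Rightarrow> 'b::complex_star_vector mat set" and eT :: 'b
  assumes "fin_dim_operator_system R eR" and "fin_dim_operator_system T eT"
  shows "sep_cone (base_cone R) (base_cone T) = dual_sep_cone (base_cone R) (base_cone T) \<longleftrightarrow>
    simplicial_cone_in selfadjoint (base_cone R) \<or> simplicial_cone_in selfadjoint (base_cone T)"
proof -
  interpret r: fin_dim_operator_system R eR by fact
  interpret t: fin_dim_operator_system T eT by fact
  have arch: "archimedean_cone (base_cone R) eR" "archimedean_cone (base_cone T) eT"
    using base_cone_archimedean r.operator_system_axioms t.operator_system_axioms by blast+
  obtain B :: "'a set" where B: "finite B" "independent B" "span B = selfadjoint"
    using r.fin_dim selfadjoint_finite_basis by metis
  obtain B' :: "'b set" where B': "finite B'" "independent B'" "span B' = selfadjoint"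
    using t.fin_dim selfadjoint_finite_basis by metis
  obtain \<Psi> :: "real ^ 'a sa_index \<Rightarrow> 'a" and Y where \<Psi>: "linear \<Psi>" "subspace Y" "inj_on \<Psi> Y" "\<Psi> ` Y = selfadjoint"
    using selfadjoint_coordinates B by blast
  obtain \<Psi>' :: "real ^ 'b sa_index \<Rightarrow> 'b" and Y' where \<Psi>': "linear \<Psi>'" "subspace Y'" "inj_on \<Psi>' Y'" "\<Psi>' ` Y' = selfadjoint"
    using selfadjoint_coordinates B' by blast
  have c: "coordinatized_cone \<Psi> Y (base_cone R) eR" using \<Psi> arch(1) by (rule coordinatized_cone.intro)
  have d: "coordinatized_cone \<Psi>' Y' (base_cone T) eT" using \<Psi>' arch(2) by (rule coordinatized_cone.intro)
  interpret c: coordinatized_cone \<Psi> Y "base_cone R" eR by (rule c)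
  interpret d: coordinatized_cone \<Psi>' Y' "base_cone T" eT by (rule d)
  show ?thesis
  proof
    assume eq: "sep_cone (base_cone R) (base_cone T) = dual_sep_cone (base_cone R) (base_cone T)"
    show "simplicial_cone_in selfadjoint (base_cone R) \<or> simplicial_cone_in selfadjoint (base_cone T)"
    proof (rule ccontr)
      assume "\<not> ?thesis"
      then have "\<not> simplicial c.pull" "\<not> simplicial d.pull"
        using c.simplicial_pull d.simplicial_pull by blast+
      then have "entangleable c.pull d.pull"
        by (rule entangleable_nonsimplicial[OF c.pointed_cone_pull d.pointed_cone_pull])
      then show False using entangled_tensor[OF c d] eq by blast
    qed
  next
    assume "simplicial_cone_in selfadjoint (base_cone R) \<or> simplicial_cone_in selfadjoint (base_cone T)"
    then have "dual_sep_cone (base_cone R) (base_cone T) \<subseteq> sep_cone (base_cone R) (base_cone T)"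
      by (rule dual_sep_cone_subset_sep_cone[OF c d B(1,3) B'(1,3)])
    then show "sep_cone (base_cone R) (base_cone T) = dual_sep_cone (base_cone R) (base_cone T)"
      using sep_cone_subset_dual_sep_cone[OF c.C_sa d.C_sa] by blast
  qed
qed


end
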